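(* Let $Q$ be a locally compact group and let $G_1,G_2$ be almost unimodular groups. Suppose $\theta_j\colon G_j\to Q$, $j=1,2$, are open, continuous homomorphisms. If $Q$ is almost unimodular, then $\{(s_1,s_2)\in G_1\times G_2\colon\theta_1(s_1)=\theta_2(s_2)\}$ is an almost unimodular group. If $\theta_1,\theta_2$ are surjective, then the converse holds.
   Context: Locally compact groups are Hausdorff. $\Delta_G\colon G\to\mathbb{R}_+=(0,\infty)$ is the modular function of a locally compact group $G$, $\mu_G(E\cdot s)=\Delta_G(s)\mu_G(E)$ for a left Haar measure $\mu_G$. $G$ is almost unimodular if $\ker\Delta_G$ is open in $G$. The fiber product is a closed subgroup of $G_1\times G_2$ with the subspace topology. *)

theory Defs
  imports "HOL-Analysis.Analysis" "HOL-Algebra.Coset"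
begin

locale locally_compact_group = group G for G (structure) and T +
  assumes topspace_eq_carrier: "topspace T = carrier G"
    and continuous_mult: "continuous_map (prod_topology T T) T (\<lambda>(x, y). x \<otimes> y)"
    and continuous_inv: "continuous_map T T (\<lambda>x. inv x)"
    and Hausdorff: "Hausdorff_space T"
    and locally_compact: "locally_compact_space T"

text \<open>Radon measures on a locally compact Hausdorff space, in the convention: Borel, finite on
  compact sets, outer regular on Borel sets, inner regular on open sets.\<close>

definition radon_measure :: "'a topology \<Rightarrow> 'a measure \<Rightarrow> bool" where
  "radon_measure T \<mu> \<longleftrightarrow>
     space \<mu> = topspace T \<and>
     sets \<mu> = sigma_sets (topspace T) {U. openin T U} \<and>
     (\<forall>K. compactin T K \<longrightarrow> emeasure \<mu> K < \<infinity>) \<and>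
     (\<forall>E\<in>sets \<mu>. emeasure \<mu> E = (INF U\<in>{U. openin T U \<and> E \<subseteq> U}. emeasure \<mu> U)) \<and>
     (\<forall>U. openin T U \<longrightarrow> emeasure \<mu> U = (SUP K\<in>{K. compactin T K \<and> K \<subseteq> U}. emeasure \<mu> K))"

definition left_haar_measure ::
    "('a, 'm) monoid_scheme \<Rightarrow> 'a topology \<Rightarrow> 'a measure \<Rightarrow> bool" where
  "left_haar_measure G T \<mu> \<longleftrightarrow>
     radon_measure T \<mu> \<and> emeasure \<mu> (space \<mu>) \<noteq> 0 \<and>
     (\<forall>s\<in>carrier G. \<forall>E\<in>sets \<mu>. emeasure \<mu> (s <#\<^bsub>G\<^esub> E) = emeasure \<mu> E)"

text \<open>A left Haar measure exists and is unique up to a positive scalar, so the number described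
  here exists, is unique, and does not depend on \<open>\<mu>\<close>.\<close>

definition modular_function ::
    "('a, 'm) monoid_scheme \<Rightarrow> 'a topology \<Rightarrow> 'a \<Rightarrow> real" where
  "modular_function G T s =
     (THE c. 0 < c \<and>
        (\<forall>\<mu>. left_haar_measure G T \<mu> \<longrightarrow>
           (\<forall>E\<in>sets \<mu>. emeasure \<mu> (E #>\<^bsub>G\<^esub> s) = ennreal c * emeasure \<mu> E)))"

definition modular_kernel :: "('a, 'm) monoid_scheme \<Rightarrow> 'a topology \<Rightarrow> 'a set" where
  "modular_kernel G T = {s \<in> carrier G. modular_function G T s = 1}"

definition almost_unimodular :: "('a, 'm) monoid_scheme \<Rightarrow> 'a topology \<Rightarrow> bool" where
  "almost_unimodular G T \<longleftrightarrow>
     locally_compact_group G T \<and> openin T (modular_kernel G T)"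

definition fiber_set ::
    "('a, 'm) monoid_scheme \<Rightarrow> ('b, 'n) monoid_scheme \<Rightarrow> ('a \<Rightarrow> 'c) \<Rightarrow> ('b \<Rightarrow> 'c) \<Rightarrow> ('a \<times> 'b) set"
  where "fiber_set G\<^sub>1 G\<^sub>2 \<theta>\<^sub>1 \<theta>\<^sub>2 =
     {(s\<^sub>1, s\<^sub>2). s\<^sub>1 \<in> carrier G\<^sub>1 \<and> s\<^sub>2 \<in> carrier G\<^sub>2 \<and> \<theta>\<^sub>1 s\<^sub>1 = \<theta>\<^sub>2 s\<^sub>2}"

definition fiber_product ::
    "('a, 'm) monoid_scheme \<Rightarrow> ('b, 'n) monoid_scheme \<Rightarrow> ('a \<Rightarrow> 'c) \<Rightarrow> ('b \<Rightarrow> 'c) \<Rightarrow> ('a \<times> 'b) monoid"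
  where "fiber_product G\<^sub>1 G\<^sub>2 \<theta>\<^sub>1 \<theta>\<^sub>2 =
     (G\<^sub>1 \<times>\<times> G\<^sub>2)\<lparr>carrier := fiber_set G\<^sub>1 G\<^sub>2 \<theta>\<^sub>1 \<theta>\<^sub>2\<rparr>"

end

theory Submission
  imports Defs
begin

text \<open>Write \<open>P\<close> for the fiber product. It is the stabiliser of \<open>1 \<in> Q\<close> for the action of
  \<open>G\<^sub>1 \<times> G\<^sub>2\<close> on \<open>Q\<close> by \<open>(s\<^sub>1, s\<^sub>2) q = \<theta>\<^sub>1(s\<^sub>1) q \<theta>\<^sub>2(s\<^sub>2)\<^sup>-\<^sup>1\<close>, and the orbit of \<open>1\<close> is clopen. Left Haar measure on
  \<open>Q\<close> is relatively invariant for this action, with character \<open>\<Delta>\<^sub>Q(\<theta>\<^sub>2(s\<^sub>2))\<close>. Integrating a function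
  on \<open>G\<^sub>1 \<times> G\<^sub>2\<close> first over the cosets of \<open>P\<close> and then over \<open>Q\<close>, twisted by this character, is
  therefore a left Haar integral on \<open>G\<^sub>1 \<times> G\<^sub>2\<close>; comparing right translations by \<open>p \<in> P\<close> gives
  \<open>\<Delta>\<^sub>1(p\<^sub>1) \<Delta>\<^sub>2(p\<^sub>2) = \<Delta>\<^sub>Q(\<theta>\<^sub>2(p\<^sub>2)) \<Delta>\<^sub>P(p)\<close>. Both implications follow, because a kernel is open as soon as
  it contains a neighbourhood of the identity. Haar measure is obtained from covering numbers, and
  all comparisons take place between positive functionals on \<open>C\<^sub>c\<close>, where iterated integrals can be
  exchanged without any countability assumption.\<close>

section \<open>Positive functionals on compactly supported functions\<close>

text \<open>\<open>modular_function\<close> is a definite description over all left Haar measures: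
  without existence its clause would be vacuous, and without uniqueness up to scale no single
  constant would be singled out. Hence a full Haar theory stands between the definitions and the
  formula. Measures occur only at its ends: a Haar measure gives the functional of its integral, and
  regularity carries a scaling constant back to Borel sets. The rest lives on \<open>cc\<close>,
  because without sigma-compactness the Borel sets of a product may exceed the product sigma-algebra
  and Fubini for measures is not at hand. Openness of the homomorphisms acts twice. It makes the
  orbit map open and the orbit clopen, so that integrals over cosets of \<open>P\<close> descend to
  continuous functions on \<open>Q\<close>, extended by zero. It also drives the converse: for small
  neighbourhoods \<open>A\<close>, \<open>B\<close> of the identities, each point of the open set
  \<alpha>(A) \<inter> \<beta>(B) comes from a pair in \<open>P\<close>, where the formula can be
  solved for the modulus of \<open>Q\<close>. Only one homomorphism enters the character, since the
  other acts on \<open>Q\<close> by left translations, which preserve Haar measure.\<close>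

lemma continuous_map_real_iff:
  "continuous_map X euclideanreal f \<longleftrightarrow>
     (\<forall>x\<in>topspace X. \<forall>e>0. \<exists>U. openin X U \<and> x \<in> U \<and> (\<forall>y\<in>U. \<bar>f y - f x\<bar> < e))"
  using Met_TC.continuous_map_to_metric[of X f]
  by (simp add: mtopology_is_euclidean dist_real_def abs_minus_commute)

lemma compactin_pointwise_cover:
  assumes K: "compactin X K" and V: "\<And>x. x \<in> K \<Longrightarrow> openin X (V x)" "\<And>x. x \<in> K \<Longrightarrow> x \<in> V x"
  obtains D where "finite D" "D \<subseteq> K" "K \<subseteq> \<Union>(V ` D)"
proof -
  obtain \<F> where "finite \<F>" "\<F> \<subseteq> V ` K" "K \<subseteq> \<Union>\<F>"
    using compactinD[OF K, of "V ` K"] V by blast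
  then show thesis
    using finite_subset_image that by metis
qed

lemma compact_sandwich:
  assumes X: "locally_compact_space X" "Hausdorff_space X"
    and K: "compactin X K" and U: "openin X U" "K \<subseteq> U"
  obtains V L where "openin X V" "compactin X L" "K \<subseteq> V" "V \<subseteq> L" "L \<subseteq> U"
proof -
  have nb: "neighbourhood_base_of (compactin X) X"
    using X locally_compact_space_neighbourhood_base by blast
  have "\<exists>V L. openin X V \<and> compactin X L \<and> x \<in> V \<and> V \<subseteq> L \<and> L \<subseteq> U" if "x \<in> K" for x
    using nb U that unfolding neighbourhood_base_of by blast
  then obtain V L where VL: "\<And>x. x \<in> K \<Longrightarrow> openin X (V x) \<and> compactin X (L x) \<and> x \<in> V x \<and> V x \<subseteq> L x \<and> L x \<subseteq> U"
    by metis
  then obtain D where D: "finite D" "D \<subseteq> K" "K \<subseteq> \<Union> (V ` D)"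
    using compactin_pointwise_cover[OF K, of V] by metis
  show thesis
  proof
    show "openin X (\<Union>(V ` D))" using D VL by blast
    show "compactin X (\<Union>(L ` D))" using D VL by (intro compactin_Union) auto
    show "K \<subseteq> \<Union>(V ` D)" by (fact D)
    show "\<Union>(V ` D) \<subseteq> \<Union>(L ` D)" "\<Union>(L ` D) \<subseteq> U" using D VL by blast+
  qed
qed

text \<open>The space $C_c(X)$; values outside \<open>topspace X\<close> are unconstrained, so functionals must
  depend only on the values on \<open>topspace X\<close>.\<close>

definition cc :: "'a topology \<Rightarrow> ('a \<Rightarrow> real) set" where
  "cc X = {f. continuous_map X euclideanreal f \<and>
              (\<exists>K. compactin X K \<and> (\<forall>x\<in>topspace X - K. f x = 0))}"

lemma cc_continuous: "f \<in> cc X \<Longrightarrow> continuous_map X euclideanreal f"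
  by (simp add: cc_def)

lemma ccI:
  assumes "continuous_map X euclideanreal f" "compactin X K" "\<And>x. x \<in> topspace X \<Longrightarrow> x \<notin> K \<Longrightarrow> f x = 0"
  shows "f \<in> cc X"
  using assms by (auto simp: cc_def)

lemma ccE:
  assumes "f \<in> cc X"
  obtains K where "compactin X K" "\<And>x. x \<in> topspace X \<Longrightarrow> x \<notin> K \<Longrightarrow> f x = 0"
  using assms by (auto simp: cc_def)

lemma cc_mult_left:
  assumes "continuous_map X euclideanreal g" "f \<in> cc X"
  shows "(\<lambda>x. g x * f x) \<in> cc X"
proof -
  obtain K where "compactin X K" "\<And>x. x \<in> topspace X \<Longrightarrow> x \<notin> K \<Longrightarrow> f x = 0"
    using assms unfolding cc_def by blast
  then show ?thesis
    by (intro ccI[of _ _ K]) (auto intro: continuous_map_real_mult assms(1) cc_continuous[OF assms(2)])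
qed

lemma cc_add:
  assumes "f \<in> cc X" "g \<in> cc X"
  shows "(\<lambda>x. f x + g x) \<in> cc X"
proof -
  obtain K L where "compactin X K" "\<And>x. x \<in> topspace X \<Longrightarrow> x \<notin> K \<Longrightarrow> f x = 0"
    "compactin X L" "\<And>x. x \<in> topspace X \<Longrightarrow> x \<notin> L \<Longrightarrow> g x = 0"
    using assms by (meson ccE)
  then show ?thesis
    by (intro ccI[of _ _ "K \<union> L"] continuous_map_add compactin_Un) (auto simp: cc_continuous assms)
qed

lemma cc_cmult: "f \<in> cc X \<Longrightarrow> (\<lambda>x. c * f x) \<in> cc X"
  by (rule cc_mult_left) auto

lemma cc_diff:
  assumes "f \<in> cc X" "g \<in> cc X"
  shows "(\<lambda>x. f x - g x) \<in> cc X"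
  using cc_add[OF assms(1) cc_cmult[OF assms(2), of "-1"]] by simp

lemma cc_zero: "(\<lambda>x. 0) \<in> cc X"
  by (rule ccI[of _ _ "{}"]) auto

lemma cc_sum:
  assumes "finite A" "\<And>i. i \<in> A \<Longrightarrow> f i \<in> cc X"
  shows "(\<lambda>x. \<Sum>i\<in>A. f i x) \<in> cc X"
  using assms by (induction A) (auto simp: cc_zero cc_add)

lemma cc_homeo:
  assumes "f \<in> cc Y" and h: "homeomorphic_maps X Y h k"
  shows "(\<lambda>x. f (h x)) \<in> cc X"
proof -
  obtain K where K: "compactin Y K" "\<And>x. x \<in> topspace Y \<Longrightarrow> x \<notin> K \<Longrightarrow> f x = 0"
    using assms unfolding cc_def by blast
  have h': "continuous_map X Y h" "continuous_map Y X k"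
    "\<And>x. x \<in> topspace X \<Longrightarrow> k (h x) = x" "\<And>y. y \<in> topspace Y \<Longrightarrow> h (k y) = y"
    using h by (auto simp: homeomorphic_maps_def)
  have "continuous_map X euclideanreal (f \<circ> h)"
    using h' assms by (metis cc_continuous continuous_map_compose)
  moreover have "compactin X (k ` K)"
    using K h' image_compactin by blast
  moreover have "f (h x) = 0" if "x \<in> topspace X" "x \<notin> k ` K" for x
  proof -
    have "h x \<in> topspace Y" using that h' by (meson continuous_map_image_subset_topspace image_subset_iff)
    moreover have "h x \<notin> K" using that h' by (metis imageI)
    ultimately show ?thesis using K by blast
  qed
  ultimately show ?thesis
    by (intro ccI[of _ _ "k ` K"]) (auto simp: o_def)
qed

text \<open>Urysohn is applied to \<open>K\<close> and the complement of an intermediate open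
  \<open>V\<close> with a compact \<open>L\<close> between \<open>V\<close> and \<open>U\<close>.
  Vanishing off \<open>V\<close> puts the support inside \<open>L\<close>; vanishing off
  \<open>U\<close> alone would not make it compact.\<close>

lemma cc_bump:
  assumes X: "locally_compact_space X" "Hausdorff_space X"
    and K: "compactin X K" and U: "openin X U" "K \<subseteq> U"
  obtains f L where "f \<in> cc X" "\<And>x. x \<in> topspace X \<Longrightarrow> 0 \<le> f x" "\<And>x. x \<in> topspace X \<Longrightarrow> f x \<le> 1"
    "\<And>x. x \<in> K \<Longrightarrow> f x = 1" "compactin X L" "L \<subseteq> U" "\<And>x. x \<in> topspace X \<Longrightarrow> x \<notin> L \<Longrightarrow> f x = 0"
proof -
  obtain V L where VL: "openin X V" "compactin X L" "K \<subseteq> V" "V \<subseteq> L" "L \<subseteq> U"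
    using compact_sandwich[OF X K U] by blast
  have "completely_regular_space X"
    using X locally_compact_Hausdorff_imp_regular_space
      locally_compact_regular_imp_completely_regular_space by blast
  then obtain f where f: "continuous_map X (top_of_set {0..1::real}) f" "f ` (topspace X - V) \<subseteq> {0}" "f ` K \<subseteq> {1}"
    using Urysohn_completely_regular_compact_closed[of 0 1 X K "topspace X - V"] K VL
    by (auto simp: disjnt_iff)
  have c: "continuous_map X euclideanreal f" "\<And>x. x \<in> topspace X \<Longrightarrow> f x \<in> {0..1}"
    using f(1) by (auto simp: continuous_map_in_subtopology)
  have z: "f x = 0" if "x \<in> topspace X" "x \<notin> L" for x
    using f that VL by blast
  show thesis
  proof (rule that[of f L])
    show "f \<in> cc X" using c z VL by (intro ccI[of _ _ L]) auto
    show "\<And>x. x \<in> K \<Longrightarrow> f x = 1" using f(3) by auto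
  qed (use c VL z in auto)
qed

lemma continuous_map_slice:
  assumes "continuous_map (prod_topology X Y) Z (\<lambda>(x,y). F x y)" "x \<in> topspace X"
  shows "continuous_map Y Z (F x)"
proof -
  have "continuous_map Y (prod_topology X Y) (\<lambda>y. (x, y))"
    using assms(2) by (intro continuous_map_pairedI) auto
  from continuous_map_compose[OF this assms(1)] show ?thesis by (simp add: o_def)
qed

text \<open>The set where \<open>F\<close> differs from its slice at \<open>y\<close> by less than
  \<open>e\<close> is open and contains \<open>{y} \<times> L\<close>, so the tube lemma gives a
  uniform neighbourhood.\<close>

lemma uniform_on_compact:
  assumes F: "continuous_map (prod_topology Y X) euclideanreal (\<lambda>(y,x). F y x)"
    and y: "y \<in> topspace Y" and L: "compactin X L" and e: "e > (0::real)"
  obtains V where "openin Y V" "y \<in> V" "\<And>v x. v \<in> V \<Longrightarrow> x \<in> L \<Longrightarrow> \<bar>F v x - F y x\<bar> < e"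
proof -
  have "continuous_map (prod_topology Y X) euclideanreal (\<lambda>p. F y (snd p))"
    using continuous_map_compose[OF continuous_map_snd continuous_map_slice[OF F y]] by (simp add: o_def)
  then have "continuous_map (prod_topology Y X) euclideanreal (\<lambda>p. \<bar>(case p of (v,x) \<Rightarrow> F v x) - F y (snd p)\<bar>)"
    by (intro continuous_intros F)
  then have op: "openin (prod_topology Y X) {p \<in> topspace (prod_topology Y X). \<bar>(case p of (v,x) \<Rightarrow> F v x) - F y (snd p)\<bar> \<in> {..<e}}"
    by (rule openin_continuous_map_preimage) auto
  have "L \<subseteq> topspace X" using L compactin_subset_topspace by blast
  then have "{y} \<times> L \<subseteq> {p \<in> topspace (prod_topology Y X). \<bar>(case p of (v,x) \<Rightarrow> F v x) - F y (snd p)\<bar> \<in> {..<e}}"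
    using y e by auto
  from tube_lemma_right[OF op L y this] obtain V W where VW: "openin Y V" "y \<in> V" "L \<subseteq> W"
    "V \<times> W \<subseteq> {p \<in> topspace (prod_topology Y X). \<bar>(case p of (v,x) \<Rightarrow> F v x) - F y (snd p)\<bar> \<in> {..<e}}"
    by blast
  show thesis
  proof (rule that[OF VW(1,2)])
    fix v x assume "v \<in> V" "x \<in> L"
    then have "(v, x) \<in> V \<times> W" using VW by blast
    then show "\<bar>F v x - F y x\<bar> < e" using VW(4) by fastforce
  qed
qed

text \<open>A Radon measure seen only through its integral. Monotonicity compares values on
  \<open>topspace X\<close> alone, which is what makes the functional blind to values
  elsewhere.\<close>

locale positive_functional =
  fixes X :: "'a topology" and I :: "('a \<Rightarrow> real) \<Rightarrow> real"
  assumes loc_compact: "locally_compact_space X" and hausdorff: "Hausdorff_space X"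
    and I_add: "\<And>f g. f \<in> cc X \<Longrightarrow> g \<in> cc X \<Longrightarrow> I (\<lambda>x. f x + g x) = I f + I g"
    and I_cmult: "\<And>f c. f \<in> cc X \<Longrightarrow> I (\<lambda>x. c * f x) = c * I f"
    and I_mono: "\<And>f g. f \<in> cc X \<Longrightarrow> g \<in> cc X \<Longrightarrow> (\<And>x. x \<in> topspace X \<Longrightarrow> f x \<le> g x) \<Longrightarrow> I f \<le> I g"
begin

lemma I_zero: "I (\<lambda>x. 0) = 0"
  using I_cmult[of "\<lambda>x. 0" 0] by (simp add: cc_zero)

lemma I_nonneg: "f \<in> cc X \<Longrightarrow> (\<And>x. x \<in> topspace X \<Longrightarrow> 0 \<le> f x) \<Longrightarrow> 0 \<le> I f"
  using I_mono[of "\<lambda>x. 0" f] by (simp add: cc_zero I_zero)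

lemma I_diff: "f \<in> cc X \<Longrightarrow> g \<in> cc X \<Longrightarrow> I (\<lambda>x. f x - g x) = I f - I g"
  using I_add[of f "\<lambda>x. (-1) * g x"] I_cmult[of g "-1"] by (simp add: cc_cmult[of g X "-1", simplified])

lemma I_sum: "finite A \<Longrightarrow> (\<And>i. i \<in> A \<Longrightarrow> f i \<in> cc X) \<Longrightarrow> I (\<lambda>x. \<Sum>i\<in>A. f i x) = (\<Sum>i\<in>A. I (f i))"
  by (induction A rule: finite_induct) (auto simp: I_zero I_add cc_sum)

text \<open>Monotonicity in both directions. Membership of \<open>g\<close> in \<open>cc X\<close>
  is inherited from \<open>f\<close>, so that rewriting an integrand needs a support check on one
  side only.\<close>

lemma I_cong:
  assumes "f \<in> cc X" "\<And>x. x \<in> topspace X \<Longrightarrow> f x = g x"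
  shows "I f = I g"
proof -
  obtain K where "compactin X K" "\<And>x. x \<in> topspace X \<Longrightarrow> x \<notin> K \<Longrightarrow> f x = 0"
    using assms unfolding cc_def by blast
  moreover have "continuous_map X euclideanreal g"
    using assms cc_continuous continuous_map_eq by blast
  ultimately have "g \<in> cc X" using assms(2) by (intro ccI[of _ _ K]) auto
  then show ?thesis using assms I_mono[of f g] I_mono[of g f] by simp
qed

lemma I_bound:
  assumes "f \<in> cc X" "g \<in> cc X" "\<And>x. x \<in> topspace X \<Longrightarrow> \<bar>f x\<bar> \<le> e * g x"
  shows "\<bar>I f\<bar> \<le> e * I g"
proof -
  have "I f \<le> I (\<lambda>x. e * g x)" using assms by (intro I_mono cc_cmult) force+
  moreover have "I (\<lambda>x. (-e) * g x) \<le> I f" using assms by (intro I_mono cc_cmult) force+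
  ultimately show ?thesis unfolding I_cmult[OF assms(2)] by (simp add: abs_le_iff)
qed

lemma bump:
  assumes "compactin X K" "openin X U" "K \<subseteq> U"
  obtains f L where "f \<in> cc X" "\<And>x. x \<in> topspace X \<Longrightarrow> 0 \<le> f x" "\<And>x. x \<in> topspace X \<Longrightarrow> f x \<le> 1"
    "\<And>x. x \<in> K \<Longrightarrow> f x = 1" "compactin X L" "L \<subseteq> U" "\<And>x. x \<in> topspace X \<Longrightarrow> x \<notin> L \<Longrightarrow> f x = 0"
  using cc_bump[OF loc_compact hausdorff assms] by blast

lemma bump1:
  assumes "compactin X K"
  obtains f where "f \<in> cc X" "\<And>x. x \<in> topspace X \<Longrightarrow> 0 \<le> f x" "\<And>x. x \<in> K \<Longrightarrow> f x = 1"
  using bump[OF assms openin_topspace compactin_subset_topspace[OF assms]] by metis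

text \<open>Near a given \<open>y\<close> all slices share a compact support \<open>L\<close>, on
  which they are uniformly close; a bump equal to 1 on \<open>L\<close> turns this into closeness of
  the integrals. The support condition is local in \<open>y\<close> because translates such as
  \<open>f (x \<otimes> y)\<close> have no common compact support for all \<open>y\<close>.\<close>

lemma continuous_functional:
  assumes F: "continuous_map (prod_topology Y X) euclideanreal (\<lambda>(y,x). F y x)"
    and supp: "\<And>y. y \<in> topspace Y \<Longrightarrow>
      \<exists>V L. openin Y V \<and> y \<in> V \<and> compactin X L \<and> (\<forall>v\<in>V. \<forall>x\<in>topspace X - L. F v x = 0)"
  shows "continuous_map Y euclideanreal (\<lambda>y. I (F y))"
  unfolding continuous_map_real_iff
proof (intro ballI allI impI)
  fix y and e :: real assume y: "y \<in> topspace Y" and e: "e > 0"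
  obtain V L where V: "openin Y V" "y \<in> V" and L: "compactin X L"
    and z: "\<And>v x. v \<in> V \<Longrightarrow> x \<in> topspace X \<Longrightarrow> x \<notin> L \<Longrightarrow> F v x = 0"
    using supp[OF y] by blast
  have cc: "F v \<in> cc X" if "v \<in> V" for v
    using that V z L openin_subset by (intro ccI[of _ _ L] continuous_map_slice[OF F]) blast+
  obtain k where k: "k \<in> cc X" "\<And>x. x \<in> topspace X \<Longrightarrow> 0 \<le> k x" "\<And>x. x \<in> L \<Longrightarrow> k x = 1"
    using bump1[OF L] by blast
  \<comment> \<open>The summand 1 keeps the denominator positive even if \<open>I k = 0\<close>, and
    makes \<open>d * I k\<close> strictly smaller than \<open>e\<close>.\<close>
  define d where "d = e / (I k + 1)"
  have Ik: "I k \<ge> 0" using I_nonneg k by blast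
  then have d: "d > 0" using e by (simp add: d_def)
  obtain W where W: "openin Y W" "y \<in> W" "\<And>v x. v \<in> W \<Longrightarrow> x \<in> L \<Longrightarrow> \<bar>F v x - F y x\<bar> < d"
    using uniform_on_compact[OF F y L d] by blast
  show "\<exists>U. openin Y U \<and> y \<in> U \<and> (\<forall>v\<in>U. \<bar>I (F v) - I (F y)\<bar> < e)"
  proof (intro exI conjI ballI)
    show "openin Y (V \<inter> W)" "y \<in> V \<inter> W" using V W by auto
    fix v assume v: "v \<in> V \<inter> W"
    have "\<bar>F v x - F y x\<bar> \<le> d * k x" if "x \<in> topspace X" for x
      using W(3)[of v x] z[of v x] z[of y x] k(3)[of x] k(2)[of x] V v that d
      by (cases "x \<in> L") auto
    then have "\<bar>I (\<lambda>x. F v x - F y x)\<bar> \<le> d * I k"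
      using v V by (intro I_bound cc_diff cc k) auto
    also have "\<dots> < e"
      using e Ik by (simp add: d_def field_simps)
    finally show "\<bar>I (F v) - I (F y)\<bar> < e"
      using v V by (simp add: I_diff cc)
  qed
qed

text \<open>The two projections of a compact support in the product bound the supports in each
  variable separately; this makes the partial integral again an admissible integrand.\<close>

lemma cc_functional:
  assumes F: "(\<lambda>(y,x). F y x) \<in> cc (prod_topology Y X)"
  shows "(\<lambda>y. I (F y)) \<in> cc Y"
proof -
  obtain C where C: "compactin (prod_topology Y X) C"
    "\<And>p. p \<in> topspace (prod_topology Y X) \<Longrightarrow> p \<notin> C \<Longrightarrow> (case p of (y,x) \<Rightarrow> F y x) = 0"
    using F unfolding cc_def by blast
  have K: "compactin Y (fst ` C)" and L: "compactin X (snd ` C)"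
    using C image_compactin continuous_map_fst continuous_map_snd by blast+
  have z: "F y x = 0" if "y \<in> topspace Y" "x \<in> topspace X" "y \<notin> fst ` C \<or> x \<notin> snd ` C" for x y
    using C(2)[of "(y,x)"] that by force
  note c = cc_continuous[OF F]
  show ?thesis
  proof (rule ccI[OF _ K])
    show "continuous_map Y euclideanreal (\<lambda>y. I (F y))"
    proof (rule continuous_functional[OF c])
      fix y assume "y \<in> topspace Y"
      then show "\<exists>V L. openin Y V \<and> y \<in> V \<and> compactin X L \<and> (\<forall>v\<in>V. \<forall>x\<in>topspace X - L. F v x = 0)"
        using L z by (intro exI[of _ "topspace Y"] exI[of _ "snd ` C"]) auto
    qed
    fix y assume y: "y \<in> topspace Y" "y \<notin> fst ` C"
    have "I (\<lambda>x. 0) = I (F y)" using y z by (intro I_cong cc_zero) auto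
    then show "I (F y) = 0" by (simp add: I_zero)
  qed
qed

lemma cc_slice:
  assumes F: "(\<lambda>(y,x). F y x) \<in> cc (prod_topology Y X)" and y: "y \<in> topspace Y"
  shows "F y \<in> cc X"
proof -
  obtain C where C: "compactin (prod_topology Y X) C"
    "\<And>p. p \<in> topspace (prod_topology Y X) \<Longrightarrow> p \<notin> C \<Longrightarrow> (case p of (y,x) \<Rightarrow> F y x) = 0"
    using F unfolding cc_def by blast
  have "compactin X (snd ` C)"
    using C image_compactin continuous_map_snd by blast
  moreover have "F y x = 0" if "x \<in> topspace X" "x \<notin> snd ` C" for x
    using C(2)[of "(y,x)"] that y by force
  ultimately show ?thesis
    using continuous_map_slice[OF cc_continuous[OF F] y] by (intro ccI) auto
qed

end

section \<open>Partitions of unity and the exchange of two functionals\<close>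

lemma cc_swap:
  assumes "(\<lambda>(x,y). F x y) \<in> cc (prod_topology X Y)"
  shows "(\<lambda>(y,x). F x y) \<in> cc (prod_topology Y X)"
proof -
  have "homeomorphic_maps (prod_topology Y X) (prod_topology X Y) (\<lambda>(y,x). (x,y)) (\<lambda>(x,y). (y,x))"
    unfolding homeomorphic_maps_def by (auto simp: case_prod_unfold intro: continuous_intros)
  from cc_homeo[OF assms this] show ?thesis by (simp add: case_prod_unfold)
qed

lemma partition_of_unity:
  assumes X: "locally_compact_space X" "Hausdorff_space X"
    and K: "compactin X K" and U: "\<And>a. a \<in> K \<Longrightarrow> openin X (U a)" "\<And>a. a \<in> K \<Longrightarrow> a \<in> U a"
  obtains D \<phi> where "finite D" "D \<subseteq> K" "\<And>a. a \<in> D \<Longrightarrow> \<phi> a \<in> cc X"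
    "\<And>a x. a \<in> D \<Longrightarrow> x \<in> topspace X \<Longrightarrow> 0 \<le> \<phi> a x"
    "\<And>a x. a \<in> D \<Longrightarrow> x \<in> topspace X \<Longrightarrow> x \<notin> U a \<Longrightarrow> \<phi> a x = 0"
    "\<And>x. x \<in> topspace X \<Longrightarrow> (\<Sum>a\<in>D. \<phi> a x) \<le> 1" "\<And>x. x \<in> K \<Longrightarrow> (\<Sum>a\<in>D. \<phi> a x) = 1"
proof -
  have KX: "K \<subseteq> topspace X" using K compactin_subset_topspace by blast
  have "\<exists>f. f \<in> cc X \<and> (\<forall>x\<in>topspace X. 0 \<le> f x) \<and> f a = 1 \<and> (\<forall>x\<in>topspace X - U a. f x = 0)"
    if "a \<in> K" for a
  proof -
    have "compactin X {a}" using that KX by auto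
    then obtain f L where "f \<in> cc X" "\<And>x. x \<in> topspace X \<Longrightarrow> 0 \<le> f x"
      "\<And>x. x \<in> {a} \<Longrightarrow> f x = 1" "L \<subseteq> U a" "\<And>x. x \<in> topspace X \<Longrightarrow> x \<notin> L \<Longrightarrow> f x = 0"
      using U[OF \<open>a \<in> K\<close>] by (elim cc_bump[OF X, of "{a}" "U a"]) auto
    then show ?thesis by (intro exI[of _ f]) auto
  qed
  then obtain \<psi> where \<psi>: "\<And>a. a \<in> K \<Longrightarrow> \<psi> a \<in> cc X" "\<And>a x. a \<in> K \<Longrightarrow> x \<in> topspace X \<Longrightarrow> 0 \<le> \<psi> a x"
    "\<And>a. a \<in> K \<Longrightarrow> \<psi> a a = 1" "\<And>a x. a \<in> K \<Longrightarrow> x \<in> topspace X \<Longrightarrow> x \<notin> U a \<Longrightarrow> \<psi> a x = 0"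
    by (metis DiffI)
  \<comment> \<open>The level 1/2 is matched to the floor in \<open>\<sigma>\<close> below: wherever
    some \<open>\<psi> a\<close> exceeds it, the floor is inactive.\<close>
  define V where "V a = {x \<in> topspace X. \<psi> a x \<in> {1/2<..}}" for a
  have V: "openin X (V a)" "a \<in> V a" if "a \<in> K" for a
    unfolding V_def using \<psi>(1,3) that KX openin_continuous_map_preimage[OF cc_continuous[OF \<psi>(1)[OF that]], of "{1/2<..}"] by auto
  then obtain D where D: "finite D" "D \<subseteq> K" "K \<subseteq> \<Union> (V ` D)"
    using compactin_pointwise_cover[OF K, of V] by metis
  \<comment> \<open>The floor 1/2 makes division continuous on the whole space. On \<open>K\<close>
    the sum already exceeds 1/2, so normalisation is exact there; elsewhere the normalised sum is at
    most 1.\<close>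
  define \<sigma> where "\<sigma> x = max (\<Sum>a\<in>D. \<psi> a x) (1/2)" for x
  have \<sigma>: "continuous_map X euclideanreal \<sigma>"
    unfolding \<sigma>_def using D \<psi> by (intro continuous_intros cc_continuous) auto
  have \<sigma>0: "\<sigma> x > 0" for x by (simp add: \<sigma>_def)
  have "continuous_map X euclideanreal (\<lambda>x. inverse (\<sigma> x))"
    using \<sigma>0 by (intro continuous_intros \<sigma>) (metis less_irrefl)
  then have c: "(\<lambda>x. inverse (\<sigma> x) * \<psi> a x) \<in> cc X" if "a \<in> D" for a
    using that \<psi> D by (intro cc_mult_left) auto
  have s: "(\<Sum>a\<in>D. inverse (\<sigma> x) * \<psi> a x) = (\<Sum>a\<in>D. \<psi> a x) / \<sigma> x" for x
    by (simp add: sum_distrib_left[symmetric] divide_inverse mult.commute)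
  show thesis
  proof (rule that[of D "\<lambda>a x. inverse (\<sigma> x) * \<psi> a x", OF D(1,2) c])
    show "(\<Sum>a\<in>D. inverse (\<sigma> x) * \<psi> a x) \<le> 1" for x
      unfolding s using \<sigma>0[of x] by (simp add: divide_le_eq \<sigma>_def)
    show "(\<Sum>a\<in>D. inverse (\<sigma> x) * \<psi> a x) = 1" if "x \<in> K" for x
    proof -
      obtain a where a: "a \<in> D" "x \<in> V a" using D(3) \<open>x \<in> K\<close> by blast
      then have "1/2 < \<psi> a x" by (auto simp: V_def)
      also have "\<dots> \<le> (\<Sum>a\<in>D. \<psi> a x)"
        using a D \<psi>(2)[OF subsetD[OF D(2)]] KX \<open>x \<in> K\<close> by (intro member_le_sum) auto
      finally have "\<sigma> x = (\<Sum>a\<in>D. \<psi> a x)" by (simp add: \<sigma>_def)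
      then show ?thesis unfolding s using \<sigma>0[of x] by simp
    qed
    show "0 \<le> inverse (\<sigma> x) * \<psi> a x" if "a \<in> D" "x \<in> topspace X" for a x
      using that D \<psi>(2)[of a x] \<sigma>0[of x] by auto
    show "inverse (\<sigma> x) * \<psi> a x = 0" if "a \<in> D" "x \<in> topspace X" "x \<notin> U a" for a x
      using that D \<psi>(4)[of a x] by auto
  qed
qed

text \<open>Up to a uniformly small error on a fixed compact set, \<open>F\<close> is a finite sum
  \<open>\<Sum>\<phi>\<^sub>a(x) F(a, y)\<close> with \<open>\<phi>\<close> a partition of unity; for such sums the order of integration is
  irrelevant.\<close>

lemma functional_swap:
  assumes I: "positive_functional X I" and J: "positive_functional Y J"
    and F: "(\<lambda>(x,y). F x y) \<in> cc (prod_topology X Y)"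
  shows "I (\<lambda>x. J (\<lambda>y. F x y)) = J (\<lambda>y. I (\<lambda>x. F x y))"
proof -
  interpret I: positive_functional X I by fact
  interpret J: positive_functional Y J by fact
  obtain C where C: "compactin (prod_topology X Y) C"
    "\<And>p. p \<in> topspace (prod_topology X Y) \<Longrightarrow> p \<notin> C \<Longrightarrow> (case p of (x,y) \<Rightarrow> F x y) = 0"
    using F unfolding cc_def by blast
  define K where "K = fst ` C"
  define L where "L = snd ` C"
  have K: "compactin X K" and L: "compactin Y L"
    unfolding K_def L_def using C image_compactin continuous_map_fst continuous_map_snd by blast+
  have KX: "K \<subseteq> topspace X" and LY: "L \<subseteq> topspace Y" using K L compactin_subset_topspace by blast+
  have z: "F x y = 0" if "x \<in> topspace X" "y \<in> topspace Y" "x \<notin> K \<or> y \<notin> L" for x y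
    using C(2)[of "(x,y)"] that unfolding K_def L_def by force
  \<comment> \<open>The partition functions spill over the edge of \<open>K\<close>. Confining them
    to \<open>O'\<close> keeps the approximant supported in the compact \<open>M\<close>, on which
    the dominating bump \<open>k\<close> equals 1.\<close>
  obtain O' M where OM: "openin X O'" "compactin X M" "K \<subseteq> O'" "O' \<subseteq> M"
    by (rule compact_sandwich[OF I.loc_compact I.hausdorff K openin_topspace KX])
  obtain k where k: "k \<in> cc X" "\<And>x. x \<in> topspace X \<Longrightarrow> 0 \<le> k x" "\<And>x. x \<in> M \<Longrightarrow> k x = 1"
    using I.bump1[OF OM(2)] by blast
  obtain l where l: "l \<in> cc Y" "\<And>x. x \<in> topspace Y \<Longrightarrow> 0 \<le> l x" "\<And>x. x \<in> L \<Longrightarrow> l x = 1"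
    using J.bump1[OF L] by blast
  note cF = cc_continuous[OF F]
  note F' = cc_swap[OF F]
  have ccJ: "(\<lambda>x. J (F x)) \<in> cc X" by (rule J.cc_functional[OF F])
  have ccI: "(\<lambda>y. I (\<lambda>x. F x y)) \<in> cc Y" by (rule I.cc_functional[OF F'])
  have slJ: "F x \<in> cc Y" if "x \<in> topspace X" for x using J.cc_slice[OF F that] .
  have slI: "(\<lambda>x. F x y) \<in> cc X" if "y \<in> topspace Y" for y using I.cc_slice[OF F' that] .
  have main: "\<bar>I (\<lambda>x. J (F x)) - J (\<lambda>y. I (\<lambda>x. F x y))\<bar> \<le> e * (2 * I k * J l)" if e: "e > 0" for e
  proof -
    have "\<exists>V. openin X V \<and> a \<in> V \<and> (\<forall>x\<in>V. \<forall>y\<in>L. \<bar>F x y - F a y\<bar> < e)" if "a \<in> K" for a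
    proof -
      have "a \<in> topspace X" using that KX by blast
      then obtain V where "openin X V" "a \<in> V" "\<And>x y. x \<in> V \<Longrightarrow> y \<in> L \<Longrightarrow> \<bar>F x y - F a y\<bar> < e"
        using uniform_on_compact[OF cF _ L e] by blast
      then show ?thesis by blast
    qed
    then obtain V where V: "\<And>a. a \<in> K \<Longrightarrow> openin X (V a)" "\<And>a. a \<in> K \<Longrightarrow> a \<in> V a"
      "\<And>a x y. a \<in> K \<Longrightarrow> x \<in> V a \<Longrightarrow> y \<in> L \<Longrightarrow> \<bar>F x y - F a y\<bar> < e" by metis
    have P: "\<And>a. a \<in> K \<Longrightarrow> openin X (V a \<inter> O')" "\<And>a. a \<in> K \<Longrightarrow> a \<in> V a \<inter> O'" using V OM by blast+
    obtain D \<phi> where D: "finite D" "D \<subseteq> K" and \<phi>: "\<And>a. a \<in> D \<Longrightarrow> \<phi> a \<in> cc X"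
      "\<And>a x. a \<in> D \<Longrightarrow> x \<in> topspace X \<Longrightarrow> 0 \<le> \<phi> a x"
      "\<And>a x. a \<in> D \<Longrightarrow> x \<in> topspace X \<Longrightarrow> x \<notin> V a \<inter> O' \<Longrightarrow> \<phi> a x = 0"
      "\<And>x. x \<in> topspace X \<Longrightarrow> (\<Sum>a\<in>D. \<phi> a x) \<le> 1" "\<And>x. x \<in> K \<Longrightarrow> (\<Sum>a\<in>D. \<phi> a x) = 1"
      by (rule partition_of_unity[OF I.loc_compact I.hausdorff K P], assumption, assumption, rule that)
    define G where "G x y = (\<Sum>a\<in>D. \<phi> a x * F a y)" for x y
    have DX: "a \<in> topspace X" if "a \<in> D" for a using that D KX by blast
    have slJG: "G x \<in> cc Y" for x
      unfolding G_def using D(1) slJ DX by (intro cc_sum cc_cmult) auto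
    have slIG: "(\<lambda>x. G x y) \<in> cc X" for y
    proof -
      have "(\<lambda>x. F a y * \<phi> a x) \<in> cc X" if "a \<in> D" for a by (rule cc_cmult[OF \<phi>(1)[OF that]])
      from cc_sum[OF D(1) this] show ?thesis unfolding G_def by (simp add: mult.commute)
    qed
    have JG: "J (G x) = (\<Sum>a\<in>D. J (F a) * \<phi> a x)" for x
    proof -
      have "J (G x) = (\<Sum>a\<in>D. J (\<lambda>y. \<phi> a x * F a y))"
        unfolding G_def using D(1) slJ DX by (intro J.I_sum cc_cmult) auto
      also have "\<dots> = (\<Sum>a\<in>D. J (F a) * \<phi> a x)"
        using slJ DX by (intro sum.cong refl) (simp add: J.I_cmult)
      finally show ?thesis .
    qed
    have IG: "I (\<lambda>x. G x y) = (\<Sum>a\<in>D. I (\<phi> a) * F a y)" for y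
    proof -
      have "I (\<lambda>x. \<Sum>a\<in>D. F a y * \<phi> a x) = (\<Sum>a\<in>D. I (\<lambda>x. F a y * \<phi> a x))"
        using D(1) \<phi>(1) by (intro I.I_sum cc_cmult) auto
      also have "\<dots> = (\<Sum>a\<in>D. I (\<phi> a) * F a y)" using \<phi>(1) by (simp add: I.I_cmult mult.commute)
      finally show ?thesis unfolding G_def by (simp add: mult.commute)
    qed
    have ccJG: "(\<lambda>x. J (G x)) \<in> cc X" unfolding JG using D(1) \<phi>(1) by (intro cc_sum cc_cmult) auto
    have ccIG: "(\<lambda>y. I (\<lambda>x. G x y)) \<in> cc Y" unfolding IG using D(1) slJ DX by (intro cc_sum cc_cmult) auto
    have "I (\<lambda>x. J (G x)) = (\<Sum>a\<in>D. I (\<phi> a) * J (F a))"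
      unfolding JG using D(1) \<phi>(1) by (subst I.I_sum) (auto intro!: cc_cmult sum.cong simp: I.I_cmult)
    moreover have "J (\<lambda>y. I (\<lambda>x. G x y)) = (\<Sum>a\<in>D. I (\<phi> a) * J (F a))"
      unfolding IG using D(1) slJ DX by (subst J.I_sum) (auto intro!: cc_cmult sum.cong simp: J.I_cmult)
    ultimately have eqG: "I (\<lambda>x. J (G x)) = J (\<lambda>y. I (\<lambda>x. G x y))" by simp
    \<comment> \<open>Domination by a product of bumps is what survives integration in either order:
      both iterated errors are then at most \<open>e * I k * J l\<close>.\<close>
    have FG: "\<bar>F x y - G x y\<bar> \<le> e * (k x * l y)" if x: "x \<in> topspace X" and y: "y \<in> topspace Y" for x y
    proof (cases "x \<in> M \<and> y \<in> L")
      case False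
      then have "F x y = 0" using z x y OM by blast
      moreover have "G x y = 0"
        unfolding G_def
      proof (rule sum.neutral, rule ballI)
        fix a assume "a \<in> D"
        then show "\<phi> a x * F a y = 0" using False \<phi>(3)[of a x] x y z[of a y] DX OM by auto
      qed
      ultimately show ?thesis using k l x y e by simp
    next
      case True
      \<comment> \<open>On \<open>M\<close> outside \<open>K\<close> the partition may sum to less
        than 1, but there \<open>F x y = 0\<close>, so the identity still holds.\<close>
      have "F x y = (\<Sum>a\<in>D. \<phi> a x) * F x y" using \<phi>(5) z x y by (cases "x \<in> K") auto
      then have "\<bar>F x y - G x y\<bar> = \<bar>\<Sum>a\<in>D. \<phi> a x * (F x y - F a y)\<bar>"
        by (simp add: G_def sum_distrib_right right_diff_distrib sum_subtractf)
      also have "\<dots> \<le> (\<Sum>a\<in>D. \<bar>\<phi> a x * (F x y - F a y)\<bar>)" by (rule sum_abs)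
      also have "\<dots> \<le> (\<Sum>a\<in>D. \<phi> a x * e)"
      proof (rule sum_mono)
        fix a assume a: "a \<in> D"
        show "\<bar>\<phi> a x * (F x y - F a y)\<bar> \<le> \<phi> a x * e"
        proof (cases "x \<in> V a")
          case True
          then have "\<bar>F x y - F a y\<bar> < e" using V(3)[of a x y] a D \<open>x \<in> M \<and> y \<in> L\<close> by blast
          then show ?thesis using \<phi>(2)[OF a x] by (simp add: abs_mult mult_left_mono)
        qed (use \<phi>(3)[OF a x] in simp)
      qed
      also have "\<dots> \<le> e * 1" using \<phi>(4)[OF x] e by (simp flip: sum_distrib_right)
      finally show ?thesis using True k l by simp
    qed
    have "\<bar>I (\<lambda>x. J (F x)) - I (\<lambda>x. J (G x))\<bar> \<le> (e * J l) * I k"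
    proof -
      have "\<bar>J (F x) - J (G x)\<bar> \<le> (e * J l) * k x" if "x \<in> topspace X" for x
        using J.I_bound[OF cc_diff[OF slJ slJG] l(1), of x x "e * k x"] FG that
        by (simp add: J.I_diff slJ slJG algebra_simps)
      then show ?thesis
        using I.I_bound[OF cc_diff[OF ccJ ccJG] k(1), of "e * J l"] by (simp add: I.I_diff ccJ ccJG)
    qed
    moreover have "\<bar>J (\<lambda>y. I (\<lambda>x. F x y)) - J (\<lambda>y. I (\<lambda>x. G x y))\<bar> \<le> (e * I k) * J l"
    proof -
      have "\<bar>I (\<lambda>x. F x y) - I (\<lambda>x. G x y)\<bar> \<le> (e * I k) * l y" if "y \<in> topspace Y" for y
        using I.I_bound[OF cc_diff[OF slI slIG] k(1), of y y "e * l y"] FG that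
        by (simp add: I.I_diff slI slIG algebra_simps)
      then show ?thesis
        using J.I_bound[OF cc_diff[OF ccI ccIG] l(1), of "e * I k"] by (simp add: J.I_diff ccI ccIG)
    qed
    ultimately show ?thesis using eqG by (simp add: algebra_simps abs_le_iff)
  qed
  have "\<bar>I (\<lambda>x. J (F x)) - J (\<lambda>y. I (\<lambda>x. F x y))\<bar> \<le> 0"
  proof (rule field_le_epsilon)
    fix d :: real assume "d > 0"
    have nn: "2 * I k * J l \<ge> 0" using I.I_nonneg J.I_nonneg k l by simp
    then have "\<bar>I (\<lambda>x. J (F x)) - J (\<lambda>y. I (\<lambda>x. F x y))\<bar> \<le> d / (2 * I k * J l + 1) * (2 * I k * J l)"
      using \<open>d > 0\<close> by (intro main) simp
    also have "\<dots> \<le> d" using nn \<open>d > 0\<close> by (simp add: field_simps)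
    finally show "\<bar>I (\<lambda>x. J (F x)) - J (\<lambda>y. I (\<lambda>x. F x y))\<bar> \<le> 0 + d" by simp
  qed
  then show ?thesis by simp
qed

section \<open>Haar functionals and their uniqueness\<close>

lemma cc_bounded:
  assumes "f \<in> cc X"
  obtains B where "0 \<le> B" "\<And>x. x \<in> topspace X \<Longrightarrow> \<bar>f x\<bar> \<le> B"
proof -
  obtain K where K: "compactin X K" "\<And>x. x \<in> topspace X \<Longrightarrow> x \<notin> K \<Longrightarrow> f x = 0"
    using assms unfolding cc_def by blast
  have "compact (f ` K)"
    using image_compactin[OF K(1) cc_continuous[OF assms]] by simp
  then obtain B where B: "\<And>y. y \<in> f ` K \<Longrightarrow> \<bar>y\<bar> \<le> B"
    using compact_imp_bounded bounded_iff by (metis real_norm_def)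
  show thesis
  proof (rule that[of "max B 0"])
    fix x assume "x \<in> topspace X"
    then show "\<bar>f x\<bar> \<le> max B 0"
      using B[of "f x"] K(2)[of x] by (cases "x \<in> K") auto
  qed simp
qed

lemma l_coset_image: "s <#\<^bsub>G\<^esub> E = (\<lambda>x. s \<otimes>\<^bsub>G\<^esub> x) ` E"
  by (auto simp: l_coset_def)

lemma r_coset_image: "E #>\<^bsub>G\<^esub> s = (\<lambda>x. x \<otimes>\<^bsub>G\<^esub> s) ` E"
  by (auto simp: r_coset_def)

section \<open>Translations, inversion and supports in a topological group\<close>

context locally_compact_group
begin

lemma continuous_map_mult:
  assumes "continuous_map X T f" "continuous_map X T g"
  shows "continuous_map X T (\<lambda>x. f x \<otimes> g x)"
  using continuous_map_compose[OF continuous_map_pairedI[OF assms] continuous_mult]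
  by (simp add: o_def)

lemma continuous_map_inverse:
  assumes "continuous_map X T f"
  shows "continuous_map X T (\<lambda>x. inv (f x))"
  using continuous_map_compose[OF assms continuous_inv] by (simp add: o_def)

lemma homeomorphic_left:
  assumes "s \<in> carrier G"
  shows "homeomorphic_maps T T (\<lambda>x. s \<otimes> x) (\<lambda>x. inv s \<otimes> x)"
  unfolding homeomorphic_maps_def
  using assms by (auto simp: topspace_eq_carrier m_assoc[symmetric] intro!: continuous_map_mult)

lemma homeomorphic_right:
  assumes "s \<in> carrier G"
  shows "homeomorphic_maps T T (\<lambda>x. x \<otimes> s) (\<lambda>x. x \<otimes> inv s)"
  unfolding homeomorphic_maps_def
  using assms by (auto simp: topspace_eq_carrier m_assoc intro!: continuous_map_mult)

lemma homeomorphic_inv: "homeomorphic_maps T T (\<lambda>x. inv x) (\<lambda>x. inv x)"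
  unfolding homeomorphic_maps_def using continuous_inv by (auto simp: topspace_eq_carrier)

lemma cc_left: "f \<in> cc T \<Longrightarrow> s \<in> carrier G \<Longrightarrow> (\<lambda>x. f (s \<otimes> x)) \<in> cc T"
  by (rule cc_homeo[OF _ homeomorphic_left])

lemma cc_right: "f \<in> cc T \<Longrightarrow> s \<in> carrier G \<Longrightarrow> (\<lambda>x. f (x \<otimes> s)) \<in> cc T"
  by (rule cc_homeo[OF _ homeomorphic_right])

lemma cc_inv: "f \<in> cc T \<Longrightarrow> (\<lambda>x. f (inv x)) \<in> cc T"
  by (rule cc_homeo[OF _ homeomorphic_inv])

text \<open>Measurability and image measures speak of preimages under translations, Haar invariance
  of cosets; this identity and its right-hand analogue mediate.\<close>

lemma vimage_left:
  assumes E: "E \<subseteq> carrier G" and s: "s \<in> carrier G"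
  shows "(\<lambda>x. s \<otimes> x) -` E \<inter> carrier G = inv s <# E"
proof (intro equalityI subsetI)
  fix x assume x: "x \<in> (\<lambda>x. s \<otimes> x) -` E \<inter> carrier G"
  then have "x = inv s \<otimes> (s \<otimes> x)" using s by (simp add: m_assoc[symmetric])
  then show "x \<in> inv s <# E" using x unfolding l_coset_image by blast
next
  fix x assume "x \<in> inv s <# E"
  then obtain e where e: "e \<in> E" "x = inv s \<otimes> e" by (auto simp: l_coset_image)
  then have "e \<in> carrier G" using E by blast
  then show "x \<in> (\<lambda>x. s \<otimes> x) -` E \<inter> carrier G" using e s by (simp add: m_assoc[symmetric])
qed

lemma vimage_right:
  assumes E: "E \<subseteq> carrier G" and s: "s \<in> carrier G"
  shows "(\<lambda>x. x \<otimes> s) -` E \<inter> carrier G = E #> inv s"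
proof (intro equalityI subsetI)
  fix x assume x: "x \<in> (\<lambda>x. x \<otimes> s) -` E \<inter> carrier G"
  then have "x = (x \<otimes> s) \<otimes> inv s" using s by (simp add: m_assoc)
  then show "x \<in> E #> inv s" using x unfolding r_coset_image by blast
next
  fix x assume "x \<in> E #> inv s"
  then obtain e where e: "e \<in> E" "x = e \<otimes> inv s" by (auto simp: r_coset_image)
  then have "e \<in> carrier G" using E by blast
  then show "x \<in> (\<lambda>x. x \<otimes> s) -` E \<inter> carrier G" using e s by (simp add: m_assoc)
qed

lemma openin_left: "openin T U \<Longrightarrow> s \<in> carrier G \<Longrightarrow> openin T (s <# U)"
  unfolding l_coset_image using homeomorphic_imp_open_map[OF homeomorphic_maps_imp_map[OF homeomorphic_left]]
  by (simp add: open_map_def)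

lemma openin_right: "openin T U \<Longrightarrow> s \<in> carrier G \<Longrightarrow> openin T (U #> s)"
  unfolding r_coset_image using homeomorphic_imp_open_map[OF homeomorphic_maps_imp_map[OF homeomorphic_right]]
  by (simp add: open_map_def)

lemma compactin_left: "compactin T K \<Longrightarrow> s \<in> carrier G \<Longrightarrow> compactin T (s <# K)"
  unfolding l_coset_image using homeomorphic_left homeomorphic_maps_def image_compactin by metis

lemma compactin_right: "compactin T K \<Longrightarrow> s \<in> carrier G \<Longrightarrow> compactin T (K #> s)"
  unfolding r_coset_image using homeomorphic_right homeomorphic_maps_def image_compactin by metis

lemma compactin_inv: "compactin T K \<Longrightarrow> compactin T ((\<lambda>x. inv x) ` K)"
  using image_compactin continuous_inv by blast

lemma compactin_mult:
  "compactin T K \<Longrightarrow> compactin T L \<Longrightarrow> compactin T ((\<lambda>(x, y). x \<otimes> y) ` (K \<times> L))"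
  using image_compactin[OF _ continuous_mult] by (simp add: compactin_Times)

lemma nhd_mult_inv:
  assumes U: "openin T U" "\<one> \<in> U"
  obtains V where "openin T V" "\<one> \<in> V" "\<And>x. x \<in> V \<Longrightarrow> inv x \<in> V"
    "\<And>x y. x \<in> V \<Longrightarrow> y \<in> V \<Longrightarrow> x \<otimes> y \<in> U" "V \<subseteq> U"
proof -
  have o: "openin (prod_topology T T) {p \<in> topspace (prod_topology T T). (\<lambda>(x,y). x \<otimes> y) p \<in> U}"
    using continuous_mult U(1) by (rule openin_continuous_map_preimage)
  have i: "(\<one>, \<one>) \<in> {p \<in> topspace (prod_topology T T). (\<lambda>(x,y). x \<otimes> y) p \<in> U}"
    using U by (simp add: topspace_eq_carrier)
  from openin_prod_topology_alt[THEN iffD1, OF o, rule_format, OF i]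
  obtain A B where AB: "openin T A" "openin T B" "\<one> \<in> A" "\<one> \<in> B"
    "A \<times> B \<subseteq> {p \<in> topspace (prod_topology T T). (\<lambda>(x,y). x \<otimes> y) p \<in> U}"
    by blast
  define W where "W = A \<inter> B"
  define V where "V = W \<inter> {x \<in> topspace T. inv x \<in> W}"
  have W: "openin T W" "\<one> \<in> W" using AB by (auto simp: W_def)
  have Wc: "W \<subseteq> carrier G" using W openin_subset topspace_eq_carrier by metis
  have m: "x \<otimes> y \<in> U" if "x \<in> V" "y \<in> V" for x y
    using AB(5) that by (auto simp: V_def W_def)
  show thesis
  proof (rule that[of V])
    show "openin T V"
      unfolding V_def using W openin_continuous_map_preimage[OF continuous_inv W(1)] by blast
    show o: "\<one> \<in> V" using W by (simp add: V_def topspace_eq_carrier)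
    show "\<And>x. x \<in> V \<Longrightarrow> inv x \<in> V" using Wc by (auto simp: V_def topspace_eq_carrier)
    show "x \<otimes> y \<in> U" if "x \<in> V" "y \<in> V" for x y by (rule m[OF that])
    show "V \<subseteq> U" using m[OF _ o] Wc by (force simp: V_def)
  qed
qed

text \<open>If \<open>x \<otimes> y\<close> lies in the support \<open>K\<close> of \<open>f\<close>
  and \<open>y\<close> in \<open>L\<close>, then \<open>x\<close> lies in the product of
  \<open>K\<close> with the inverses of \<open>L\<close>, which is compact.\<close>

lemma right_translation_support:
  assumes f: "f \<in> cc T" and L: "compactin T L"
  obtains C where "compactin T C"
    "\<And>x y. x \<in> carrier G \<Longrightarrow> y \<in> L \<Longrightarrow> x \<notin> C \<Longrightarrow> f (x \<otimes> y) = 0"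
proof -
  obtain K where K: "compactin T K" "\<And>x. x \<in> topspace T \<Longrightarrow> x \<notin> K \<Longrightarrow> f x = 0"
    using f unfolding cc_def by blast
  show thesis
  proof (rule that[OF compactin_mult[OF K(1) compactin_inv[OF L]]])
    fix x y assume xy: "x \<in> carrier G" "y \<in> L" "x \<notin> (\<lambda>(x, y). x \<otimes> y) ` (K \<times> (\<lambda>x. inv x) ` L)"
    have y: "y \<in> carrier G" using xy L compactin_subset_topspace topspace_eq_carrier by blast
    have "x \<otimes> y \<notin> K"
    proof
      assume "x \<otimes> y \<in> K"
      then have "(x \<otimes> y, inv y) \<in> K \<times> (\<lambda>x. inv x) ` L" using xy by blast
      then have "(x \<otimes> y) \<otimes> inv y \<in> (\<lambda>(x, y). x \<otimes> y) ` (K \<times> (\<lambda>x. inv x) ` L)" by force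
      then show False using xy y by (simp add: m_assoc)
    qed
    then show "f (x \<otimes> y) = 0" using K(2) xy y by (simp add: topspace_eq_carrier)
  qed
qed

text \<open>A compact neighbourhood of \<open>y\<close> supplies the common support that
  \<open>continuous_functional\<close> asks for. The statement serves twice: in the uniqueness of
  Haar functionals, and for continuity of the modular function.\<close>

lemma continuous_right_translation:
  assumes I: "positive_functional T I" and f: "f \<in> cc T"
  shows "continuous_map T euclideanreal (\<lambda>y. I (\<lambda>x. f (x \<otimes> y)))"
proof -
  interpret positive_functional T I by fact
  show ?thesis
  proof (rule continuous_functional)
    have "continuous_map (prod_topology T T) T (\<lambda>p. snd p \<otimes> fst p)"
      by (intro continuous_map_mult continuous_intros)
    from continuous_map_compose[OF this cc_continuous[OF f]]
    show "continuous_map (prod_topology T T) euclideanreal (\<lambda>(y, x). f (x \<otimes> y))"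
      by (simp add: o_def case_prod_unfold)
    fix y assume "y \<in> topspace T"
    then obtain V L where V: "openin T V" "compactin T L" "y \<in> V" "V \<subseteq> L"
      using locally_compact unfolding locally_compact_space_def by blast
    obtain C where "compactin T C" "\<And>x y. x \<in> carrier G \<Longrightarrow> y \<in> L \<Longrightarrow> x \<notin> C \<Longrightarrow> f (x \<otimes> y) = 0"
      using right_translation_support[OF f V(2)] by blast
    then show "\<exists>V L. openin T V \<and> y \<in> V \<and> compactin T L \<and> (\<forall>v\<in>V. \<forall>x\<in>topspace T - L. f (x \<otimes> v) = 0)"
      using V by (intro exI[of _ V] exI[of _ C]) (auto simp: topspace_eq_carrier)
  qed
qed

text \<open>These are the two integrands whose integrations are exchanged in the uniqueness
  argument. In the second one, \<open>x\<close> is the product of \<open>y\<close> and the inverse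
  of \<open>inv x \<otimes> y\<close>, so both factors being nonzero confines \<open>x\<close> to a
  compact set.\<close>

lemma cc_product_shear:
  assumes h: "h \<in> cc T" and f: "f \<in> cc T"
  shows "(\<lambda>(x,y). h y * f (x \<otimes> y)) \<in> cc (prod_topology T T)"
    and "(\<lambda>(x,y). h (inv x \<otimes> y) * f y) \<in> cc (prod_topology T T)"
proof -
  have cs: "continuous_map (prod_topology T T) T snd" "continuous_map (prod_topology T T) T fst"
    by (intro continuous_intros)+
  obtain H where H: "compactin T H" "\<And>x. x \<in> topspace T \<Longrightarrow> x \<notin> H \<Longrightarrow> h x = 0"
    using h unfolding cc_def by blast
  obtain K where K: "compactin T K" "\<And>x. x \<in> topspace T \<Longrightarrow> x \<notin> K \<Longrightarrow> f x = 0"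
    using f unfolding cc_def by blast
  show "(\<lambda>(x,y). h y * f (x \<otimes> y)) \<in> cc (prod_topology T T)"
  proof -
    obtain C where C: "compactin T C" "\<And>x y. x \<in> carrier G \<Longrightarrow> y \<in> H \<Longrightarrow> x \<notin> C \<Longrightarrow> f (x \<otimes> y) = 0"
      using right_translation_support[OF f H(1)] by blast
    have "continuous_map (prod_topology T T) euclideanreal (\<lambda>p. h (snd p) * f (fst p \<otimes> snd p))"
      using continuous_map_compose[OF cs(1) cc_continuous[OF h]]
        continuous_map_compose[OF continuous_map_mult[OF cs(2,1)] cc_continuous[OF f]]
      by (intro continuous_map_real_mult) (simp_all add: o_def)
    moreover have "compactin (prod_topology T T) (C \<times> H)" using C H by (simp add: compactin_Times)
    ultimately have "(\<lambda>p. h (snd p) * f (fst p \<otimes> snd p)) \<in> cc (prod_topology T T)"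
    proof (rule ccI)
      fix p assume p: "p \<in> topspace (prod_topology T T)" "p \<notin> C \<times> H"
      then have p': "fst p \<in> carrier G" "snd p \<in> topspace T" "fst p \<notin> C \<or> snd p \<notin> H"
        by (auto simp: topspace_eq_carrier)
      then show "h (snd p) * f (fst p \<otimes> snd p) = 0"
        using C(2)[OF p'(1), of "snd p"] H(2)[OF p'(2)] by (cases "snd p \<in> H") auto
    qed
    then show ?thesis by (simp add: case_prod_unfold)
  qed
  show "(\<lambda>(x,y). h (inv x \<otimes> y) * f y) \<in> cc (prod_topology T T)"
  proof -
    define C where "C = (\<lambda>(x, y). x \<otimes> y) ` (K \<times> (\<lambda>x. inv x) ` H)"
    have C: "compactin T C" unfolding C_def by (intro compactin_mult compactin_inv K H)
    have z: "h (inv x \<otimes> y) * f y = 0" if "x \<in> carrier G" "y \<in> carrier G" "x \<notin> C \<or> y \<notin> K" for x y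
    proof (cases "y \<in> K \<and> inv x \<otimes> y \<in> H")
      case True
      then have "(y, inv (inv x \<otimes> y)) \<in> K \<times> (\<lambda>x. inv x) ` H" by blast
      then have "y \<otimes> inv (inv x \<otimes> y) \<in> C" unfolding C_def by force
      then have "x \<in> C" using that by (simp add: inv_mult_group m_assoc[symmetric])
      then show ?thesis using that True by blast
    next
      case False
      then show ?thesis using K H that by (auto simp: topspace_eq_carrier)
    qed
    have "continuous_map (prod_topology T T) euclideanreal (\<lambda>p. h (inv (fst p) \<otimes> snd p) * f (snd p))"
      using continuous_map_compose[OF cs(1) cc_continuous[OF f]]
        continuous_map_compose[OF continuous_map_mult[OF continuous_map_inverse[OF cs(2)] cs(1)] cc_continuous[OF h]]
      by (intro continuous_map_real_mult) (simp_all add: o_def)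
    moreover have "compactin (prod_topology T T) (C \<times> K)" using C K by (simp add: compactin_Times)
    ultimately have "(\<lambda>p. h (inv (fst p) \<otimes> snd p) * f (snd p)) \<in> cc (prod_topology T T)"
    proof (rule ccI)
      fix p assume "p \<in> topspace (prod_topology T T)" "p \<notin> C \<times> K"
      then have "fst p \<in> carrier G" "snd p \<in> carrier G" "fst p \<notin> C \<or> snd p \<notin> K"
        by (auto simp: topspace_eq_carrier)
      then show "h (inv (fst p) \<otimes> snd p) * f (snd p) = 0" by (rule z)
    qed
    then show ?thesis by (simp add: case_prod_unfold)
  qed
qed

end

locale left_invariant_functional = locally_compact_group G T + positive_functional T I
  for G (structure) and T and I +
  assumes left_invariant: "\<And>s f. s \<in> carrier G \<Longrightarrow> f \<in> cc T \<Longrightarrow> I (\<lambda>x. f (s \<otimes> x)) = I f"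

text \<open>Nontriviality is kept apart from invariance, because functionals built from others (a
  right translate, an integral over a quotient) are compared with a Haar functional before they are
  known to be nonzero.\<close>

locale haar_functional = left_invariant_functional +
  assumes nontrivial: "\<exists>f\<in>cc T. I f \<noteq> 0"
begin

text \<open>If \<open>I f\<close> vanished, so would the integral of any finite sum of left
  translates of \<open>f\<close>. Such sums dominate a multiple of every function in
  \<open>cc T\<close>, by covering its support with translates of the set where \<open>f\<close>
  exceeds half its value at \<open>a\<close>; then \<open>I\<close> would be zero.\<close>

lemma strictly_positive:
  assumes f: "f \<in> cc T" "\<And>x. x \<in> carrier G \<Longrightarrow> 0 \<le> f x" and a: "a \<in> carrier G" "f a > 0"
  shows "I f > 0"
proof (rule ccontr)
  assume "\<not> I f > 0"
  then have If: "I f = 0" using I_nonneg[OF f(1)] f(2) by (force simp: topspace_eq_carrier)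
  obtain g where g: "g \<in> cc T" "I g \<noteq> 0" using nontrivial by blast
  obtain K where K: "compactin T K" "\<And>x. x \<in> topspace T \<Longrightarrow> x \<notin> K \<Longrightarrow> g x = 0"
    using g unfolding cc_def by blast
  obtain B where B: "0 \<le> B" "\<And>x. x \<in> topspace T \<Longrightarrow> \<bar>g x\<bar> \<le> B" using cc_bounded[OF g(1)] by blast
  have Kc: "K \<subseteq> carrier G" using K compactin_subset_topspace topspace_eq_carrier by metis
  \<comment> \<open>Left multiplication by \<open>a \<otimes> inv x\<close> carries \<open>x\<close>
    to \<open>a\<close>, so the translated function takes the value \<open>f a\<close> at
    \<open>x\<close>.\<close>
  define V where "V x = {y \<in> topspace T. f ((a \<otimes> inv x) \<otimes> y) \<in> {f a / 2<..}}" for x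
  have V: "openin T (V x)" "x \<in> V x" if "x \<in> K" for x
  proof -
    have "(\<lambda>y. f ((a \<otimes> inv x) \<otimes> y)) \<in> cc T" using that Kc a f by (intro cc_left) auto
    then show "openin T (V x)"
      unfolding V_def using openin_continuous_map_preimage[OF cc_continuous, of _ T "{f a / 2<..}"] by simp
    show "x \<in> V x" using that Kc a by (auto simp: V_def topspace_eq_carrier m_assoc)
  qed
  obtain D where D: "finite D" "D \<subseteq> K" "K \<subseteq> \<Union>(V ` D)"
    using compactin_pointwise_cover[OF K(1) V] by blast
  define h where "h y = (\<Sum>x\<in>D. f ((a \<otimes> inv x) \<otimes> y))" for y
  have c: "(\<lambda>y. f ((a \<otimes> inv x) \<otimes> y)) \<in> cc T" if "x \<in> D" for x
    using that Kc a f D by (intro cc_left) auto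
  have h: "h \<in> cc T" unfolding h_def by (rule cc_sum[OF D(1) c])
  have "I h = (\<Sum>x\<in>D. I (\<lambda>y. f ((a \<otimes> inv x) \<otimes> y)))"
    unfolding h_def by (rule I_sum[OF D(1) c])
  also have "\<dots> = (\<Sum>x\<in>D. I f)"
    using D Kc a f by (intro sum.cong refl left_invariant) auto
  finally have Ih: "I h = 0" using If by simp
  have h0: "0 \<le> h y" if "y \<in> carrier G" for y
    unfolding h_def using that f a D Kc by (intro sum_nonneg f(2)) auto
  have "\<bar>g y\<bar> \<le> (2 * B / f a) * h y" if y: "y \<in> topspace T" for y
  proof (cases "y \<in> K")
    case True
    then obtain x where x: "x \<in> D" "y \<in> V x" using D by blast
    have "f a / 2 \<le> f ((a \<otimes> inv x) \<otimes> y)" using x by (simp add: V_def)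
    also have "\<dots> \<le> h y"
      unfolding h_def using x D Kc a y by (intro member_le_sum f(2)) (auto simp: topspace_eq_carrier)
    finally have "(2 * B / f a) * (f a / 2) \<le> (2 * B / f a) * h y"
      using B a by (intro mult_left_mono) auto
    then show ?thesis using B(2)[OF y] a by simp
  next
    case False
    then show ?thesis using K y h0 B a by (simp add: topspace_eq_carrier)
  qed
  from I_bound[OF g(1) h this] show False using Ih g by simp
qed

text \<open>For a symmetric bump \<open>h\<close> near the identity, two changes of variables and two exchanges of the
  order of integration turn \<open>I h * J f\<close> into \<open>J\<^sub>y (h y * I\<^sub>x (f (x y)))\<close>, which is close to
  \<open>J h * I f\<close>.\<close>

lemma unique:
  assumes J: "left_invariant_functional G T J" and f: "f \<in> cc T" and g: "g \<in> cc T"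
  shows "J f * I g = J g * I f"
proof (cases "\<exists>f\<in>cc T. J f \<noteq> 0")
  case False
  then show ?thesis using f g by simp
next
  case True
  interpret J: left_invariant_functional G T J by fact
  interpret JH: haar_functional G T J by unfold_locales (rule True)
  have PI: "positive_functional T I" and PJ: "positive_functional T J" by unfold_locales
  have key: "\<bar>J f * I g - J g * I f\<bar> \<le> e * (\<bar>J f\<bar> + \<bar>J g\<bar>)" if e: "e > 0" for e
  proof -
    have ex: "\<exists>U. openin T U \<and> \<one> \<in> U \<and> (\<forall>y\<in>U. \<bar>I (\<lambda>x. u (x \<otimes> y)) - I u\<bar> < e)" if u: "u \<in> cc T" for u
    proof -
      have "I (\<lambda>x. u (x \<otimes> \<one>)) = I u"
        by (intro I_cong cc_right u) (auto simp: topspace_eq_carrier)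
      then show ?thesis
        using continuous_right_translation[OF PI u, unfolded continuous_map_real_iff] e
        by (metis one_closed topspace_eq_carrier)
    qed
    obtain U1 U2 where U: "openin T U1" "\<one> \<in> U1" "\<And>y. y\<in>U1 \<Longrightarrow> \<bar>I (\<lambda>x. f (x \<otimes> y)) - I f\<bar> < e"
      "openin T U2" "\<one> \<in> U2" "\<And>y. y\<in>U2 \<Longrightarrow> \<bar>I (\<lambda>x. g (x \<otimes> y)) - I g\<bar> < e"
      using ex[OF f] ex[OF g] by blast
    have "openin T (U1 \<inter> U2)" "\<one> \<in> U1 \<inter> U2" using U by auto
    then obtain V where V: "openin T V" "\<one> \<in> V" "\<And>x. x \<in> V \<Longrightarrow> inv x \<in> V" "V \<subseteq> U1 \<inter> U2"
      using nhd_mult_inv by metis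
    have "compactin T {\<one>}" by (simp add: topspace_eq_carrier)
    then obtain b L where b: "b \<in> cc T" "\<And>x. x \<in> topspace T \<Longrightarrow> 0 \<le> b x" "b \<one> = 1" "L \<subseteq> V"
      "\<And>x. x \<in> topspace T \<Longrightarrow> x \<notin> L \<Longrightarrow> b x = 0"
      by (rule bump[of "{\<one>}" V]) (use V in auto)
    \<comment> \<open>The symmetry of \<open>h\<close> will let \<open>inv y \<otimes> x\<close> be
      replaced by its inverse \<open>inv x \<otimes> y\<close>. Since \<open>V\<close> is closed
      under inverses, \<open>h\<close> still vanishes off \<open>V\<close>.\<close>
    define h where "h x = b x + b (inv x)" for x
    have h: "h \<in> cc T" unfolding h_def by (intro cc_add cc_inv b)
    have h0: "0 \<le> h x" if "x \<in> carrier G" for x using b(2) that by (simp add: h_def topspace_eq_carrier)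
    have hs: "h (inv x) = h x" if "x \<in> carrier G" for x using that by (simp add: h_def)
    have hV: "h x = 0" if "x \<in> carrier G" "x \<notin> V" for x
    proof -
      have "inv x \<notin> V" using V(3)[of "inv x"] that by auto
      then have "x \<notin> L" "inv x \<notin> L" using that b(4) by blast+
      then show ?thesis using that b(5) by (simp add: h_def topspace_eq_carrier)
    qed
    have "h \<one> > 0" using b by (simp add: h_def)
    then have Jh: "J h > 0" using JH.strictly_positive[OF h h0] by blast
    have est: "\<bar>I h * J u - J h * I u\<bar> \<le> e * J h"
      if u: "u \<in> cc T" and uV: "\<And>y. y \<in> V \<Longrightarrow> \<bar>I (\<lambda>x. u (x \<otimes> y)) - I u\<bar> < e" for u
    proof -
      have c1: "(\<lambda>(x,y). h y * u (x \<otimes> y)) \<in> cc (prod_topology T T)"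
        and c2: "(\<lambda>(x,y). h (inv x \<otimes> y) * u y) \<in> cc (prod_topology T T)"
        by (rule cc_product_shear[OF h u])+
      have "I h * J u = J (\<lambda>y. I h * u y)" using u by (simp add: J.I_cmult)
      also have "\<dots> = J (\<lambda>y. I (\<lambda>x. h (inv x \<otimes> y) * u y))"
      proof (rule J.I_cong)
        show "(\<lambda>y. I h * u y) \<in> cc T" using u by (rule cc_cmult)
        fix y assume "y \<in> topspace T"
        then have y: "y \<in> carrier G" by (simp add: topspace_eq_carrier)
        have ch: "(\<lambda>x. h (inv y \<otimes> x)) \<in> cc T" using h y by (intro cc_left) auto
        \<comment> \<open>Left invariance of \<open>I\<close> introduces \<open>inv y\<close> inside
          \<open>h\<close>; the symmetry of \<open>h\<close> then puts the integrand in a form where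
          \<open>x\<close> can be removed by a translation in \<open>y\<close>.\<close>
        have "I h * u y = u y * I (\<lambda>x. h (inv y \<otimes> x))" using left_invariant[of "inv y" h] y h by simp
        also have "\<dots> = I (\<lambda>x. u y * h (inv y \<otimes> x))" using ch by (simp add: I_cmult)
        also have "\<dots> = I (\<lambda>x. h (inv x \<otimes> y) * u y)"
        proof (rule I_cong[OF cc_cmult[OF ch]])
          fix x assume "x \<in> topspace T"
          then show "u y * h (inv y \<otimes> x) = h (inv x \<otimes> y) * u y"
            using hs[of "inv y \<otimes> x"] y by (simp add: topspace_eq_carrier inv_mult_group)
        qed
        finally show "I h * u y = I (\<lambda>x. h (inv x \<otimes> y) * u y)" .
      qed
      also have "\<dots> = I (\<lambda>x. J (\<lambda>y. h (inv x \<otimes> y) * u y))"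
        by (rule functional_swap[OF PI PJ c2, symmetric])
      \<comment> \<open>For fixed \<open>x\<close>, the inner functional \<open>J\<close> is
        translated by \<open>x\<close> in the variable \<open>y\<close>: this frees \<open>h\<close>
        of \<open>x\<close> and moves \<open>x\<close> into \<open>u\<close>.\<close>
      also have "\<dots> = I (\<lambda>x. J (\<lambda>y. h y * u (x \<otimes> y)))"
      proof (rule I_cong)
        show "(\<lambda>x. J (\<lambda>y. h (inv x \<otimes> y) * u y)) \<in> cc T" by (rule J.cc_functional[OF c2])
        fix x assume x: "x \<in> topspace T"
        then have x': "x \<in> carrier G" by (simp add: topspace_eq_carrier)
        note sl = J.cc_slice[OF c2 x]
        have "J (\<lambda>y. h (inv x \<otimes> y) * u y) = J (\<lambda>y. h (inv x \<otimes> (x \<otimes> y)) * u (x \<otimes> y))"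
          using J.left_invariant[OF x' sl] by simp
        also have "\<dots> = J (\<lambda>y. h y * u (x \<otimes> y))"
          using cc_left[OF sl x'] x' by (intro J.I_cong) (auto simp: topspace_eq_carrier m_assoc[symmetric])
        finally show "J (\<lambda>y. h (inv x \<otimes> y) * u y) = J (\<lambda>y. h y * u (x \<otimes> y))" .
      qed
      also have "\<dots> = J (\<lambda>y. I (\<lambda>x. h y * u (x \<otimes> y)))"
        by (rule functional_swap[OF PI PJ c1])
      finally have e1: "I h * J u = J (\<lambda>y. I (\<lambda>x. h y * u (x \<otimes> y)))" .
      have c3: "(\<lambda>y. I (\<lambda>x. h y * u (x \<otimes> y))) \<in> cc T" by (rule cc_functional[OF cc_swap[OF c1]])
      have c4: "(\<lambda>y. I u * h y) \<in> cc T" using h by (rule cc_cmult)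
      have "I h * J u - J h * I u = J (\<lambda>y. I (\<lambda>x. h y * u (x \<otimes> y)) - I u * h y)"
        using c3 c4 h by (simp add: e1 J.I_diff J.I_cmult)
      also have "\<bar>\<dots>\<bar> \<le> e * J h"
      proof (rule J.I_bound[OF cc_diff[OF c3 c4] h])
        fix y assume "y \<in> topspace T"
        then have y: "y \<in> carrier G" by (simp add: topspace_eq_carrier)
        have "I (\<lambda>x. h y * u (x \<otimes> y)) = h y * I (\<lambda>x. u (x \<otimes> y))"
          using cc_right[OF u y] by (rule I_cmult)
        then have eq: "\<bar>I (\<lambda>x. h y * u (x \<otimes> y)) - I u * h y\<bar> = h y * \<bar>I (\<lambda>x. u (x \<otimes> y)) - I u\<bar>"
          using h0[OF y] by (simp add: abs_mult flip: right_diff_distrib mult.commute[of "h y" "I u"])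
        show "\<bar>I (\<lambda>x. h y * u (x \<otimes> y)) - I u * h y\<bar> \<le> e * h y"
        proof (cases "y \<in> V")
          case True
          then show ?thesis
            unfolding eq using uV[OF True] h0[OF y] by (subst mult.commute) (intro mult_right_mono, auto)
        qed (simp add: hV[OF y] I_zero)
      qed
      finally show ?thesis .
    qed
    \<comment> \<open>The same ratio serves \<open>f\<close> and \<open>g\<close>, as
      \<open>h\<close> is concentrated where right translation changes both integrals by less than
      \<open>e\<close>. Eliminating \<open>r\<close> leaves the cross products
      \<open>J f * I g\<close> and \<open>J g * I f\<close>.\<close>
    define r where "r = I h / J h"
    have r: "\<bar>r * J u - I u\<bar> \<le> e" if "u \<in> cc T" "\<And>y. y \<in> V \<Longrightarrow> \<bar>I (\<lambda>x. u (x \<otimes> y)) - I u\<bar> < e" for u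
    proof -
      have "r * J u - I u = (I h * J u - J h * I u) / J h" using Jh by (simp add: r_def field_simps)
      then have "\<bar>r * J u - I u\<bar> = \<bar>I h * J u - J h * I u\<bar> / J h" using Jh by simp
      also have "\<dots> \<le> e" using est[OF that] Jh by (simp add: divide_le_eq)
      finally show ?thesis .
    qed
    have rf: "\<bar>r * J f - I f\<bar> \<le> e" using U V by (intro r f) auto
    have rg: "\<bar>r * J g - I g\<bar> \<le> e" using U V by (intro r g) auto
    have "J f * I g - J g * I f = J g * (r * J f - I f) - J f * (r * J g - I g)" by (simp add: algebra_simps)
    also have "\<bar>\<dots>\<bar> \<le> \<bar>J g\<bar> * \<bar>r * J f - I f\<bar> + \<bar>J f\<bar> * \<bar>r * J g - I g\<bar>"
      by (metis abs_mult abs_triangle_ineq4)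
    also have "\<dots> \<le> \<bar>J g\<bar> * e + \<bar>J f\<bar> * e"
      using rf rg by (intro add_mono mult_left_mono) auto
    finally show ?thesis by (simp add: algebra_simps)
  qed
  have "\<bar>J f * I g - J g * I f\<bar> \<le> 0"
  proof (rule field_le_epsilon)
    fix d :: real assume d: "d > 0"
    define s where "s = \<bar>J f\<bar> + \<bar>J g\<bar>"
    have s: "s \<ge> 0" by (simp add: s_def)
    have "\<bar>J f * I g - J g * I f\<bar> \<le> d / (s + 1) * s"
      unfolding s_def using d by (intro key) (simp add: add_nonneg_pos)
    also have "\<dots> \<le> d" using s d by (simp add: field_simps)
    finally show "\<bar>J f * I g - J g * I f\<bar> \<le> 0 + d" by simp
  qed
  then show ?thesis by simp
qed

lemma proportional:
  assumes J: "left_invariant_functional G T J"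
  obtains c where "\<And>f. f \<in> cc T \<Longrightarrow> J f = c * I f"
proof -
  obtain g where g: "g \<in> cc T" "I g \<noteq> 0" using nontrivial by blast
  show thesis
    by (rule that[of "J g / I g"]) (use unique[OF J _ g(1)] g in \<open>simp add: field_simps\<close>)
qed

end

section \<open>Radon measures from contents\<close>

lemma radon_measureD:
  assumes "radon_measure X \<mu>"
  shows "space \<mu> = topspace X"
    and "sets \<mu> = sigma_sets (topspace X) {U. openin X U}"
    and "compactin X K \<Longrightarrow> emeasure \<mu> K < \<infinity>"
    and "E \<in> sets \<mu> \<Longrightarrow> emeasure \<mu> E = (INF U\<in>{U. openin X U \<and> E \<subseteq> U}. emeasure \<mu> U)"
    and "openin X U \<Longrightarrow> emeasure \<mu> U = (SUP K\<in>{K. compactin X K \<and> K \<subseteq> U}. emeasure \<mu> K)"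
    and "openin X U \<Longrightarrow> U \<in> sets \<mu>"
  using assms unfolding radon_measure_def by auto

lemma radon_measure_compact_sets:
  assumes \<mu>: "radon_measure X \<mu>" and X: "Hausdorff_space X" and K: "compactin X K"
  shows "K \<in> sets \<mu>"
proof -
  have "topspace X - (topspace X - K) \<in> sets \<mu>"
    using radon_measureD(6)[OF \<mu> openin_diff[OF openin_topspace compactin_imp_closedin[OF X K]]]
    unfolding radon_measureD(2)[OF \<mu>] by (rule sigma_sets.Compl)
  then show ?thesis using compactin_subset_topspace[OF K] by (simp add: double_diff)
qed

lemma continuous_map_measurable:
  assumes \<mu>: "radon_measure X \<mu>" and h: "continuous_map X X h"
  shows "h \<in> measurable \<mu> \<mu>"
proof (rule measurable_sigma_sets[OF radon_measureD(2)[OF \<mu>]])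
  show "{U. openin X U} \<subseteq> Pow (topspace X)" using openin_subset by blast
  show "h \<in> space \<mu> \<rightarrow> topspace X"
    using h radon_measureD(1)[OF \<mu>] by (simp add: continuous_map_def)
  fix U assume "U \<in> {U. openin X U}"
  then have "openin X {x \<in> topspace X. h x \<in> U}"
    using h by (intro openin_continuous_map_preimage) auto
  moreover have "h -` U \<inter> space \<mu> = {x \<in> topspace X. h x \<in> U}" using radon_measureD(1)[OF \<mu>] by auto
  ultimately show "h -` U \<inter> space \<mu> \<in> sets \<mu>" using radon_measureD(6)[OF \<mu>] by simp
qed

text \<open>The compact sets \<open>K - U\<close> and \<open>K - V\<close> are disjoint; removing
  from \<open>K\<close> disjoint open neighbourhoods of them gives the two pieces. This is the
  source of subadditivity on open sets.\<close>

lemma compactin_split: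
  assumes X: "Hausdorff_space X" and K: "compactin X K" and UV: "openin X U" "openin X V" "K \<subseteq> U \<union> V"
  obtains A B where "compactin X A" "compactin X B" "A \<subseteq> U" "B \<subseteq> V" "K = A \<union> B"
proof -
  have c: "compactin X (K - W)" if "openin X W" for W
  proof -
    have "K - W = K \<inter> (topspace X - W)" using compactin_subset_topspace[OF K] by blast
    then show ?thesis using compact_Int_closedin[OF K closedin_diff[OF closedin_topspace that]] by simp
  qed
  have "disjnt (K - U) (K - V)" using UV by (auto simp: disjnt_iff)
  then obtain A B where AB: "openin X A" "openin X B" "K - U \<subseteq> A" "K - V \<subseteq> B" "disjnt A B"
    using Hausdorff_space_compact_separation[OF X c[OF UV(1)] c[OF UV(2)]] by metis
  show thesis
  proof (rule that[of "K - A" "K - B"])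
    show "compactin X (K - A)" "compactin X (K - B)" using c AB by auto
    show "K - A \<subseteq> U" "K - B \<subseteq> V" "K = K - A \<union> (K - B)" using AB by (auto simp: disjnt_iff)
  qed
qed

section \<open>Contents on compact sets and the measures they induce\<close>

locale compact_content =
  fixes X :: "'a topology" and v :: "'a set \<Rightarrow> real"
  assumes loc_compact: "locally_compact_space X" and hausdorff: "Hausdorff_space X"
    and v_nonneg: "\<And>K. compactin X K \<Longrightarrow> 0 \<le> v K"
    and v_mono: "\<And>K L. compactin X K \<Longrightarrow> compactin X L \<Longrightarrow> K \<subseteq> L \<Longrightarrow> v K \<le> v L"
    and v_Un: "\<And>K L. compactin X K \<Longrightarrow> compactin X L \<Longrightarrow> v (K \<union> L) \<le> v K + v L"
    and v_disjoint: "\<And>K L. compactin X K \<Longrightarrow> compactin X L \<Longrightarrow> K \<inter> L = {} \<Longrightarrow> v (K \<union> L) = v K + v L"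
begin

definition inner_vol :: "'a set \<Rightarrow> ennreal" where
  "inner_vol U = (SUP K\<in>{K. compactin X K \<and> K \<subseteq> U}. ennreal (v K))"

definition outer_vol :: "'a set \<Rightarrow> ennreal" where
  "outer_vol E = (INF U\<in>{U. openin X U \<and> E \<subseteq> U}. inner_vol U)"

lemma inner_vol_upper: "compactin X K \<Longrightarrow> K \<subseteq> U \<Longrightarrow> ennreal (v K) \<le> inner_vol U"
  unfolding inner_vol_def by (intro SUP_upper) auto

lemma inner_vol_mono: "U \<subseteq> V \<Longrightarrow> inner_vol U \<le> inner_vol V"
  unfolding inner_vol_def by (intro SUP_subset_mono) auto

lemma outer_vol_open: "openin X U \<Longrightarrow> outer_vol U = inner_vol U"
  unfolding outer_vol_def by (intro antisym INF_lower2[of U] INF_greatest inner_vol_mono) auto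

lemma outer_vol_mono: "E \<subseteq> F \<Longrightarrow> outer_vol E \<le> outer_vol F"
  unfolding outer_vol_def by (intro INF_superset_mono) auto

text \<open>A content carries no regularity here, so the induced measure of a compact set may be
  strictly larger than its content. This inequality is enough for inner regularity on open
  sets.\<close>

lemma outer_vol_compact_ge: "compactin X K \<Longrightarrow> ennreal (v K) \<le> outer_vol K"
  unfolding outer_vol_def by (intro INF_greatest) (auto intro: inner_vol_upper)

text \<open>An open \<open>V\<close> around \<open>K\<close> inside a compact \<open>L\<close> has
  inner volume at most \<open>v L\<close>.\<close>

lemma outer_vol_compact_finite:
  assumes K: "compactin X K"
  shows "outer_vol K < \<infinity>"
proof -
  obtain V L where VL: "openin X V" "compactin X L" "K \<subseteq> V" "V \<subseteq> L"
    by (rule compact_sandwich[OF loc_compact hausdorff K openin_topspace compactin_subset_topspace[OF K]])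
  have "outer_vol K \<le> inner_vol V" unfolding outer_vol_def using VL by (intro INF_lower) auto
  also have "\<dots> \<le> ennreal (v L)"
    unfolding inner_vol_def
  proof (rule SUP_least)
    fix C assume "C \<in> {K. compactin X K \<and> K \<subseteq> V}"
    then show "ennreal (v C) \<le> ennreal (v L)" using VL v_mono[of C L] by (auto intro!: ennreal_leI)
  qed
  finally show ?thesis using ennreal_less_top[of "v L"] by (simp add: order_le_less_trans)
qed

lemma v_empty: "v {} = 0"
  using v_disjoint[of "{}" "{}"] by simp

lemma inner_vol_empty: "inner_vol {} = 0"
proof -
  have "{K. compactin X K \<and> K \<subseteq> {}} = {{}}" by auto
  then show ?thesis by (simp add: inner_vol_def v_empty)
qed

lemma inner_vol_Un:
  assumes "openin X U" "openin X V"
  shows "inner_vol (U \<union> V) \<le> inner_vol U + inner_vol V"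
  unfolding inner_vol_def[of "U \<union> V"]
proof (rule SUP_least)
  fix K assume K: "K \<in> {K. compactin X K \<and> K \<subseteq> U \<union> V}"
  then obtain A B where AB: "compactin X A" "compactin X B" "A \<subseteq> U" "B \<subseteq> V" "K = A \<union> B"
    using compactin_split[OF hausdorff _ assms, of K] by blast
  then have "ennreal (v K) \<le> ennreal (v A) + ennreal (v B)"
    using v_Un[OF AB(1,2)] v_nonneg by (simp add: ennreal_leI flip: ennreal_plus)
  also have "\<dots> \<le> inner_vol U + inner_vol V" using AB by (intro add_mono inner_vol_upper)
  finally show "ennreal (v K) \<le> inner_vol U + inner_vol V" .
qed

lemma inner_vol_finite_UN:
  assumes "\<And>i. openin X (U i)"
  shows "inner_vol (\<Union>i<(n::nat). U i) \<le> (\<Sum>i<n. inner_vol (U i))"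
proof (induction n)
  case (Suc n)
  have "inner_vol (\<Union>i<Suc n. U i) = inner_vol ((\<Union>i<n. U i) \<union> U n)" by (simp add: lessThan_Suc Un_commute)
  also have "\<dots> \<le> inner_vol (\<Union>i<n. U i) + inner_vol (U n)" using assms by (intro inner_vol_Un) auto
  finally show ?case using Suc by (auto intro: order_trans add_right_mono)
qed (simp add: inner_vol_empty)

text \<open>Each compact set competing in the supremum meets the union in a finite subcover, so
  finite subadditivity is enough.\<close>

lemma inner_vol_UN:
  assumes U: "\<And>i. openin X (U i)"
  shows "inner_vol (\<Union>i::nat. U i) \<le> (\<Sum>i. inner_vol (U i))"
  unfolding inner_vol_def[of "\<Union>i. U i"]
proof (rule SUP_least)
  fix K assume "K \<in> {K. compactin X K \<and> K \<subseteq> (\<Union>i. U i)}"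
  then have K: "compactin X K" "K \<subseteq> \<Union>(range U)" by auto
  then obtain \<F> where F: "finite \<F>" "\<F> \<subseteq> range U" "K \<subseteq> \<Union>\<F>"
    using compactinD[of X K "range U"] U by blast
  obtain D where D: "finite D" "\<F> = U ` D" using finite_subset_image[OF F(1,2)] by blast
  obtain n where "D \<subseteq> {..<n}" using finite_nat_bounded[OF D(1)] by blast
  then have "K \<subseteq> (\<Union>i<n. U i)" using F D by blast
  then have "ennreal (v K) \<le> inner_vol (\<Union>i<n. U i)" using K by (intro inner_vol_upper)
  also have "\<dots> \<le> (\<Sum>i<n. inner_vol (U i))" by (rule inner_vol_finite_UN[OF U])
  also have "\<dots> \<le> (\<Sum>i. inner_vol (U i))" by (rule sum_le_suminf) auto
  finally show "ennreal (v K) \<le> (\<Sum>i. inner_vol (U i))" .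
qed

lemma countably_subadditive_outer: "countably_subadditive (Pow (topspace X)) outer_vol"
  unfolding countably_subadditive_def
proof safe
  fix A :: "nat \<Rightarrow> 'a set" assume A: "range A \<subseteq> Pow (topspace X)"
  show "outer_vol (\<Union>i. A i) \<le> (\<Sum>i. outer_vol (A i))"
  proof (rule ennreal_le_epsilon)
    fix e :: real assume e: "0 < e" "(\<Sum>i. outer_vol (A i)) < top_class.top"
    have "\<exists>U. openin X U \<and> A n \<subseteq> U \<and> inner_vol U \<le> outer_vol (A n) + e * (1/2)^Suc n" for n
    proof -
      have "outer_vol (A n) < outer_vol (A n) + e * (1/2)^Suc n"
        using e by (auto simp add: less_top dest!: ennreal_suminf_lessD)
      then show ?thesis
        unfolding outer_vol_def[of "A n"] INF_less_iff by (auto dest: less_imp_le)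
    qed
    then obtain U where U: "\<And>n. openin X (U n)" "\<And>n. A n \<subseteq> U n" "\<And>n. inner_vol (U n) \<le> outer_vol (A n) + e * (1/2)^Suc n"
      by metis
    have "outer_vol (\<Union>i. A i) \<le> outer_vol (\<Union>i. U i)" using U by (intro outer_vol_mono) blast
    also have "\<dots> = inner_vol (\<Union>i. U i)" using U by (intro outer_vol_open) auto
    also have "\<dots> \<le> (\<Sum>i. inner_vol (U i))" by (rule inner_vol_UN[OF U(1)])
    also have "\<dots> \<le> (\<Sum>n. outer_vol (A n) + e * (1/2) ^ Suc n)"
      using U by (intro suminf_le) auto
    also have "\<dots> = (\<Sum>n. outer_vol (A n)) + (\<Sum>n. ennreal e * ennreal ((1/2) ^ Suc n))"
      using e by (subst suminf_add[symmetric])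
                 (auto simp del: ennreal_suminf_cmult simp add: ennreal_mult[symmetric])
    also have "\<dots> = (\<Sum>n. outer_vol (A n)) + e"
      unfolding ennreal_suminf_cmult
      by (subst suminf_ennreal_eq[OF zero_le_power power_half_series]) auto
    finally show "outer_vol (\<Union>i. A i) \<le> (\<Sum>n. outer_vol (A n)) + e" .
  qed
qed

lemma outer_measure_space_outer: "outer_measure_space (Pow (topspace X)) outer_vol"
proof -
  have "positive (Pow (topspace X)) outer_vol"
    using outer_vol_open[of "{}"] by (simp add: positive_def inner_vol_empty)
  moreover have "increasing (Pow (topspace X)) outer_vol"
    by (simp add: increasing_def outer_vol_mono)
  ultimately show ?thesis
    using countably_subadditive_outer by (simp add: outer_measure_space_def)
qed

text \<open>Choose a compact \<open>K\<close> in \<open>V \<inter> U\<close> and then a compact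
  \<open>L\<close> in \<open>V - K\<close>: the content is additive on the disjoint pair, and
  \<open>V - K\<close> is an open set containing \<open>V - U\<close>. Suprema over \<open>L\<close>
  and then over \<open>K\<close> give the claim.\<close>

lemma inner_vol_split:
  assumes U: "openin X U" and V: "openin X V"
  shows "outer_vol (V \<inter> U) + outer_vol (V - U) \<le> inner_vol V"
proof -
  have 1: "ennreal (v K) + outer_vol (V - U) \<le> inner_vol V" if K: "compactin X K" "K \<subseteq> V \<inter> U" for K
  proof -
    have o: "openin X (V - K)" using V K(1) hausdorff compactin_imp_closedin by blast
    have "ennreal (v K) + outer_vol (V - U) \<le> ennreal (v K) + inner_vol (V - K)"
      unfolding outer_vol_def using o K by (intro add_left_mono INF_lower) auto
    also have "\<dots> = (SUP L\<in>{L. compactin X L \<and> L \<subseteq> V - K}. ennreal (v K) + ennreal (v L))"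
      unfolding inner_vol_def by (intro ennreal_SUP_add_right) (auto intro: exI[of _ "{}"])
    also have "\<dots> \<le> inner_vol V"
    proof (rule SUP_least)
      fix L assume L: "L \<in> {L. compactin X L \<and> L \<subseteq> V - K}"
      then have "ennreal (v K) + ennreal (v L) = ennreal (v (K \<union> L))"
        using K v_disjoint[of K L] v_nonneg by (subst v_disjoint) auto
      also have "\<dots> \<le> inner_vol V" using K L by (intro inner_vol_upper compactin_Un) auto
      finally show "ennreal (v K) + ennreal (v L) \<le> inner_vol V" .
    qed
    finally show ?thesis .
  qed
  have "outer_vol (V \<inter> U) + outer_vol (V - U) = inner_vol (V \<inter> U) + outer_vol (V - U)"
    using U V by (simp add: outer_vol_open openin_Int)
  also have "\<dots> = (SUP K\<in>{K. compactin X K \<and> K \<subseteq> V \<inter> U}. ennreal (v K) + outer_vol (V - U))"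
    unfolding inner_vol_def by (intro ennreal_SUP_add_left[symmetric]) (auto intro: exI[of _ "{}"])
  also have "\<dots> \<le> inner_vol V" using 1 by (intro SUP_least) auto
  finally show ?thesis .
qed

text \<open>Caratheodory's condition for an arbitrary test set reduces to open test sets, since the
  outer measure is an infimum over open supersets; for those it is
  \<open>inner_vol_split\<close>.\<close>

lemma open_in_lambda_system:
  assumes U: "openin X U"
  shows "U \<in> lambda_system (topspace X) (Pow (topspace X)) outer_vol"
  unfolding lambda_system_def
proof (intro CollectI conjI ballI antisym)
  show "U \<in> Pow (topspace X)" using openin_subset[OF U] by simp
  fix E assume E: "E \<in> Pow (topspace X)"
  interpret sigma_algebra "topspace X" "Pow (topspace X)" by (rule sigma_algebra_Pow)
  have "subadditive (Pow (topspace X)) outer_vol"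
    using outer_measure_space_outer countably_subadditive_subadditive
    unfolding outer_measure_space_def by blast
  moreover have "(U \<inter> E) \<union> ((topspace X - U) \<inter> E) = E" using E by auto
  ultimately show "outer_vol E \<le> outer_vol (U \<inter> E) + outer_vol ((topspace X - U) \<inter> E)"
    using subadditiveD[of "Pow (topspace X)" outer_vol "U \<inter> E" "(topspace X - U) \<inter> E"] E openin_subset[OF U] by auto
  show "outer_vol (U \<inter> E) + outer_vol ((topspace X - U) \<inter> E) \<le> outer_vol E"
    unfolding outer_vol_def[of E]
  proof (rule INF_greatest)
    fix V assume V: "V \<in> {U. openin X U \<and> E \<subseteq> U}"
    have "outer_vol (U \<inter> E) + outer_vol ((topspace X - U) \<inter> E) \<le> outer_vol (V \<inter> U) + outer_vol (V - U)"
      using V by (intro add_mono outer_vol_mono) auto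
    also have "\<dots> \<le> inner_vol V" using U V by (intro inner_vol_split) auto
    finally show "outer_vol (U \<inter> E) + outer_vol ((topspace X - U) \<inter> E) \<le> inner_vol V" .
  qed
qed

text \<open>Values on open sets are all that is recorded: outer regularity, part of the
  construction, determines the measure from them.\<close>

lemma radon_measure_exists:
  obtains \<mu> where "radon_measure X \<mu>" "\<And>U. openin X U \<Longrightarrow> emeasure \<mu> U = inner_vol U"
proof -
  let ?O = "{U. openin X U}"
  define \<mu> where "\<mu> = measure_of (topspace X) ?O outer_vol"
  have sub: "?O \<subseteq> Pow (topspace X)" using openin_subset by blast
  interpret sigma_algebra "topspace X" "Pow (topspace X)" by (rule sigma_algebra_Pow)
  have ms: "measure_space (topspace X) (lambda_system (topspace X) (Pow (topspace X)) outer_vol) outer_vol"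
    by (rule caratheodory_lemma[OF outer_measure_space_outer])
  have sets_sub: "sigma_sets (topspace X) ?O \<subseteq> lambda_system (topspace X) (Pow (topspace X)) outer_vol"
    using ms open_in_lambda_system unfolding measure_space_def
    by (intro sigma_algebra.sigma_sets_subset) auto
  have sets: "sets \<mu> = sigma_sets (topspace X) ?O" unfolding \<mu>_def using sub by (rule sets_measure_of)
  have em: "emeasure \<mu> E = outer_vol E" if "E \<in> sets \<mu>" for E
  proof (rule emeasure_measure_of[OF \<mu>_def sub])
    show "positive (sets \<mu>) outer_vol" using ms by (auto simp: measure_space_def positive_def)
    show "countably_additive (sets \<mu>) outer_vol"
      using ms sets_sub unfolding sets measure_space_def countably_additive_def by blast
  qed (rule that)
  have os: "U \<in> sets \<mu>" if "openin X U" for U using that by (auto simp: sets)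
  have emo: "emeasure \<mu> U = inner_vol U" if "openin X U" for U using em os outer_vol_open that by simp
  have cs: "K \<in> sets \<mu>" if "compactin X K" for K
  proof -
    have "topspace X - (topspace X - K) \<in> sets \<mu>"
      using os[OF openin_diff[OF openin_topspace compactin_imp_closedin[OF hausdorff that]]]
      unfolding sets by (rule sigma_sets.Compl)
    then show ?thesis using compactin_subset_topspace[OF that] by (simp add: double_diff)
  qed
  have "radon_measure X \<mu>"
    unfolding radon_measure_def
  proof (intro conjI allI impI ballI)
    show "space \<mu> = topspace X" unfolding \<mu>_def using sub by (rule space_measure_of)
    show "sets \<mu> = sigma_sets (topspace X) ?O" by (rule sets)
    show "emeasure \<mu> K < \<infinity>" if "compactin X K" for K using that cs em outer_vol_compact_finite by simp
    show "emeasure \<mu> E = (INF U\<in>{U. openin X U \<and> E \<subseteq> U}. emeasure \<mu> U)" if "E \<in> sets \<mu>" for E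
      using em[OF that] emo by (simp add: outer_vol_def)
    show "emeasure \<mu> U = (SUP K\<in>{K. compactin X K \<and> K \<subseteq> U}. emeasure \<mu> K)" if U: "openin X U" for U
    proof (rule antisym)
      have "ennreal (v K) \<le> emeasure \<mu> K" if "compactin X K" for K
        using outer_vol_compact_ge[OF that] em[OF cs[OF that]] by simp
      then show "emeasure \<mu> U \<le> (SUP K\<in>{K. compactin X K \<and> K \<subseteq> U}. emeasure \<mu> K)"
        unfolding emo[OF U] inner_vol_def by (intro SUP_mono) blast
      show "(SUP K\<in>{K. compactin X K \<and> K \<subseteq> U}. emeasure \<mu> K) \<le> emeasure \<mu> U"
        using os[OF U] by (intro SUP_least emeasure_mono) auto
    qed
  qed
  then show thesis using that emo by blast
qed

end

section \<open>Existence of Haar measure\<close>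

context locally_compact_group
begin

text \<open>Haar's index (K : U). The \<open>LEAST\<close> is meaningful once some finite cover
  exists, as it does for compact \<open>K\<close> and an open neighbourhood \<open>U\<close> of the
  identity.\<close>

definition covering_number :: "'a set \<Rightarrow> 'a set \<Rightarrow> nat" where
  "covering_number K U = (LEAST n. \<exists>S. finite S \<and> S \<subseteq> carrier G \<and> card S = n \<and> K \<subseteq> (\<Union>s\<in>S. s <# U))"

lemma covering_number_le:
  assumes "finite S" "S \<subseteq> carrier G" "K \<subseteq> (\<Union>s\<in>S. s <# U)"
  shows "covering_number K U \<le> card S"
  unfolding covering_number_def using assms by (intro Least_le) auto

lemma subset_carrier: "compactin T K \<Longrightarrow> K \<subseteq> carrier G"
  using compactin_subset_topspace topspace_eq_carrier by metis

lemma covering_witness: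
  assumes K: "compactin T K" and U: "openin T U" "\<one> \<in> U"
  obtains S where "finite S" "S \<subseteq> carrier G" "card S = covering_number K U" "K \<subseteq> (\<Union>s\<in>S. s <# U)"
proof -
  have Kc: "K \<subseteq> carrier G" by (rule subset_carrier[OF K])
  have "openin T (s <# U)" "s \<in> s <# U" if "s \<in> K" for s
  proof -
    show "openin T (s <# U)" using that Kc U by (intro openin_left) auto
    have "s \<otimes> \<one> \<in> s <# U" unfolding l_coset_image using U by blast
    then show "s \<in> s <# U" using that Kc by auto
  qed
  then obtain D where "finite D" "D \<subseteq> K" "K \<subseteq> (\<Union>s\<in>D. s <# U)"
    using compactin_pointwise_cover[OF K, of "\<lambda>s. s <# U"] by blast
  then have "\<exists>n. \<exists>S. finite S \<and> S \<subseteq> carrier G \<and> card S = n \<and> K \<subseteq> (\<Union>s\<in>S. s <# U)"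
    using Kc by blast
  from LeastI_ex[OF this] show thesis
    using that unfolding covering_number_def by blast
qed

lemma covering_number_mono:
  assumes "compactin T L" "openin T U" "\<one> \<in> U" "K \<subseteq> L"
  shows "covering_number K U \<le> covering_number L U"
proof -
  obtain S where "finite S" "S \<subseteq> carrier G" "card S = covering_number L U" "L \<subseteq> (\<Union>s\<in>S. s <# U)"
    by (rule covering_witness[OF assms(1-3)])
  then show ?thesis using covering_number_le[of S K U] assms(4) by auto
qed

lemma covering_number_Un:
  assumes K: "compactin T K" and L: "compactin T L" and U: "openin T U" "\<one> \<in> U"
  shows "covering_number (K \<union> L) U \<le> covering_number K U + covering_number L U"
proof -
  obtain S where S: "finite S" "S \<subseteq> carrier G" "card S = covering_number K U" "K \<subseteq> (\<Union>s\<in>S. s <# U)"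
    by (rule covering_witness[OF K U])
  obtain R where R: "finite R" "R \<subseteq> carrier G" "card R = covering_number L U" "L \<subseteq> (\<Union>s\<in>R. s <# U)"
    by (rule covering_witness[OF L U])
  have "covering_number (K \<union> L) U \<le> card (S \<union> R)"
    using S R by (intro covering_number_le) auto
  also have "\<dots> \<le> card S + card R" by (rule card_Un_le)
  finally show ?thesis using S R by simp
qed

text \<open>No translate of \<open>U\<close> meets both sets, so an optimal cover of the union
  contains disjoint subfamilies covering each.\<close>

lemma covering_number_disjoint:
  assumes K: "compactin T K" and L: "compactin T L" and U: "openin T U" "\<one> \<in> U"
    and sep: "\<And>s. s \<in> carrier G \<Longrightarrow> (s <# U) \<inter> K = {} \<or> (s <# U) \<inter> L = {}"
  shows "covering_number (K \<union> L) U = covering_number K U + covering_number L U"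
proof (rule antisym[OF covering_number_Un[OF K L U]])
  obtain S where S: "finite S" "S \<subseteq> carrier G" "card S = covering_number (K \<union> L) U" "K \<union> L \<subseteq> (\<Union>s\<in>S. s <# U)"
    by (rule covering_witness[OF compactin_Un[OF K L] U])
  define A where "A = {s\<in>S. (s <# U) \<inter> K \<noteq> {}}"
  define B where "B = {s\<in>S. (s <# U) \<inter> L \<noteq> {}}"
  have AB: "finite A" "finite B" "A \<inter> B = {}" "A \<union> B \<subseteq> S" using S sep by (auto simp: A_def B_def)
  have "K \<subseteq> (\<Union>s\<in>A. s <# U)"
  proof
    fix x assume x: "x \<in> K"
    then obtain s where "s \<in> S" "x \<in> s <# U" using S(4) by blast
    then show "x \<in> (\<Union>s\<in>A. s <# U)" using x unfolding A_def by blast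
  qed
  then have "covering_number K U \<le> card A" using AB S by (intro covering_number_le) auto
  moreover have "L \<subseteq> (\<Union>s\<in>B. s <# U)"
  proof
    fix x assume x: "x \<in> L"
    then obtain s where "s \<in> S" "x \<in> s <# U" using S(4) by blast
    then show "x \<in> (\<Union>s\<in>B. s <# U)" using x unfolding B_def by blast
  qed
  then have "covering_number L U \<le> card B" using AB S by (intro covering_number_le) auto
  moreover have "card A + card B \<le> card S"
    using AB S(1) by (metis card_Un_disjoint card_mono)
  ultimately show "covering_number K U + covering_number L U \<le> covering_number (K \<union> L) U" using S by simp
qed

text \<open>Cover \<open>K\<close> by translates of \<open>V\<close>, and inside each of them cover
  the larger translate of \<open>A\<close> by translates of \<open>U\<close>. Divided by (A : U),
  this is a bound on (K : U) / (A : U) independent of \<open>U\<close>.\<close>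

lemma covering_number_trans:
  assumes K: "compactin T K" and A: "compactin T A" and U: "openin T U" "\<one> \<in> U"
    and V: "openin T V" "\<one> \<in> V" "V \<subseteq> A"
  shows "covering_number K U \<le> covering_number K V * covering_number A U"
proof -
  obtain S where S: "finite S" "S \<subseteq> carrier G" "card S = covering_number K V" "K \<subseteq> (\<Union>s\<in>S. s <# V)"
    by (rule covering_witness[OF K V(1,2)])
  obtain R where R: "finite R" "R \<subseteq> carrier G" "card R = covering_number A U" "A \<subseteq> (\<Union>s\<in>R. s <# U)"
    by (rule covering_witness[OF A U])
  have Uc: "U \<subseteq> carrier G" using openin_subset[OF U(1)] by (simp add: topspace_eq_carrier)
  let ?P = "(\<lambda>(s, r). s \<otimes> r) ` (S \<times> R)"
  have "K \<subseteq> (\<Union>p\<in>?P. p <# U)"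
  proof
    fix x assume "x \<in> K"
    then obtain s v where s: "s \<in> S" "v \<in> V" "x = s \<otimes> v" using S(4) by (auto simp: l_coset_image)
    then obtain r u where r: "r \<in> R" "u \<in> U" "v = r \<otimes> u" using R(4) V(3) by (force simp: l_coset_image)
    have "x = (s \<otimes> r) \<otimes> u" using s r S R Uc by (simp add: m_assoc subset_iff)
    then show "x \<in> (\<Union>p\<in>?P. p <# U)" using s r by (auto simp: l_coset_image)
  qed
  then have "covering_number K U \<le> card ?P" using S R by (intro covering_number_le) auto
  also have "\<dots> \<le> card (S \<times> R)" using S R by (intro card_image_le) auto
  finally show ?thesis using S R by (simp add: card_cartesian_product)
qed

lemma covering_number_left_le:
  assumes K: "compactin T K" and U: "openin T U" "\<one> \<in> U" and g: "g \<in> carrier G"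
  shows "covering_number (g <# K) U \<le> covering_number K U"
proof -
  obtain S where S: "finite S" "S \<subseteq> carrier G" "card S = covering_number K U" "K \<subseteq> (\<Union>s\<in>S. s <# U)"
    by (rule covering_witness[OF K U])
  have Uc: "U \<subseteq> carrier G" using openin_subset[OF U(1)] by (simp add: topspace_eq_carrier)
  let ?P = "(\<lambda>s. g \<otimes> s) ` S"
  have "g <# K \<subseteq> (\<Union>p\<in>?P. p <# U)"
  proof
    fix x assume "x \<in> g <# K"
    then obtain k where k: "k \<in> K" "x = g \<otimes> k" by (auto simp: l_coset_image)
    then obtain s u where s: "s \<in> S" "u \<in> U" "k = s \<otimes> u" using S(4) by (force simp: l_coset_image)
    have "x = (g \<otimes> s) \<otimes> u" using s k S Uc g by (simp add: m_assoc subset_iff)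
    then show "x \<in> (\<Union>p\<in>?P. p <# U)" using s by (auto simp: l_coset_image)
  qed
  then have "covering_number (g <# K) U \<le> card ?P" using S g by (intro covering_number_le) auto
  also have "\<dots> \<le> card S" using S by (intro card_image_le) auto
  finally show ?thesis using S by simp
qed

lemma l_coset_inv_cancel: "K \<subseteq> carrier G \<Longrightarrow> g \<in> carrier G \<Longrightarrow> inv g <# (g <# K) = K"
  by (simp add: lcos_m_assoc lcos_mult_one)

lemma r_coset_inv_cancel: "K \<subseteq> carrier G \<Longrightarrow> g \<in> carrier G \<Longrightarrow> (K #> g) #> inv g = K"
  by (simp add: coset_mult_assoc)

lemma covering_number_left:
  assumes K: "compactin T K" and U: "openin T U" "\<one> \<in> U" and g: "g \<in> carrier G"
  shows "covering_number (g <# K) U = covering_number K U"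
proof (rule antisym[OF covering_number_left_le[OF assms]])
  show "covering_number K U \<le> covering_number (g <# K) U"
    using covering_number_left_le[OF compactin_left[OF K g] U, of "inv g"] g
    by (simp add: l_coset_inv_cancel subset_carrier[OF K])
qed

text \<open>If \<open>s \<otimes> u\<close> were in \<open>K\<close> and
  \<open>s \<otimes> v\<close> in \<open>L\<close>, then \<open>inv u \<otimes> v\<close> would
  carry a point of \<open>K\<close> into \<open>L\<close>. The tube lemma gives a neighbourhood
  \<open>N\<close> of the identity with \<open>K\<close> times \<open>N\<close> disjoint from
  \<open>L\<close>, and quotients of elements of \<open>V\<close> lie in \<open>N\<close>.\<close>

lemma separating_neighbourhood:
  assumes K: "compactin T K" and L: "compactin T L" and KL: "K \<inter> L = {}"
  obtains V where "openin T V" "\<one> \<in> V"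
    "\<And>U s. U \<subseteq> V \<Longrightarrow> s \<in> carrier G \<Longrightarrow> (s <# U) \<inter> K = {} \<or> (s <# U) \<inter> L = {}"
proof -
  have Kc: "K \<subseteq> carrier G" by (rule subset_carrier[OF K])
  have "openin T (topspace T - L)" using L Hausdorff compactin_imp_closedin by blast
  then have o: "openin (prod_topology T T) {p \<in> topspace (prod_topology T T). (\<lambda>(x,y). x \<otimes> y) p \<in> topspace T - L}"
    using continuous_mult by (intro openin_continuous_map_preimage)
  have "a \<otimes> \<one> = a" if "a \<in> K" for a using that Kc by auto
  then have i: "K \<times> {\<one>} \<subseteq> {p \<in> topspace (prod_topology T T). (\<lambda>(x,y). x \<otimes> y) p \<in> topspace T - L}"
    using Kc KL by (auto simp: topspace_eq_carrier)
  have "\<one> \<in> topspace T" by (simp add: topspace_eq_carrier)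
  from tube_lemma_left[OF o K this i] obtain A N where N: "openin T N" "K \<subseteq> A" "\<one> \<in> N"
    "A \<times> N \<subseteq> {p \<in> topspace (prod_topology T T). (\<lambda>(x,y). x \<otimes> y) p \<in> topspace T - L}"
    by blast
  obtain V where V: "openin T V" "\<one> \<in> V" "\<And>x. x \<in> V \<Longrightarrow> inv x \<in> V" "\<And>x y. x \<in> V \<Longrightarrow> y \<in> V \<Longrightarrow> x \<otimes> y \<in> N"
    using nhd_mult_inv[OF N(1,3)] by metis
  have Vc: "V \<subseteq> carrier G" using openin_subset[OF V(1)] by (simp add: topspace_eq_carrier)
  show thesis
  proof (rule that[OF V(1,2)])
    fix U s assume U: "U \<subseteq> V" and s: "s \<in> carrier G"
    show "(s <# U) \<inter> K = {} \<or> (s <# U) \<inter> L = {}"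
    proof (rule ccontr)
      assume "\<not> ((s <# U) \<inter> K = {} \<or> (s <# U) \<inter> L = {})"
      then obtain u v where u: "u \<in> U" "s \<otimes> u \<in> K" and v: "v \<in> U" "s \<otimes> v \<in> L"
        by (auto simp: l_coset_image)
      have uv: "u \<in> carrier G" "v \<in> carrier G" using U Vc u v by auto
      have "inv u \<otimes> v \<in> N" using V(3,4) subsetD[OF U u(1)] subsetD[OF U v(1)] by simp
      then have "(s \<otimes> u, inv u \<otimes> v) \<in> A \<times> N" using N u by blast
      from subsetD[OF N(4) this] have "(s \<otimes> u) \<otimes> (inv u \<otimes> v) \<notin> L" by simp
      moreover have "(s \<otimes> u) \<otimes> (inv u \<otimes> v) = s \<otimes> (u \<otimes> (inv u \<otimes> v))" using uv s by (simp add: m_assoc)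
      moreover have "u \<otimes> (inv u \<otimes> v) = v" using uv by (simp add: m_assoc[symmetric])
      ultimately show False using v by simp
    qed
  qed
qed

text \<open>The normalised covering numbers \<open>covering_number K U / covering_number A U\<close> lie in a product
  of compact intervals; \<open>v\<close> is a cluster point of them as \<open>U\<close> shrinks to the identity.\<close>

lemma invariant_content_exists:
  obtains v A where "compact_content T v" "\<And>g K. g \<in> carrier G \<Longrightarrow> compactin T K \<Longrightarrow> v (g <# K) = v K"
    "compactin T A" "v A = 1"
proof -
  obtain V0 A where A: "openin T V0" "compactin T A" "\<one> \<in> V0" "V0 \<subseteq> A"
    using locally_compact unfolding locally_compact_space_def topspace_eq_carrier by blast
  let ?N = "{U. openin T U \<and> \<one> \<in> U}"
  \<comment> \<open>The value 0 at noncompact sets only makes \<open>r U\<close> total, so that it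
    is a point of a product indexed by all subsets.\<close>
  define r where "r U K = (if compactin T K then real (covering_number K U) / real (covering_number A U) else 0)" for U K
  \<comment> \<open>The filter of identity neighbourhoods shrinking to the identity: a property
    holds eventually when it holds for all neighbourhoods contained in some fixed one.\<close>
  define F where "F = (INF U\<in>?N. principal {W\<in>?N. W \<subseteq> U})"
  have N_ne: "carrier G \<in> ?N" using openin_topspace[of T] unfolding topspace_eq_carrier by simp
  have evF: "eventually P F \<longleftrightarrow> (\<exists>U\<in>?N. \<forall>W\<in>?N. W \<subseteq> U \<longrightarrow> P W)" for P
  proof -
    have "eventually P F \<longleftrightarrow> (\<exists>U\<in>?N. eventually P (principal {W\<in>?N. W \<subseteq> U}))"
      unfolding F_def
    proof (rule eventually_INF_base)
      show "?N \<noteq> {}" using N_ne by blast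
      fix a b assume "a \<in> ?N" "b \<in> ?N"
      then show "\<exists>x\<in>?N. principal {W\<in>?N. W \<subseteq> x} \<le> inf (principal {W\<in>?N. W \<subseteq> a}) (principal {W\<in>?N. W \<subseteq> b})"
        by (intro bexI[of _ "a \<inter> b"]) auto
    qed
    then show ?thesis by (auto simp: eventually_principal)
  qed
  have F_ne: "F \<noteq> bot"
    unfolding trivial_limit_def evF using N_ne by blast
  have posA: "covering_number A U > 0" if U: "U \<in> ?N" for U
  proof (rule ccontr)
    assume "\<not> 0 < covering_number A U"
    then obtain S where "finite S" "card S = 0" "A \<subseteq> (\<Union>s\<in>S. s <# U)"
      using covering_witness[OF A(2), of U] U by auto
    then show False using A by auto
  qed
  \<comment> \<open>The bounds are \<open>covering_number_trans\<close> for the fixed neighbourhood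
    \<open>V0\<close> inside \<open>A\<close>; Tychonoff makes the box compact.\<close>
  define B where "B = PiE UNIV (\<lambda>K. {0..real (covering_number K V0)})"
  have rB: "r U \<in> B" if U: "U \<in> ?N" for U
    unfolding B_def
  proof (rule PiE_I)
    fix K
    have "real (covering_number K U) \<le> real (covering_number K V0) * real (covering_number A U)" if "compactin T K"
      using covering_number_trans[OF that A(2), of U V0] U A by (simp flip: of_nat_mult)
    then show "r U K \<in> {0..real (covering_number K V0)}"
      using posA[OF U] by (auto simp: r_def divide_le_eq)
  qed auto
  have "compactin (product_topology (\<lambda>i. euclideanreal) UNIV) B"
    unfolding B_def compactin_PiE by auto
  then have "compact B" by (simp add: euclidean_product_topology)
  moreover have "filtermap r F \<noteq> bot" using F_ne by (simp add: filtermap_bot_iff)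
  moreover have "eventually (\<lambda>x. x \<in> B) (filtermap r F)"
    unfolding eventually_filtermap evF using N_ne rB by blast
  ultimately obtain v where v: "inf (nhds v) (filtermap r F) \<noteq> bot"
    unfolding compact_filter by blast
  \<comment> \<open>Refining \<open>F\<close> by the preimages of neighbourhoods of \<open>v\<close>
    turns the cluster point into an honest limit, so that (in)equalities can be passed to the limit
    coordinate by coordinate.\<close>
  define H where "H = inf F (filtercomap r (nhds v))"
  have H_ne: "H \<noteq> bot"
  proof
    assume "H = bot"
    then have "eventually (\<lambda>_. False) H" by simp
    then obtain P Q where PQ: "eventually P F" "eventually Q (filtercomap r (nhds v))" "\<And>x. \<not> (P x \<and> Q x)"
      unfolding H_def eventually_inf by blast
    obtain R where R: "eventually R (nhds v)" "\<And>x. R (r x) \<Longrightarrow> Q x" using PQ(2) unfolding eventually_filtercomap by blast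
    have "eventually (\<lambda>y. \<not> R y) (filtermap r F)"
      unfolding eventually_filtermap using PQ(1) by (rule eventually_mono) (use PQ R in blast)
    then have "eventually (\<lambda>_. False) (inf (nhds v) (filtermap r F))"
      using R(1) unfolding eventually_inf by blast
    then show False using v by (simp add: trivial_limit_def)
  qed
  have lim: "((\<lambda>U. r U K) \<longlongrightarrow> v K) H" for K
  proof -
    have f: "filterlim r (nhds v) H" unfolding H_def by (rule filterlim_mono[OF filterlim_filtercomap order_refl]) simp
    show ?thesis
    proof (rule topological_tendstoI)
      fix S :: "real set" assume S: "open S" "v K \<in> S"
      have "open ((\<lambda>f. f K) -` S)" using S(1) by (intro open_vimage continuous_on_product_coordinates)
      then have "eventually (\<lambda>f. f K \<in> S) (nhds v)"
        using S(2) by (auto simp: eventually_nhds)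
      then show "eventually (\<lambda>U. r U K \<in> S) H" using f by (rule eventually_compose_filterlim)
    qed
  qed
  have evH: "eventually P H" if "U \<in> ?N" "\<And>W. W \<in> ?N \<Longrightarrow> W \<subseteq> U \<Longrightarrow> P W" for P U
  proof -
    have "eventually P F" unfolding evF using that by blast
    then show ?thesis unfolding H_def by (rule filter_leD[OF inf_le1])
  qed
  have evN: "eventually (\<lambda>U. U \<in> ?N) H" by (rule evH[OF N_ne])
  have lim_le: "x \<le> y" if "(f \<longlongrightarrow> x) H" "(g \<longlongrightarrow> y) H" "\<And>U. U \<in> ?N \<Longrightarrow> f U \<le> g U"
    for f g :: "'a set \<Rightarrow> real" and x y
  proof -
    have "eventually (\<lambda>U. f U \<le> g U) H" using evN by (rule eventually_mono) (rule that(3))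
    then show ?thesis by (rule tendsto_le[OF H_ne that(2,1)])
  qed
  \<comment> \<open>Agreement is required only below some neighbourhood \<open>U\<close>, because
    additivity on disjoint sets holds only for small neighbourhoods.\<close>
  have lim_eq: "x = y" if "(f \<longlongrightarrow> x) H" "(g \<longlongrightarrow> y) H" "\<And>W. W \<in> ?N \<Longrightarrow> W \<subseteq> U \<Longrightarrow> f W = g W" "U \<in> ?N"
    for f g :: "'a set \<Rightarrow> real" and x y U
  proof -
    have "eventually (\<lambda>W. f W = g W) H" by (rule evH[OF that(4,3)])
    then have "(g \<longlongrightarrow> x) H" using that(1) by (rule Lim_transform_eventually[rotated])
    then show ?thesis using that(2) H_ne tendsto_unique by blast
  qed
  show thesis
  proof (rule that[of v A])
    show "compact_content T v"
    proof
      show "locally_compact_space T" "Hausdorff_space T" by (rule locally_compact Hausdorff)+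
      fix K assume K: "compactin T K"
      show "0 \<le> v K" using lim_le[OF tendsto_const lim[of K], of 0] by (simp add: r_def)
      fix L assume L: "compactin T L"
      show "v K \<le> v L" if "K \<subseteq> L"
      proof (rule lim_le[OF lim lim])
        fix U assume "U \<in> ?N"
        then show "r U K \<le> r U L"
          using K L that covering_number_mono[OF L, of U K] by (simp add: r_def divide_right_mono)
      qed
      show "v (K \<union> L) \<le> v K + v L"
      proof (rule lim_le[OF lim tendsto_add[OF lim lim]])
        fix U assume "U \<in> ?N"
        then have "real (covering_number (K \<union> L) U) \<le> real (covering_number K U) + real (covering_number L U)"
          using covering_number_Un[OF K L, of U] by (simp flip: of_nat_add)
        then show "r U (K \<union> L) \<le> r U K + r U L"
          using K L by (simp add: r_def compactin_Un add_divide_distrib[symmetric] divide_right_mono)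
      qed
      show "v (K \<union> L) = v K + v L" if KL: "K \<inter> L = {}"
      proof -
        obtain V where V: "openin T V" "\<one> \<in> V"
          "\<And>U s. U \<subseteq> V \<Longrightarrow> s \<in> carrier G \<Longrightarrow> (s <# U) \<inter> K = {} \<or> (s <# U) \<inter> L = {}"
          using separating_neighbourhood[OF K L KL] by blast
        show ?thesis
        proof (rule lim_eq[OF lim tendsto_add[OF lim lim], of V])
          fix U assume U: "U \<in> ?N" "U \<subseteq> V"
          then have "covering_number (K \<union> L) U = covering_number K U + covering_number L U"
            using V(3)[OF U(2)] by (intro covering_number_disjoint[OF K L]) auto
          then show "r U (K \<union> L) = r U K + r U L"
            using K L by (simp add: r_def compactin_Un add_divide_distrib)
        qed (use V in auto)
      qed
    qed
    show "v (g <# K) = v K" if g: "g \<in> carrier G" and K: "compactin T K" for g K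
    proof (rule lim_eq[OF lim lim _ N_ne])
      fix U assume "U \<in> ?N"
      then show "r U (g <# K) = r U K"
        using covering_number_left[OF K, of U g] compactin_left[OF K g] g K by (simp add: r_def)
    qed
    show "compactin T A" by (rule A)
    show "v A = 1"
    proof (rule lim_eq[OF lim tendsto_const _ N_ne])
      fix U assume "U \<in> ?N"
      then show "r U A = 1" using posA[of U] A by (simp add: r_def)
    qed
  qed
qed

text \<open>Invariance of the content gives one inequality on open sets; outer regularity extends it
  to Borel sets, and applying it to the inverse translation gives equality.\<close>

lemma haar_measure_exists: "\<exists>\<mu>. left_haar_measure G T \<mu>"
proof -
  obtain v A where "compact_content T v" and inv: "\<And>g K. g \<in> carrier G \<Longrightarrow> compactin T K \<Longrightarrow> v (g <# K) = v K"
    and A: "compactin T A" "v A = 1"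
    by (rule invariant_content_exists, rule that)
  interpret compact_content T v by fact
  obtain \<mu> where \<mu>: "radon_measure T \<mu>" "\<And>U. openin T U \<Longrightarrow> emeasure \<mu> U = inner_vol U"
    using radon_measure_exists by blast
  have Ec: "E \<subseteq> carrier G" if "E \<in> sets \<mu>" for E
    using sets.sets_into_space[OF that] radon_measureD(1)[OF \<mu>(1)] by (simp add: topspace_eq_carrier)
  note open_sets = radon_measureD(6)[OF \<mu>(1)]
  have le_open: "emeasure \<mu> (s <# U) \<le> emeasure \<mu> U" if U: "openin T U" and s: "s \<in> carrier G" for s U
  proof -
    have Uc: "U \<subseteq> carrier G" using openin_subset[OF U] by (simp add: topspace_eq_carrier)
    have "inner_vol (s <# U) \<le> inner_vol U"
      unfolding inner_vol_def[of "s <# U"]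
    proof (rule SUP_least)
      fix K assume K: "K \<in> {K. compactin T K \<and> K \<subseteq> s <# U}"
      then have "inv s <# K \<subseteq> inv s <# (s <# U)" unfolding l_coset_image by blast
      then have "inv s <# K \<subseteq> U" using l_coset_inv_cancel[OF Uc s] by simp
      moreover have "compactin T (inv s <# K)" using K s by (intro compactin_left) auto
      ultimately have "ennreal (v (inv s <# K)) \<le> inner_vol U" by (intro inner_vol_upper)
      then show "ennreal (v K) \<le> inner_vol U" using inv[of "inv s" K] K s by simp
    qed
    then show ?thesis using \<mu>(2) U s openin_left by simp
  qed
  have meas: "s <# E \<in> sets \<mu>" if E: "E \<in> sets \<mu>" and s: "s \<in> carrier G" for s E
  proof -
    have "continuous_map T T (\<lambda>x. inv s \<otimes> x)"
      using homeomorphic_left[OF s] by (simp add: homeomorphic_maps_def)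
    from measurable_sets[OF continuous_map_measurable[OF \<mu>(1) this] E]
    show ?thesis
      using vimage_left[OF Ec[OF E], of "inv s"] s radon_measureD(1)[OF \<mu>(1)] by (simp add: topspace_eq_carrier)
  qed
  have le: "emeasure \<mu> (s <# E) \<le> emeasure \<mu> E" if E: "E \<in> sets \<mu>" and s: "s \<in> carrier G" for s E
  proof -
    have "emeasure \<mu> (s <# E) \<le> emeasure \<mu> U" if U: "openin T U" "E \<subseteq> U" for U
    proof -
      have "s <# E \<subseteq> s <# U" using U unfolding l_coset_image by blast
      then have "emeasure \<mu> (s <# E) \<le> emeasure \<mu> (s <# U)"
        using open_sets openin_left U s by (intro emeasure_mono) auto
      also have "\<dots> \<le> emeasure \<mu> U" by (rule le_open[OF U(1) s])
      finally show ?thesis .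
    qed
    then show ?thesis unfolding radon_measureD(4)[OF \<mu>(1) E] by (auto intro: INF_greatest)
  qed
  have "left_haar_measure G T \<mu>"
    unfolding left_haar_measure_def
  proof (intro conjI ballI)
    show "radon_measure T \<mu>" by fact
    have "ennreal (v A) \<le> emeasure \<mu> (space \<mu>)"
      using \<mu>(2)[OF openin_topspace] radon_measureD(1)[OF \<mu>(1)] inner_vol_upper[OF A(1) compactin_subset_topspace[OF A(1)]] by simp
    then show "emeasure \<mu> (space \<mu>) \<noteq> 0" using A by auto
    fix s E assume s: "s \<in> carrier G" and E: "E \<in> sets \<mu>"
    show "emeasure \<mu> (s <# E) = emeasure \<mu> E"
    proof (rule antisym[OF le[OF E s]])
      show "emeasure \<mu> E \<le> emeasure \<mu> (s <# E)"
        using le[OF meas[OF E s], of "inv s"] l_coset_inv_cancel[OF Ec[OF E] s] s by simp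
    qed
  qed
  then show ?thesis by blast
qed

end

section \<open>The modular function\<close>

lemma cc_measurable:
  assumes \<mu>: "radon_measure X \<mu>" and f: "f \<in> cc X"
  shows "f \<in> borel_measurable \<mu>"
proof (rule borel_measurableI)
  fix S :: "real set" assume "open S"
  then have "openin X {x \<in> topspace X. f x \<in> S}"
    using openin_continuous_map_preimage[OF cc_continuous[OF f], of S] by simp
  moreover have "f -` S \<inter> space \<mu> = {x \<in> topspace X. f x \<in> S}" using radon_measureD(1)[OF \<mu>] by auto
  ultimately show "f -` S \<inter> space \<mu> \<in> sets \<mu>" using radon_measureD(6)[OF \<mu>] by simp
qed

lemma cc_integrable:
  assumes \<mu>: "radon_measure X \<mu>" and X: "Hausdorff_space X" and f: "f \<in> cc X"
  shows "integrable \<mu> f"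
proof -
  obtain K where K: "compactin X K" "\<And>x. x \<in> topspace X \<Longrightarrow> x \<notin> K \<Longrightarrow> f x = 0"
    using f unfolding cc_def by blast
  obtain B where B: "\<And>x. x \<in> topspace X \<Longrightarrow> \<bar>f x\<bar> \<le> B" using cc_bounded[OF f] by blast
  show ?thesis
    by (rule integrableI_bounded_set[of K, where B = B])
      (use radon_measure_compact_sets[OF \<mu> X K(1)] cc_measurable[OF \<mu> f] radon_measureD(3)[OF \<mu> K(1)]
        B K(2) radon_measureD(1)[OF \<mu>] in \<open>auto intro!: AE_I2\<close>)
qed

lemma positive_functional_integral:
  assumes \<mu>: "radon_measure X \<mu>" and X: "locally_compact_space X" "Hausdorff_space X"
  shows "positive_functional X (integral\<^sup>L \<mu>)"
proof
  fix f g :: "'a \<Rightarrow> real" and c :: real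
  assume f: "f \<in> cc X"
  note i = cc_integrable[OF \<mu> X(2)]
  show "integral\<^sup>L \<mu> (\<lambda>x. c * f x) = c * integral\<^sup>L \<mu> f" by simp
  assume g: "g \<in> cc X"
  show "integral\<^sup>L \<mu> (\<lambda>x. f x + g x) = integral\<^sup>L \<mu> f + integral\<^sup>L \<mu> g"
    using i[OF f] i[OF g] by simp
  show "integral\<^sup>L \<mu> f \<le> integral\<^sup>L \<mu> g" if "\<And>x. x \<in> topspace X \<Longrightarrow> f x \<le> g x"
    using i[OF f] i[OF g] that radon_measureD(1)[OF \<mu>] by (intro integral_mono) auto
qed (use X in auto)

text \<open>With its counterpart \<open>integral_le_emeasure\<close> this is the way back from
  functionals to measures: a bump squeezed between a compact and an open set, followed by
  regularity.\<close>

lemma emeasure_le_integral: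
  assumes \<mu>: "radon_measure X \<mu>" and X: "Hausdorff_space X"
    and f: "f \<in> cc X" "\<And>x. x \<in> topspace X \<Longrightarrow> 0 \<le> f x"
    and K: "compactin X K" "\<And>x. x \<in> K \<Longrightarrow> 1 \<le> f x"
  shows "emeasure \<mu> K \<le> ennreal (integral\<^sup>L \<mu> f)"
proof -
  have "emeasure \<mu> K = (\<integral>\<^sup>+x. indicator K x \<partial>\<mu>)"
    using radon_measure_compact_sets[OF \<mu> X K(1)] by simp
  also have "\<dots> \<le> (\<integral>\<^sup>+x. ennreal (f x) \<partial>\<mu>)"
    using K(2) by (intro nn_integral_mono) (auto simp: indicator_def)
  also have "\<dots> = ennreal (integral\<^sup>L \<mu> f)"
    using cc_integrable[OF \<mu> X f(1)] f(2) radon_measureD(1)[OF \<mu>] by (intro nn_integral_eq_integral) auto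
  finally show ?thesis .
qed

lemma integral_le_emeasure:
  assumes \<mu>: "radon_measure X \<mu>" and X: "Hausdorff_space X"
    and f: "f \<in> cc X" "\<And>x. x \<in> topspace X \<Longrightarrow> 0 \<le> f x" "\<And>x. x \<in> topspace X \<Longrightarrow> f x \<le> 1"
    and U: "openin X U" "\<And>x. x \<in> topspace X \<Longrightarrow> x \<notin> U \<Longrightarrow> f x = 0"
  shows "ennreal (integral\<^sup>L \<mu> f) \<le> emeasure \<mu> U"
proof -
  have "ennreal (integral\<^sup>L \<mu> f) = (\<integral>\<^sup>+x. ennreal (f x) \<partial>\<mu>)"
    using cc_integrable[OF \<mu> X f(1)] f(2) radon_measureD(1)[OF \<mu>] by (intro nn_integral_eq_integral[symmetric]) auto
  also have "\<dots> \<le> (\<integral>\<^sup>+x. indicator U x \<partial>\<mu>)"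
    using f U radon_measureD(1)[OF \<mu>] by (intro nn_integral_mono) (auto simp: indicator_def)
  also have "\<dots> = emeasure \<mu> U" using radon_measureD(6)[OF \<mu> U(1)] by simp
  finally show ?thesis .
qed

context locally_compact_group
begin

lemma haar_positive_compact:
  assumes \<mu>: "left_haar_measure G T \<mu>"
  obtains K where "compactin T K" "0 < emeasure \<mu> K" "emeasure \<mu> K < \<infinity>"
proof -
  have R: "radon_measure T \<mu>" and n: "emeasure \<mu> (space \<mu>) \<noteq> 0" using \<mu> by (auto simp: left_haar_measure_def)
  have "0 < (SUP K\<in>{K. compactin T K \<and> K \<subseteq> topspace T}. emeasure \<mu> K)"
    using n radon_measureD(1)[OF R] radon_measureD(5)[OF R openin_topspace] by (simp add: zero_less_iff_neq_zero)
  then obtain K where "compactin T K" "0 < emeasure \<mu> K" unfolding less_SUP_iff by blast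
  then show thesis using that radon_measureD(3)[OF R] by blast
qed

lemma haar_functional_integral:
  assumes \<mu>: "left_haar_measure G T \<mu>"
  shows "haar_functional G T (integral\<^sup>L \<mu>)"
proof -
  have R: "radon_measure T \<mu>"
    and inv: "\<And>s E. s \<in> carrier G \<Longrightarrow> E \<in> sets \<mu> \<Longrightarrow> emeasure \<mu> (s <# E) = emeasure \<mu> E"
    using \<mu> by (auto simp: left_haar_measure_def)
  note sp = radon_measureD(1)[OF R, unfolded topspace_eq_carrier]
  interpret positive_functional T "integral\<^sup>L \<mu>"
    by (rule positive_functional_integral[OF R locally_compact Hausdorff])
  interpret left_invariant_functional G T "integral\<^sup>L \<mu>"
  proof unfold_locales
    fix s f assume s: "s \<in> carrier G" and f: "f \<in> cc T"
    have m: "(\<lambda>x. s \<otimes> x) \<in> measurable \<mu> \<mu>"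
      using homeomorphic_left[OF s] by (intro continuous_map_measurable[OF R]) (simp add: homeomorphic_maps_def)
    have "distr \<mu> \<mu> (\<lambda>x. s \<otimes> x) = \<mu>"
    proof (rule measure_eqI)
      fix E assume "E \<in> sets (distr \<mu> \<mu> (\<lambda>x. s \<otimes> x))"
      then have E: "E \<in> sets \<mu>" by simp
      have "(\<lambda>x. s \<otimes> x) -` E \<inter> space \<mu> = inv s <# E"
        using vimage_left[OF _ s] sets.sets_into_space[OF E] sp by simp
      then show "emeasure (distr \<mu> \<mu> (\<lambda>x. s \<otimes> x)) E = emeasure \<mu> E"
        using inv[of "inv s" E] s E m by (simp add: emeasure_distr)
    qed simp
    then show "(\<integral>x. f (s \<otimes> x) \<partial>\<mu>) = integral\<^sup>L \<mu> f"
      using integral_distr[OF m cc_measurable[OF R f]] by simp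
  qed
  show ?thesis
  proof unfold_locales
    obtain K where K: "compactin T K" "0 < emeasure \<mu> K" by (rule haar_positive_compact[OF \<mu>])
    obtain f where f: "f \<in> cc T" "\<And>x. x \<in> topspace T \<Longrightarrow> 0 \<le> f x" "\<And>x. x \<in> K \<Longrightarrow> f x = 1"
      using bump1[OF K(1)] by blast
    have "emeasure \<mu> K \<le> ennreal (integral\<^sup>L \<mu> f)"
      using f K by (intro emeasure_le_integral[OF R Hausdorff]) auto
    then have "integral\<^sup>L \<mu> f \<noteq> 0" using K(2) by auto
    then show "\<exists>f\<in>cc T. integral\<^sup>L \<mu> f \<noteq> 0" using f by blast
  qed
qed

lemma haar_functional_exists: "\<exists>I. haar_functional G T I"
  using haar_measure_exists haar_functional_integral by blast

text \<open>The indicator of \<open>E #> s\<close> at \<open>x\<close> is that of \<open>E\<close>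
  at \<open>x \<otimes> inv s\<close>, whence the \<open>inv s\<close> in the hypothesis. Bumps give
  the bound on open sets by inner regularity, and outer regularity extends it. One inequality
  suffices: the other is this one for \<open>inv s\<close> and \<open>1 / c\<close>.\<close>

lemma haar_measure_right_le:
  assumes \<mu>: "left_haar_measure G T \<mu>" and s: "s \<in> carrier G" and c: "c > 0"
    and scale: "\<And>f. f \<in> cc T \<Longrightarrow> (\<integral>x. f (x \<otimes> inv s) \<partial>\<mu>) = c * integral\<^sup>L \<mu> f"
    and E: "E \<in> sets \<mu>"
  shows "emeasure \<mu> (E #> s) \<le> ennreal c * emeasure \<mu> E"
proof -
  have R: "radon_measure T \<mu>" using \<mu> by (simp add: left_haar_measure_def)
  have open_le: "emeasure \<mu> (U #> s) \<le> ennreal c * emeasure \<mu> U" if U: "openin T U" for U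
    unfolding radon_measureD(5)[OF R openin_right[OF U s]]
  proof (rule SUP_least)
    fix K assume K: "K \<in> {K. compactin T K \<and> K \<subseteq> U #> s}"
    have Uc: "U \<subseteq> carrier G" using openin_subset[OF U] by (simp add: topspace_eq_carrier)
    have Kc: "K \<subseteq> carrier G" using K subset_carrier by blast
    have "K #> inv s \<subseteq> (U #> s) #> inv s" using K unfolding r_coset_image by blast
    then have KU: "K #> inv s \<subseteq> U" using r_coset_inv_cancel[OF Uc s] by simp
    have Ks: "compactin T (K #> inv s)" using K s by (intro compactin_right) auto
    obtain f L where f: "f \<in> cc T" "\<And>x. x \<in> topspace T \<Longrightarrow> 0 \<le> f x" "\<And>x. x \<in> topspace T \<Longrightarrow> f x \<le> 1"
        "\<And>x. x \<in> K #> inv s \<Longrightarrow> f x = 1" "compactin T L" "L \<subseteq> U" "\<And>x. x \<in> topspace T \<Longrightarrow> x \<notin> L \<Longrightarrow> f x = 0"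
      by (rule cc_bump[OF locally_compact Hausdorff Ks U KU], rule that)
    have "emeasure \<mu> K \<le> ennreal (\<integral>x. f (x \<otimes> inv s) \<partial>\<mu>)"
    proof (rule emeasure_le_integral[OF R Hausdorff])
      show "(\<lambda>x. f (x \<otimes> inv s)) \<in> cc T" using f s by (intro cc_right) auto
      show "0 \<le> f (x \<otimes> inv s)" if "x \<in> topspace T" for x using f(2) that s by (simp add: topspace_eq_carrier)
      show "compactin T K" using K by simp
      show "1 \<le> f (x \<otimes> inv s)" if "x \<in> K" for x
      proof -
        have "x \<otimes> inv s \<in> K #> inv s" using that unfolding r_coset_image by blast
        then show ?thesis using f(4) by simp
      qed
    qed
    also have "\<dots> = ennreal c * ennreal (integral\<^sup>L \<mu> f)"
      using c by (simp add: scale[OF f(1)] ennreal_mult')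
    also have "\<dots> \<le> ennreal c * emeasure \<mu> U"
      using f(1-3) f(7)[OF _ contra_subsetD[OF f(6)]] by (intro mult_left_mono integral_le_emeasure[OF R Hausdorff] U) auto
    finally show "emeasure \<mu> K \<le> ennreal c * emeasure \<mu> U" .
  qed
  \<comment> \<open>Dividing by \<open>c\<close> leaves \<open>emeasure \<mu> E\<close> alone on the
    right, which outer regularity rewrites as an infimum.\<close>
  have inv_c: "ennreal (1 / c) * ennreal c = 1"
    using c by (simp flip: ennreal_mult)
  have "ennreal (1 / c) * emeasure \<mu> (E #> s) \<le> emeasure \<mu> E"
    unfolding radon_measureD(4)[OF R E]
  proof (rule INF_greatest)
    fix U assume U: "U \<in> {U. openin T U \<and> E \<subseteq> U}"
    have "emeasure \<mu> (E #> s) \<le> emeasure \<mu> (U #> s)"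
      using U openin_right s radon_measureD(6)[OF R] by (intro emeasure_mono) (auto simp: r_coset_image)
    also have "\<dots> \<le> ennreal c * emeasure \<mu> U" using U by (intro open_le) auto
    finally have "ennreal (1 / c) * emeasure \<mu> (E #> s) \<le> ennreal (1 / c) * (ennreal c * emeasure \<mu> U)"
      by (rule mult_left_mono) simp
    then show "ennreal (1 / c) * emeasure \<mu> (E #> s) \<le> emeasure \<mu> U"
      by (simp add: inv_c flip: mult.assoc)
  qed
  then have "ennreal c * (ennreal (1 / c) * emeasure \<mu> (E #> s)) \<le> ennreal c * emeasure \<mu> E"
    by (rule mult_left_mono) simp
  then show ?thesis using inv_c by (simp add: mult.commute[of "ennreal c"] flip: mult.assoc)
qed

lemma right_translate_sets:
  assumes R: "radon_measure T \<mu>" and s: "s \<in> carrier G" and E: "E \<in> sets \<mu>"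
  shows "E #> s \<in> sets \<mu>"
proof -
  note sp = radon_measureD(1)[OF R, unfolded topspace_eq_carrier]
  have "(\<lambda>x. x \<otimes> inv s) \<in> measurable \<mu> \<mu>"
    using homeomorphic_right[OF s] by (intro continuous_map_measurable[OF R]) (simp add: homeomorphic_maps_def)
  from measurable_sets[OF this E] show ?thesis
    using vimage_right[of E "inv s"] sets.sets_into_space[OF E] sp s by simp
qed

end

section \<open>Right translation scales a Haar functional\<close>

context haar_functional
begin

text \<open>Left and right translations commute, so the right translate of a Haar functional is left
  invariant and hence proportional to it.\<close>

lemma right_scale_exists:
  assumes s: "s \<in> carrier G"
  obtains c where "c > 0" "\<And>f. f \<in> cc T \<Longrightarrow> I (\<lambda>x. f (x \<otimes> s)) = c * I f"
proof -
  have J: "left_invariant_functional G T (\<lambda>f. I (\<lambda>x. f (x \<otimes> s)))"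
  proof unfold_locales
    fix f g :: "'a \<Rightarrow> real" and c :: real assume f: "f \<in> cc T"
    show "I (\<lambda>x. c * f (x \<otimes> s)) = c * I (\<lambda>x. f (x \<otimes> s))" using cc_right[OF f s] by (rule I_cmult)
    show "I (\<lambda>x. f (t \<otimes> (x \<otimes> s))) = I (\<lambda>x. f (x \<otimes> s))" if t: "t \<in> carrier G" for t
    proof -
      have "I (\<lambda>x. f (x \<otimes> s)) = I (\<lambda>x. f ((t \<otimes> x) \<otimes> s))"
        using left_invariant[OF t cc_right[OF f s]] by simp
      also have "\<dots> = I (\<lambda>x. f (t \<otimes> (x \<otimes> s)))"
        using cc_left[OF cc_right[OF f s] t] t s by (intro I_cong) (auto simp: topspace_eq_carrier m_assoc)
      finally show ?thesis by simp
    qed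
    assume g: "g \<in> cc T"
    show "I (\<lambda>x. f (x \<otimes> s) + g (x \<otimes> s)) = I (\<lambda>x. f (x \<otimes> s)) + I (\<lambda>x. g (x \<otimes> s))"
      using cc_right[OF f s] cc_right[OF g s] by (rule I_add)
    show "I (\<lambda>x. f (x \<otimes> s)) \<le> I (\<lambda>x. g (x \<otimes> s))" if "\<And>x. x \<in> topspace T \<Longrightarrow> f x \<le> g x"
      using cc_right[OF f s] cc_right[OF g s] that s by (intro I_mono) (auto simp: topspace_eq_carrier)
  qed (rule locally_compact Hausdorff)+
  obtain c where c: "\<And>f. f \<in> cc T \<Longrightarrow> I (\<lambda>x. f (x \<otimes> s)) = c * I f"
    using proportional[OF J] by blast
  have sc: "compactin T {s}" using s by (simp add: topspace_eq_carrier)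
  \<comment> \<open>A bump at \<open>s\<close> has positive integral, and so has its right
    translate, which is positive at the identity; so the ratio is positive.\<close>
  obtain f where f: "f \<in> cc T" "\<And>x. x \<in> topspace T \<Longrightarrow> 0 \<le> f x" "\<And>x. x \<in> {s} \<Longrightarrow> f x = 1"
    by (rule bump1[OF sc], rule that)
  have "I f > 0" using f s by (intro strictly_positive[of f s]) (auto simp: topspace_eq_carrier)
  moreover have "I (\<lambda>x. f (x \<otimes> s)) > 0"
    using f s by (intro strictly_positive[of _ "\<one>"] cc_right) (auto simp: topspace_eq_carrier)
  ultimately have "c > 0" using c[OF f(1)] by (simp add: zero_less_mult_iff)
  then show thesis using that c by blast
qed

text \<open>One functional decides the definite description: all Haar integrals are multiples of
  \<open>I\<close>, so the scaling by \<open>c\<close> holds for each of them, and passes to Borel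
  sets by regularity.\<close>

lemma modular_function_eqI:
  assumes s: "s \<in> carrier G" and c: "c > 0" "\<And>f. f \<in> cc T \<Longrightarrow> I (\<lambda>x. f (x \<otimes> inv s)) = c * I f"
  shows "modular_function G T s = c"
  unfolding modular_function_def
proof (rule the_equality)
  have trans: "(\<integral>x. f (x \<otimes> inv s) \<partial>\<mu>) = c * integral\<^sup>L \<mu> f" if \<mu>: "left_haar_measure G T \<mu>" and f: "f \<in> cc T" for \<mu> f
  proof -
    interpret M: haar_functional G T "integral\<^sup>L \<mu>" by (rule haar_functional_integral[OF \<mu>])
    obtain k where k: "\<And>f. f \<in> cc T \<Longrightarrow> integral\<^sup>L \<mu> f = k * I f"
      using proportional[OF M.left_invariant_functional_axioms] by blast
    show ?thesis using k[OF f] k[OF cc_right[OF f, of "inv s"]] c(2)[OF f] s by simp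
  qed
  show good: "0 < c \<and> (\<forall>\<mu>. left_haar_measure G T \<mu> \<longrightarrow> (\<forall>E\<in>sets \<mu>. emeasure \<mu> (E #> s) = ennreal c * emeasure \<mu> E))"
  proof (intro conjI allI impI ballI c(1))
    fix \<mu> E assume \<mu>: "left_haar_measure G T \<mu>" and E: "E \<in> sets \<mu>"
    have R: "radon_measure T \<mu>" using \<mu> by (simp add: left_haar_measure_def)
    have Ec: "E \<subseteq> carrier G" using sets.sets_into_space[OF E] radon_measureD(1)[OF R] by (simp add: topspace_eq_carrier)
    have inverse: "(\<integral>x. f (x \<otimes> inv (inv s)) \<partial>\<mu>) = (1 / c) * integral\<^sup>L \<mu> f" if f: "f \<in> cc T" for f
    proof -
      interpret M: haar_functional G T "integral\<^sup>L \<mu>" by (rule haar_functional_integral[OF \<mu>])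
      have "integral\<^sup>L \<mu> f = (\<integral>x. f ((x \<otimes> inv s) \<otimes> s) \<partial>\<mu>)"
        using f s by (intro M.I_cong) (auto simp: topspace_eq_carrier m_assoc)
      also have "\<dots> = c * (\<integral>x. f (x \<otimes> s) \<partial>\<mu>)" by (rule trans[OF \<mu> cc_right[OF f s]])
      finally show ?thesis using c s by simp
    qed
    show "emeasure \<mu> (E #> s) = ennreal c * emeasure \<mu> E"
    proof (rule antisym)
      show "emeasure \<mu> (E #> s) \<le> ennreal c * emeasure \<mu> E"
        by (rule haar_measure_right_le[OF \<mu> s c(1) trans[OF \<mu>] E])
      have "emeasure \<mu> ((E #> s) #> inv s) \<le> ennreal (1 / c) * emeasure \<mu> (E #> s)"
        using s c by (intro haar_measure_right_le[OF \<mu> _ _ inverse right_translate_sets[OF R s E]]) auto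
      then have "ennreal c * emeasure \<mu> E \<le> ennreal c * (ennreal (1 / c) * emeasure \<mu> (E #> s))"
        using r_coset_inv_cancel[OF Ec s] by (intro mult_left_mono) auto
      also have "\<dots> = emeasure \<mu> (E #> s)"
        using c(1) by (simp flip: mult.assoc ennreal_mult)
      finally show "ennreal c * emeasure \<mu> E \<le> emeasure \<mu> (E #> s)" .
    qed
  qed
  \<comment> \<open>For uniqueness the universal clause is evaluated at an actual Haar measure, on a
    compact set of positive finite measure, where the measure can be cancelled.\<close>
  fix d assume d: "0 < d \<and> (\<forall>\<mu>. left_haar_measure G T \<mu> \<longrightarrow> (\<forall>E\<in>sets \<mu>. emeasure \<mu> (E #> s) = ennreal d * emeasure \<mu> E))"
  obtain \<mu> where \<mu>: "left_haar_measure G T \<mu>" using haar_measure_exists by blast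
  obtain K where K: "compactin T K" "0 < emeasure \<mu> K" "emeasure \<mu> K < \<infinity>"
    by (rule haar_positive_compact[OF \<mu>])
  have Ks: "K \<in> sets \<mu>" using \<mu> K Hausdorff radon_measure_compact_sets by (auto simp: left_haar_measure_def)
  have "ennreal d * emeasure \<mu> K = ennreal c * emeasure \<mu> K"
    using d good \<mu> Ks by metis
  then have "ennreal d = ennreal c"
    using K by (metis (no_types) ennreal_mult_divide_eq infinity_ennreal_def less_irrefl)
  then show "d = c" using d c by simp
qed

lemma modular_function_pos:
  assumes s: "s \<in> carrier G" shows "modular_function G T s > 0"
proof -
  obtain c where c: "c > 0" "\<And>f. f \<in> cc T \<Longrightarrow> I (\<lambda>x. f (x \<otimes> inv s)) = c * I f"
    using right_scale_exists[OF inv_closed[OF s]] by blast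
  show ?thesis using modular_function_eqI[OF s c] c by simp
qed

text \<open>The division reflects the convention: enlarging by \<Delta>(s) belongs to
  \<open>E #> s\<close>, that is, to the integrand \<open>f (x \<otimes> inv s)\<close>.\<close>

lemma right_translate:
  assumes s: "s \<in> carrier G" and f: "f \<in> cc T"
  shows "I (\<lambda>x. f (x \<otimes> s)) = I f / modular_function G T s"
proof -
  obtain c where c: "c > 0" "\<And>f. f \<in> cc T \<Longrightarrow> I (\<lambda>x. f (x \<otimes> inv s)) = c * I f"
    using right_scale_exists[OF inv_closed[OF s]] by blast
  have "I f = I (\<lambda>x. f ((x \<otimes> inv s) \<otimes> s))"
    using f s by (intro I_cong) (auto simp: topspace_eq_carrier m_assoc)
  also have "\<dots> = c * I (\<lambda>x. f (x \<otimes> s))" by (rule c(2)[OF cc_right[OF f s]])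
  finally show ?thesis using modular_function_eqI[OF s c] c by simp
qed

end

context locally_compact_group
begin

lemma modular_function_gt_0:
  assumes "s \<in> carrier G" shows "modular_function G T s > 0"
proof -
  obtain I where "haar_functional G T I" using haar_functional_exists by blast
  from haar_functional.modular_function_pos[OF this assms] show ?thesis .
qed

lemma modular_function_data:
  obtains I b where "haar_functional G T I" "b \<in> cc T" "I b > 0"
proof -
  obtain I where "haar_functional G T I" using haar_functional_exists by blast
  interpret haar_functional G T I by fact
  obtain f where f: "f \<in> cc T" "I f \<noteq> 0" using nontrivial by blast
  have "(\<lambda>x. - f x) \<in> cc T" "I (\<lambda>x. - f x) = - I f"
    using cc_cmult[OF f(1), of "-1"] I_cmult[OF f(1), of "-1"] by auto
  then show thesis using that[OF \<open>haar_functional G T I\<close>] f by (metis linorder_neqE neg_0_less_iff_less)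
qed

lemma modular_function_mult:
  assumes s: "s \<in> carrier G" and t: "t \<in> carrier G"
  shows "modular_function G T (s \<otimes> t) = modular_function G T s * modular_function G T t"
proof -
  obtain I b where "haar_functional G T I" and b: "b \<in> cc T" "I b > 0" by (rule modular_function_data)
  interpret haar_functional G T I by fact
  have "I b / modular_function G T (s \<otimes> t) = I (\<lambda>x. b (x \<otimes> (s \<otimes> t)))"
    using right_translate[OF _ b(1), of "s \<otimes> t"] s t by simp
  also have "\<dots> = I (\<lambda>x. b ((x \<otimes> s) \<otimes> t))"
    using b s t by (intro I_cong cc_right) (auto simp: topspace_eq_carrier m_assoc)
  also have "\<dots> = I b / modular_function G T t / modular_function G T s"
    using right_translate[OF s cc_right[OF b(1) t]] right_translate[OF t b(1)] by simp
  finally show ?thesis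
    using b modular_function_gt_0[of "s \<otimes> t"] modular_function_gt_0[OF s] modular_function_gt_0[OF t] s t
    by (simp add: field_simps)
qed

lemma modular_function_one: "modular_function G T \<one> = 1"
  using modular_function_mult[of \<one> \<one>] modular_function_gt_0[of \<one>] by simp

lemma modular_function_inv:
  assumes s: "s \<in> carrier G"
  shows "modular_function G T (inv s) = 1 / modular_function G T s"
  using modular_function_mult[of s "inv s"] modular_function_one modular_function_gt_0[OF s] s
  by (simp add: field_simps)

text \<open>For a fixed \<open>b\<close> with positive integral, the modulus at \<open>s\<close> is
  \<open>I b\<close> divided by the integral of the translate of \<open>b\<close>, a continuous
  nonvanishing function of \<open>s\<close>.\<close>

lemma continuous_modular_function: "continuous_map T euclideanreal (modular_function G T)"
proof -
  obtain I b where "haar_functional G T I" and b: "b \<in> cc T" "I b > 0" by (rule modular_function_data)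
  interpret haar_functional G T I by fact
  have nz: "I (\<lambda>x. b (x \<otimes> s)) \<noteq> 0" if "s \<in> topspace T" for s
    using right_translate[OF _ b(1), of s] b that modular_function_gt_0[of s] by (simp add: topspace_eq_carrier)
  have "continuous_map T euclideanreal (\<lambda>s. I b / I (\<lambda>x. b (x \<otimes> s)))"
    using continuous_right_translation[OF positive_functional_axioms b(1)] nz
    by (intro continuous_map_real_divide) auto
  then show ?thesis
    by (rule continuous_map_eq)
      (use right_translate[OF _ b(1)] b(2) in \<open>simp add: topspace_eq_carrier\<close>)
qed

text \<open>By multiplicativity, a neighbourhood \<open>U\<close> of the identity inside the kernel
  yields the neighbourhood \<open>s <# U\<close> of each kernel element \<open>s\<close>.\<close>

lemma openin_modular_kernel_iff:
  "openin T (modular_kernel G T) \<longleftrightarrow> (\<exists>U. openin T U \<and> \<one> \<in> U \<and> U \<subseteq> modular_kernel G T)"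
proof
  assume "openin T (modular_kernel G T)"
  then show "\<exists>U. openin T U \<and> \<one> \<in> U \<and> U \<subseteq> modular_kernel G T"
    by (intro exI[of _ "modular_kernel G T"]) (simp add: modular_kernel_def modular_function_one)
next
  assume "\<exists>U. openin T U \<and> \<one> \<in> U \<and> U \<subseteq> modular_kernel G T"
  then obtain U where U: "openin T U" "\<one> \<in> U" "U \<subseteq> modular_kernel G T" by blast
  show "openin T (modular_kernel G T)"
  proof (subst openin_subopen, rule ballI)
    fix s assume s: "s \<in> modular_kernel G T"
    then have sc: "s \<in> carrier G" by (simp add: modular_kernel_def)
    have "s \<otimes> \<one> \<in> s <# U" using U unfolding l_coset_image by blast
    moreover have "s <# U \<subseteq> modular_kernel G T"
      using s U(3) by (auto simp: l_coset_image modular_kernel_def modular_function_mult)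
    ultimately show "\<exists>V. openin T V \<and> s \<in> V \<and> V \<subseteq> modular_kernel G T"
      using openin_left[OF U(1) sc] sc by (intro exI[of _ "s <# U"]) simp
  qed
qed

end

section \<open>Closed subgroups, products and quotients\<close>

lemma cc_subtopology:
  assumes f: "f \<in> cc X" and H: "closedin X H"
  shows "f \<in> cc (subtopology X H)"
proof -
  obtain K where K: "compactin X K" "\<And>x. x \<in> topspace X \<Longrightarrow> x \<notin> K \<Longrightarrow> f x = 0"
    using f unfolding cc_def by blast
  have "compactin (subtopology X H) (K \<inter> H)"
    using compact_Int_closedin[OF K(1) H] by (simp add: compactin_subtopology)
  then show ?thesis
    by (rule ccI[OF continuous_map_from_subtopology[OF cc_continuous[OF f]]]) (use K(2) in auto)
qed

lemma (in locally_compact_group) closed_subgroup: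
  assumes H: "subgroup H G" and cl: "closedin T H"
  shows "locally_compact_group (G\<lparr>carrier := H\<rparr>) (subtopology T H)"
proof -
  interpret H: group "G\<lparr>carrier := H\<rparr>" using H by (rule subgroup.subgroup_is_group) (rule group_axioms)
  have Hc: "H \<subseteq> carrier G" using H by (rule subgroup.subset)
  have ts: "topspace (subtopology T H) = H" using Hc by (auto simp: topspace_eq_carrier)
  have c: "continuous_map (subtopology T H) T (\<lambda>x. x)"
    using continuous_map_from_subtopology[OF continuous_map_id] by (simp add: id_def)
  show ?thesis
  proof unfold_locales
    show "topspace (subtopology T H) = carrier (G\<lparr>carrier := H\<rparr>)" using ts by simp
    show "Hausdorff_space (subtopology T H)" by (rule Hausdorff_space_subtopology[OF Hausdorff])
    show "locally_compact_space (subtopology T H)" by (rule locally_compact_space_closed_subset[OF locally_compact cl])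
    have "continuous_map (subtopology T H) T (\<lambda>x. inv x)" using continuous_map_inverse[OF c] .
    then have "continuous_map (subtopology T H) (subtopology T H) (\<lambda>x. inv x)"
      using ts subgroup.m_inv_closed[OF H] by (auto simp: continuous_map_in_subtopology)
    then show "continuous_map (subtopology T H) (subtopology T H) (\<lambda>x. inv\<^bsub>G\<lparr>carrier := H\<rparr>\<^esub> x)"
      by (rule continuous_map_eq) (use ts m_inv_consistent[OF H] in auto)
    have "continuous_map (prod_topology (subtopology T H) (subtopology T H)) T (\<lambda>p. fst p \<otimes> snd p)"
      using continuous_map_compose[OF continuous_map_fst c] continuous_map_compose[OF continuous_map_snd c]
      by (intro continuous_map_mult) (simp_all add: o_def)
    then have "continuous_map (prod_topology (subtopology T H) (subtopology T H)) (subtopology T H) (\<lambda>p. fst p \<otimes> snd p)"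
      using ts subgroup.m_closed[OF H] by (auto simp: continuous_map_in_subtopology)
    then show "continuous_map (prod_topology (subtopology T H) (subtopology T H)) (subtopology T H)
        (\<lambda>(x, y). x \<otimes>\<^bsub>G\<lparr>carrier := H\<rparr>\<^esub> y)"
      by (simp add: case_prod_unfold)
  qed
qed

lemma locally_compact_group_DirProd:
  assumes G: "locally_compact_group G T" and H: "locally_compact_group H U"
  shows "locally_compact_group (G \<times>\<times> H) (prod_topology T U)"
proof -
  interpret G: locally_compact_group G T by fact
  interpret H: locally_compact_group H U by fact
  interpret group "G \<times>\<times> H" by (rule DirProd_group[OF G.group_axioms H.group_axioms])
  let ?P = "prod_topology T U"
  show ?thesis
  proof unfold_locales
    show ts: "topspace ?P = carrier (G \<times>\<times> H)" by (simp add: G.topspace_eq_carrier H.topspace_eq_carrier)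
    show "Hausdorff_space ?P" using G.Hausdorff H.Hausdorff by (simp add: Hausdorff_space_prod_topology)
    show "locally_compact_space ?P" using G.locally_compact H.locally_compact by (simp add: locally_compact_space_prod_topology)
    have "continuous_map ?P ?P (\<lambda>p. (inv\<^bsub>G\<^esub> (fst p), inv\<^bsub>H\<^esub> (snd p)))"
      by (intro continuous_map_pairedI G.continuous_map_inverse H.continuous_map_inverse continuous_intros)
    then show "continuous_map ?P ?P (\<lambda>x. inv\<^bsub>G \<times>\<times> H\<^esub> x)"
      by (rule continuous_map_eq)
        (use inv_DirProd[OF G.group_axioms H.group_axioms] in \<open>auto simp: G.topspace_eq_carrier H.topspace_eq_carrier\<close>)
    have "continuous_map (prod_topology ?P ?P) ?P
        (\<lambda>p. (fst (fst p) \<otimes>\<^bsub>G\<^esub> fst (snd p), snd (fst p) \<otimes>\<^bsub>H\<^esub> snd (snd p)))"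
      using continuous_map_compose[OF continuous_map_fst continuous_map_fst]
        continuous_map_compose[OF continuous_map_fst continuous_map_snd]
        continuous_map_compose[OF continuous_map_snd continuous_map_fst]
        continuous_map_compose[OF continuous_map_snd continuous_map_snd]
      by (intro continuous_map_pairedI G.continuous_map_mult H.continuous_map_mult) (simp_all add: o_def)
    then show "continuous_map (prod_topology ?P ?P) ?P (\<lambda>(x, y). x \<otimes>\<^bsub>G \<times>\<times> H\<^esub> y)"
      by (simp add: case_prod_unfold DirProd_def)
  qed
qed

text \<open>The iterated functional \<open>L\<close> is a Haar functional on the product, and right
  translation by \<open>(a, b)\<close> scales each of its two integrations separately.\<close>

lemma modular_function_DirProd:
  assumes G: "locally_compact_group G T" and H: "locally_compact_group H U"
    and a: "a \<in> carrier G" and b: "b \<in> carrier H"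
  shows "modular_function (G \<times>\<times> H) (prod_topology T U) (a, b) = modular_function G T a * modular_function H U b"
proof -
  interpret G: locally_compact_group G T by fact
  interpret H: locally_compact_group H U by fact
  let ?P = "prod_topology T U"
  interpret P: locally_compact_group "G \<times>\<times> H" ?P by (rule locally_compact_group_DirProd[OF G H])
  obtain I where "haar_functional G T I" using G.haar_functional_exists by blast
  then interpret I: haar_functional G T I .
  obtain J where "haar_functional H U J" using H.haar_functional_exists by blast
  then interpret J: haar_functional H U J .
  note ts = G.topspace_eq_carrier H.topspace_eq_carrier
  define L where "L f = I (\<lambda>x. J (\<lambda>y. f (x, y)))" for f
  have sl: "(\<lambda>y. f (x, y)) \<in> cc U" if "f \<in> cc ?P" "x \<in> topspace T" for f x
    using J.cc_slice[of "\<lambda>x y. f (x, y)" T x] that by simp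
  have fn: "(\<lambda>x. J (\<lambda>y. f (x, y))) \<in> cc T" if "f \<in> cc ?P" for f
    using J.cc_functional[of "\<lambda>x y. f (x, y)" T] that by simp
  interpret L: positive_functional ?P L
  proof
    fix f g :: "'a \<times> 'c \<Rightarrow> real" and c assume f: "f \<in> cc ?P"
    have "L (\<lambda>x. c * f x) = I (\<lambda>x. c * J (\<lambda>y. f (x, y)))"
      unfolding L_def
    proof (rule I.I_cong)
      show "(\<lambda>x. J (\<lambda>y. c * f (x, y))) \<in> cc T" by (rule fn[OF cc_cmult[OF f]])
    qed (use sl[OF f] J.I_cmult in simp)
    then show "L (\<lambda>x. c * f x) = c * L f" using I.I_cmult[OF fn[OF f]] by (simp add: L_def)
    assume g: "g \<in> cc ?P"
    have "L (\<lambda>x. f x + g x) = I (\<lambda>x. J (\<lambda>y. f (x, y)) + J (\<lambda>y. g (x, y)))"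
      unfolding L_def
    proof (rule I.I_cong)
      show "(\<lambda>x. J (\<lambda>y. f (x, y) + g (x, y))) \<in> cc T" by (rule fn[OF cc_add[OF f g]])
    qed (use sl[OF f] sl[OF g] J.I_add in simp)
    then show "L (\<lambda>x. f x + g x) = L f + L g" using I.I_add[OF fn[OF f] fn[OF g]] by (simp add: L_def)
    show "L f \<le> L g" if le: "\<And>x. x \<in> topspace ?P \<Longrightarrow> f x \<le> g x"
      unfolding L_def by (intro I.I_mono J.I_mono fn sl f g le) auto
  qed (rule P.locally_compact P.Hausdorff)+
  interpret L: haar_functional "G \<times>\<times> H" ?P L
  proof unfold_locales
    fix s f assume s: "s \<in> carrier (G \<times>\<times> H)" and f: "f \<in> cc ?P"
    obtain s1 s2 where s': "s = (s1, s2)" "s1 \<in> carrier G" "s2 \<in> carrier H" using s by auto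
    have f2: "(\<lambda>p. f (s \<otimes>\<^bsub>G \<times>\<times> H\<^esub> p)) \<in> cc ?P" by (rule P.cc_left[OF f s])
    have "L (\<lambda>x. f (s \<otimes>\<^bsub>G \<times>\<times> H\<^esub> x)) = I (\<lambda>x. J (\<lambda>y. f (s1 \<otimes>\<^bsub>G\<^esub> x, y)))"
      unfolding L_def
    proof (rule I.I_cong[OF fn[OF f2]])
      fix x assume x: "x \<in> topspace T"
      then have "(\<lambda>y. f (s1 \<otimes>\<^bsub>G\<^esub> x, y)) \<in> cc U" using s' by (intro sl[OF f]) (simp add: ts)
      from J.left_invariant[OF s'(3) this]
      show "J (\<lambda>y. f (s \<otimes>\<^bsub>G \<times>\<times> H\<^esub> (x, y))) = J (\<lambda>y. f (s1 \<otimes>\<^bsub>G\<^esub> x, y))"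
        by (simp add: s')
    qed
    also have "\<dots> = L f" unfolding L_def by (rule I.left_invariant[OF s'(2) fn[OF f]])
    finally show "L (\<lambda>x. f (s \<otimes>\<^bsub>G \<times>\<times> H\<^esub> x)) = L f" .
  next
    have 1: "compactin ?P {(\<one>\<^bsub>G\<^esub>, \<one>\<^bsub>H\<^esub>)}" by (simp add: ts)
    obtain f where f: "f \<in> cc ?P" "\<And>x. x \<in> topspace ?P \<Longrightarrow> 0 \<le> f x" "\<And>x. x \<in> {(\<one>\<^bsub>G\<^esub>, \<one>\<^bsub>H\<^esub>)} \<Longrightarrow> f x = 1"
      by (rule L.bump1[OF 1], rule that)
    have "J (\<lambda>y. f (\<one>\<^bsub>G\<^esub>, y)) > 0"
      using f(2,3) by (intro J.strictly_positive[OF sl[OF f(1)], of _ "\<one>\<^bsub>H\<^esub>"]) (auto simp: ts)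
    moreover have "0 \<le> J (\<lambda>y. f (x, y))" if "x \<in> carrier G" for x
      using f(2) that by (intro J.I_nonneg sl[OF f(1)]) (auto simp: ts)
    ultimately have "L f > 0"
      unfolding L_def by (intro I.strictly_positive[OF fn[OF f(1)], of "\<one>\<^bsub>G\<^esub>"]) auto
    then show "\<exists>f\<in>cc ?P. L f \<noteq> 0" using f(1) by force
  qed
  obtain f where f: "f \<in> cc ?P" "L f \<noteq> 0" using L.nontrivial by blast
  have ab: "(a, b) \<in> carrier (G \<times>\<times> H)" using a b by simp
  have f2: "(\<lambda>p. f (p \<otimes>\<^bsub>G \<times>\<times> H\<^esub> (a, b))) \<in> cc ?P" by (rule P.cc_right[OF f(1) ab])
  have f3: "(\<lambda>x. J (\<lambda>y. f (x \<otimes>\<^bsub>G\<^esub> a, y))) \<in> cc T" by (rule G.cc_right[OF fn[OF f(1)] a])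
  have "L f / modular_function (G \<times>\<times> H) ?P (a, b) = L (\<lambda>p. f (p \<otimes>\<^bsub>G \<times>\<times> H\<^esub> (a, b)))"
    by (rule L.right_translate[OF ab f(1), symmetric])
  also have "\<dots> = I (\<lambda>x. (1 / modular_function H U b) * J (\<lambda>y. f (x \<otimes>\<^bsub>G\<^esub> a, y)))"
    unfolding L_def
  proof (rule I.I_cong[OF fn[OF f2]])
    fix x assume x: "x \<in> topspace T"
    then have "(\<lambda>y. f (x \<otimes>\<^bsub>G\<^esub> a, y)) \<in> cc U" using a by (intro sl[OF f(1)]) (simp add: ts)
    from J.right_translate[OF b this]
    show "J (\<lambda>y. f ((x, y) \<otimes>\<^bsub>G \<times>\<times> H\<^esub> (a, b))) = (1 / modular_function H U b) * J (\<lambda>y. f (x \<otimes>\<^bsub>G\<^esub> a, y))"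
      by simp
  qed
  also have "\<dots> = (1 / modular_function H U b) * (L f / modular_function G T a)"
    unfolding L_def I.I_cmult[OF f3] using I.right_translate[OF a fn[OF f(1)]] by simp
  finally show ?thesis
    using f(2) P.modular_function_gt_0[OF ab] G.modular_function_gt_0[OF a] H.modular_function_gt_0[OF b]
    by (simp add: field_simps)
qed

text \<open>The homogeneous space \<open>G/H\<close> is modelled by a space \<open>Y\<close> with an open map \<open>\<pi>\<close> from \<open>G\<close> onto a
  clopen subset of \<open>Y\<close> whose nonempty fibres are the cosets \<open>gH\<close>; \<open>J\<close> is a measure on \<open>Y\<close> under
  which the action of \<open>s\<close> scales by \<open>\<delta> s\<close>.\<close>

locale homogeneous_space = locally_compact_group G T + J: positive_functional Y J
  for G (structure) and T and Y :: "'y topology" and J +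
  fixes H :: "'a set" and \<pi> :: "'a \<Rightarrow> 'y" and \<delta> :: "'a \<Rightarrow> real"
  assumes subgroup_H: "subgroup H G" and closedin_H: "closedin T H"
    and \<pi>_continuous: "continuous_map T Y \<pi>" and \<pi>_open: "open_map T Y \<pi>"
    and closed_image: "closedin Y (\<pi> ` carrier G)"
    and fibre: "\<And>g g'. g \<in> carrier G \<Longrightarrow> g' \<in> carrier G \<Longrightarrow> \<pi> g = \<pi> g' \<longleftrightarrow> inv g \<otimes> g' \<in> H"
    and \<delta>_continuous: "continuous_map T euclideanreal \<delta>"
    and \<delta>_pos: "\<And>s. s \<in> carrier G \<Longrightarrow> \<delta> s > 0"
    and \<delta>_mult: "\<And>s t. s \<in> carrier G \<Longrightarrow> t \<in> carrier G \<Longrightarrow> \<delta> (s \<otimes> t) = \<delta> s * \<delta> t"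
    and J_pos: "\<And>F. F \<in> cc Y \<Longrightarrow> (\<And>y. y \<in> topspace Y \<Longrightarrow> 0 \<le> F y) \<Longrightarrow> F (\<pi> \<one>) > 0 \<Longrightarrow> J F > 0"
    and J_invariant: "\<And>s F F'. s \<in> carrier G \<Longrightarrow> F \<in> cc Y \<Longrightarrow> F' \<in> cc Y \<Longrightarrow>
      (\<And>g. g \<in> carrier G \<Longrightarrow> F' (\<pi> g) = F (\<pi> (s \<otimes> g))) \<Longrightarrow>
      (\<And>y. y \<in> topspace Y - \<pi> ` carrier G \<Longrightarrow> F y = 0 \<and> F' y = 0) \<Longrightarrow> J F' = \<delta> s * J F"
begin

lemma H_carrier: "H \<subseteq> carrier G"
  using subgroup_H by (rule subgroup.subset)

lemma topspace_H: "topspace (subtopology T H) = H"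
  using H_carrier by (auto simp: topspace_eq_carrier)

lemma cc_coset: "f \<in> cc T \<Longrightarrow> g \<in> carrier G \<Longrightarrow> (\<lambda>h. f (g \<otimes> h)) \<in> cc (subtopology T H)"
  by (rule cc_subtopology[OF cc_left closedin_H])

text \<open>The classical compatibility between the moduli of a group and of a closed subgroup whose
  coset space carries a relatively invariant measure of modulus \<open>\<delta>\<close>.\<close>

lemma modular_function_subgroup:
  assumes p: "p \<in> H"
  shows "modular_function G T p = \<delta> p * modular_function (G\<lparr>carrier := H\<rparr>) (subtopology T H) p"
proof -
  let ?H = "G\<lparr>carrier := H\<rparr>" and ?TH = "subtopology T H"
  interpret LH: locally_compact_group ?H ?TH by (rule closed_subgroup[OF subgroup_H closedin_H])
  obtain I where "haar_functional ?H ?TH I" using LH.haar_functional_exists by blast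
  then interpret I: haar_functional ?H ?TH I .
  \<comment> \<open>Integration over the coset above \<open>y\<close>. Two representatives of a
    coset differ by an element of \<open>H\<close>, so left invariance of \<open>I\<close> makes the
    choice immaterial; points off the image get 0.\<close>
  define M where "M f y = (if y \<in> \<pi> ` carrier G
    then I (\<lambda>h. f ((SOME g. g \<in> carrier G \<and> \<pi> g = y) \<otimes> h)) else 0)" for f y
  have M_eq: "M f (\<pi> g) = I (\<lambda>h. f (g \<otimes> h))" if f: "f \<in> cc T" and g: "g \<in> carrier G" for f g
  proof -
    define g' where "g' = (SOME g'. g' \<in> carrier G \<and> \<pi> g' = \<pi> g)"
    have g': "g' \<in> carrier G" "\<pi> g' = \<pi> g"
      using someI_ex[of "\<lambda>g'. g' \<in> carrier G \<and> \<pi> g' = \<pi> g"] g unfolding g'_def by blast+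
    then have k: "inv g' \<otimes> g \<in> H" using fibre g by blast
    have "I (\<lambda>h. f (g' \<otimes> h)) = I (\<lambda>h. f (g' \<otimes> ((inv g' \<otimes> g) \<otimes> h)))"
      using I.left_invariant[of "inv g' \<otimes> g", OF _ cc_coset[OF f g'(1)]] k by simp
    also have "\<dots> = I (\<lambda>h. f (g \<otimes> h))"
    proof (rule I.I_cong[symmetric, OF cc_coset[OF f g]])
      fix h assume "h \<in> topspace ?TH"
      then have h: "h \<in> carrier G" using H_carrier topspace_H by auto
      have "g' \<otimes> ((inv g' \<otimes> g) \<otimes> h) = (g' \<otimes> inv g') \<otimes> (g \<otimes> h)"
        using g g' h by (simp only: m_assoc m_closed inv_closed)
      then show "f (g \<otimes> h) = f (g' \<otimes> ((inv g' \<otimes> g) \<otimes> h))" using g g' h by simp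
    qed
    finally show ?thesis using g unfolding M_def g'_def by auto
  qed
  have M_out: "M f y = 0" if "y \<notin> \<pi> ` carrier G" for f y using that by (simp add: M_def)
  have \<pi>_H: "\<pi> (g \<otimes> h) = \<pi> g" if "g \<in> carrier G" "h \<in> H" for g h
    using fibre[of g "g \<otimes> h"] that H_carrier by (auto simp: m_assoc[symmetric])
  have image_open: "openin Y (\<pi> ` S)" if "openin T S" for S using \<pi>_open that by (simp add: open_map_def)
  \<comment> \<open>Openness of \<open>\<pi>\<close> pushes continuity of the coset integral on
    \<open>G\<close> down to the image. The image being closed, its complement is a neighbourhood of
    each of its points on which \<open>M f\<close> is constantly 0.\<close>
  have M_cc: "M f \<in> cc Y" if f: "f \<in> cc T" for f
  proof -
    obtain K where K: "compactin T K" "\<And>x. x \<in> topspace T \<Longrightarrow> x \<notin> K \<Longrightarrow> f x = 0"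
      using f unfolding cc_def by blast
    have c: "continuous_map T euclideanreal (\<lambda>g. I (\<lambda>h. f (g \<otimes> h)))"
    proof (rule I.continuous_functional)
      have "continuous_map (prod_topology T ?TH) T (\<lambda>p. fst p \<otimes> snd p)"
        using continuous_map_compose[OF continuous_map_snd continuous_map_from_subtopology[OF continuous_map_id]]
        by (intro continuous_map_mult continuous_intros) (simp add: o_def id_def)
      from continuous_map_compose[OF this cc_continuous[OF f]]
      show "continuous_map (prod_topology T ?TH) euclideanreal (\<lambda>(g, h). f (g \<otimes> h))"
        by (simp add: o_def case_prod_unfold)
      fix g assume "g \<in> topspace T"
      then obtain V L where V: "openin T V" "compactin T L" "g \<in> V" "V \<subseteq> L"
        using locally_compact unfolding locally_compact_space_def by blast
      define C where "C = (\<lambda>(x, y). x \<otimes> y) ` ((\<lambda>x. inv x) ` L \<times> K)"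
      have "compactin T C" unfolding C_def by (intro compactin_mult compactin_inv V K)
      then have "compactin ?TH (C \<inter> H)"
        using compact_Int_closedin[OF _ closedin_H] by (simp add: compactin_subtopology)
      moreover have "f (v \<otimes> h) = 0" if v: "v \<in> V" and h: "h \<in> H" "h \<notin> C" for v h
      proof -
        have vc: "v \<in> carrier G" "h \<in> carrier G"
          using v h H_carrier openin_subset[OF V(1)] by (auto simp: topspace_eq_carrier)
        have "v \<otimes> h \<notin> K"
        proof
          assume "v \<otimes> h \<in> K"
          then have "(inv v, v \<otimes> h) \<in> (\<lambda>x. inv x) ` L \<times> K" using v V by blast
          then have "inv v \<otimes> (v \<otimes> h) \<in> C" unfolding C_def by force
          then show False using h vc by (simp add: m_assoc[symmetric])
        qed
        then show ?thesis using K(2) vc by (simp add: topspace_eq_carrier)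
      qed
      ultimately show "\<exists>V L. openin T V \<and> g \<in> V \<and> compactin ?TH L \<and> (\<forall>v\<in>V. \<forall>h\<in>topspace ?TH - L. f (v \<otimes> h) = 0)"
        using V topspace_H by (intro exI[of _ V] exI[of _ "C \<inter> H"]) auto
    qed
    have "continuous_map Y euclideanreal (M f)"
      unfolding continuous_map_real_iff
    proof (intro ballI allI impI)
      fix y and e :: real assume y: "y \<in> topspace Y" and e: "e > 0"
      show "\<exists>U. openin Y U \<and> y \<in> U \<and> (\<forall>z\<in>U. \<bar>M f z - M f y\<bar> < e)"
      proof (cases "y \<in> \<pi> ` carrier G")
        case True
        then obtain g where g: "g \<in> carrier G" "y = \<pi> g" by blast
        obtain U where U: "openin T U" "g \<in> U" "\<And>u. u \<in> U \<Longrightarrow> \<bar>I (\<lambda>h. f (u \<otimes> h)) - I (\<lambda>h. f (g \<otimes> h))\<bar> < e"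
          using c[unfolded continuous_map_real_iff] g e by (metis topspace_eq_carrier)
        have "\<bar>M f (\<pi> u) - M f y\<bar> < e" if "u \<in> U" for u
          using U(3)[OF that] that openin_subset[OF U(1)] M_eq[OF f] g by (auto simp: topspace_eq_carrier)
        then show ?thesis using image_open[OF U(1)] U(2) g by (intro exI[of _ "\<pi> ` U"]) auto
      next
        case False
        then show ?thesis using closed_image y e by (intro exI[of _ "topspace Y - \<pi> ` carrier G"]) (auto simp: M_out)
      qed
    qed
    moreover have "compactin Y (\<pi> ` K)" by (rule image_compactin[OF K(1) \<pi>_continuous])
    moreover have "M f y = 0" if "y \<in> topspace Y" "y \<notin> \<pi> ` K" for y
    proof (cases "y \<in> \<pi> ` carrier G")
      case True
      then obtain g where g: "g \<in> carrier G" "y = \<pi> g" by blast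
      have "f (g \<otimes> h) = 0" if h: "h \<in> H" for h
      proof -
        have "g \<otimes> h \<notin> K" using \<pi>_H[OF g(1) h] g \<open>y \<notin> \<pi> ` K\<close> by (metis image_eqI)
        then show ?thesis using K(2) g h H_carrier by (auto simp: topspace_eq_carrier)
      qed
      then have "I (\<lambda>h. 0) = I (\<lambda>h. f (g \<otimes> h))" using topspace_H by (intro I.I_cong cc_zero) simp
      then show ?thesis using M_eq[OF f g(1)] g by (simp add: I.I_zero)
    qed (rule M_out)
    ultimately show ?thesis by (rule ccI)
  qed
  have M_eqI: "M f y = F y" if f: "f \<in> cc T" and y: "y \<in> topspace Y"
    and F: "\<And>g. g \<in> carrier G \<Longrightarrow> I (\<lambda>h. f (g \<otimes> h)) = F (\<pi> g)" "y \<notin> \<pi> ` carrier G \<Longrightarrow> F y = 0" for f F y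
  proof (cases "y \<in> \<pi> ` carrier G")
    case True
    then show ?thesis using M_eq[OF f] F(1) by auto
  qed (simp add: M_out F(2))
  \<comment> \<open>The weight \<open>\<delta>\<close> is multiplicative, so under left translation
    by \<open>s\<close> it contributes \<open>1 / \<delta> s\<close>, cancelling the factor by which
    \<open>J\<close> scales.\<close>
  define L where "L f = J (M (\<lambda>x. \<delta> x * f x))" for f
  have fc: "(\<lambda>x. \<delta> x * f x) \<in> cc T" if "f \<in> cc T" for f using \<delta>_continuous that by (rule cc_mult_left)
  have JM_cmult: "J (M (\<lambda>x. c * f x)) = c * J (M f)" if f: "f \<in> cc T" for c f
  proof -
    have "J (M (\<lambda>x. c * f x)) = J (\<lambda>y. c * M f y)"
    proof (rule J.I_cong[OF M_cc[OF cc_cmult[OF f]]], rule M_eqI[OF cc_cmult[OF f]])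
      fix g assume g: "g \<in> carrier G"
      show "I (\<lambda>h. c * f (g \<otimes> h)) = c * M f (\<pi> g)"
        using I.I_cmult[OF cc_coset[OF f g]] M_eq[OF f g] by simp
    qed (auto simp: M_out)
    then show ?thesis using J.I_cmult[OF M_cc[OF f]] by simp
  qed
  have J_cong_M: "J (M f) = J (M g)" if f: "f \<in> cc T" and g: "g \<in> cc T" and fg: "\<And>x. x \<in> carrier G \<Longrightarrow> f x = g x" for f g
  proof (rule J.I_cong[OF M_cc[OF f]], rule M_eqI[OF f])
    fix x assume x: "x \<in> carrier G"
    have "I (\<lambda>h. f (x \<otimes> h)) = I (\<lambda>h. g (x \<otimes> h))"
      using fg x H_carrier topspace_H by (intro I.I_cong[OF cc_coset[OF f x]]) auto
    then show "I (\<lambda>h. f (x \<otimes> h)) = M g (\<pi> x)" using M_eq[OF g x] by simp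
  qed (auto simp: M_out)
  have L_left: "left_invariant_functional G T L"
  proof unfold_locales
    fix f g :: "'a \<Rightarrow> real" and c assume f: "f \<in> cc T"
    show "L (\<lambda>x. c * f x) = c * L f"
      using JM_cmult[OF fc[OF f], of c] unfolding L_def by (simp add: mult.left_commute)
    show "L (\<lambda>x. f (s \<otimes> x)) = L f" if s: "s \<in> carrier G" for s
    proof -
      let ?u = "\<lambda>x. \<delta> x * f x"
      note us = cc_left[OF fc[OF f] s]
      have a: "L (\<lambda>x. f (s \<otimes> x)) = J (M (\<lambda>x. (1 / \<delta> s) * ?u (s \<otimes> x)))"
        unfolding L_def
      proof (rule J_cong_M[OF fc[OF cc_left[OF f s]] cc_cmult[OF us]])
        fix x assume "x \<in> carrier G"
        then show "\<delta> x * f (s \<otimes> x) = (1 / \<delta> s) * ?u (s \<otimes> x)" using \<delta>_mult[OF s] \<delta>_pos[OF s] by simp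
      qed
      have b: "J (M (\<lambda>x. ?u (s \<otimes> x))) = \<delta> s * J (M ?u)"
      proof (rule J_invariant[OF s M_cc[OF fc[OF f]] M_cc[OF us]])
        fix g assume g: "g \<in> carrier G"
        have "M (\<lambda>x. ?u (s \<otimes> x)) (\<pi> g) = I (\<lambda>h. ?u (s \<otimes> (g \<otimes> h)))" by (rule M_eq[OF us g])
        also have "\<dots> = I (\<lambda>h. ?u ((s \<otimes> g) \<otimes> h))"
          using topspace_H H_carrier s g by (intro I.I_cong[OF cc_coset[OF us g]]) (auto simp: m_assoc subset_iff)
        also have "\<dots> = M ?u (\<pi> (s \<otimes> g))" using s g by (intro M_eq[OF fc[OF f], symmetric]) simp
        finally show "M (\<lambda>x. ?u (s \<otimes> x)) (\<pi> g) = M ?u (\<pi> (s \<otimes> g))" .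
      qed (auto simp: M_out)
      show ?thesis unfolding a JM_cmult[OF us] b using \<delta>_pos[OF s] by (simp add: L_def)
    qed
    assume g: "g \<in> cc T"
    have "L (\<lambda>x. f x + g x) = J (\<lambda>y. M (\<lambda>x. \<delta> x * f x) y + M (\<lambda>x. \<delta> x * g x) y)"
      unfolding L_def
    proof (rule J.I_cong[OF M_cc[OF fc[OF cc_add[OF f g]]]], rule M_eqI[OF fc[OF cc_add[OF f g]]])
      fix x assume x: "x \<in> carrier G"
      show "I (\<lambda>h. \<delta> (x \<otimes> h) * (f (x \<otimes> h) + g (x \<otimes> h))) = M (\<lambda>x. \<delta> x * f x) (\<pi> x) + M (\<lambda>x. \<delta> x * g x) (\<pi> x)"
        using I.I_add[OF cc_coset[OF fc[OF f] x] cc_coset[OF fc[OF g] x]] M_eq[OF fc[OF f] x] M_eq[OF fc[OF g] x]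
        by (simp add: distrib_left)
    qed (auto simp: M_out)
    then show "L (\<lambda>x. f x + g x) = L f + L g"
      using J.I_add[OF M_cc[OF fc[OF f]] M_cc[OF fc[OF g]]] by (simp add: L_def)
    show "L f \<le> L g" if le: "\<And>x. x \<in> topspace T \<Longrightarrow> f x \<le> g x"
      unfolding L_def
    proof (rule J.I_mono[OF M_cc[OF fc[OF f]] M_cc[OF fc[OF g]]])
      fix y assume "y \<in> topspace Y"
      show "M (\<lambda>x. \<delta> x * f x) y \<le> M (\<lambda>x. \<delta> x * g x) y"
      proof (cases "y \<in> \<pi> ` carrier G")
        case True
        then obtain x where x: "x \<in> carrier G" "y = \<pi> x" by blast
        have "I (\<lambda>h. \<delta> (x \<otimes> h) * f (x \<otimes> h)) \<le> I (\<lambda>h. \<delta> (x \<otimes> h) * g (x \<otimes> h))"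
        proof (rule I.I_mono[OF cc_coset[OF fc[OF f] x(1)] cc_coset[OF fc[OF g] x(1)]])
          fix h assume "h \<in> topspace ?TH"
          then have "x \<otimes> h \<in> carrier G" using x H_carrier topspace_H by auto
          then show "\<delta> (x \<otimes> h) * f (x \<otimes> h) \<le> \<delta> (x \<otimes> h) * g (x \<otimes> h)"
            using le \<delta>_pos by (intro mult_left_mono) (auto simp: topspace_eq_carrier less_imp_le)
        qed
        then show ?thesis using M_eq[OF fc[OF f] x(1)] M_eq[OF fc[OF g] x(1)] x by simp
      qed (simp add: M_out)
    qed
  qed (rule locally_compact Hausdorff)+
  have pc: "p \<in> carrier G" using p H_carrier by blast
  \<comment> \<open>Right translation by \<open>p\<close> stays inside each coset: it affects the
    inner integral through the modulus of \<open>H\<close> and the weight through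
    \<open>\<delta> p\<close>, but not the outer functional \<open>J\<close>.\<close>
  have L_right: "L (\<lambda>x. f (x \<otimes> p)) = L f / (\<delta> p * modular_function ?H ?TH p)" if f: "f \<in> cc T" for f
  proof -
    let ?u = "\<lambda>x. \<delta> x * f x"
    note u = fc[OF f] and up = cc_right[OF fc[OF f] pc]
    have a: "L (\<lambda>x. f (x \<otimes> p)) = J (M (\<lambda>x. (1 / \<delta> p) * ?u (x \<otimes> p)))"
      unfolding L_def
    proof (rule J_cong_M[OF fc[OF cc_right[OF f pc]] cc_cmult[OF up]])
      fix x assume "x \<in> carrier G"
      then show "\<delta> x * f (x \<otimes> p) = (1 / \<delta> p) * ?u (x \<otimes> p)" using \<delta>_mult[OF _ pc] \<delta>_pos[OF pc] by simp
    qed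
    have "J (M (\<lambda>x. ?u (x \<otimes> p))) = J (\<lambda>y. (1 / modular_function ?H ?TH p) * M ?u y)"
    proof (rule J.I_cong[OF M_cc[OF up]], rule M_eqI[OF up])
      fix g assume g: "g \<in> carrier G"
      have "I (\<lambda>h. ?u ((g \<otimes> h) \<otimes> p)) = I (\<lambda>h. ?u (g \<otimes> (h \<otimes> p)))"
        using topspace_H H_carrier pc g by (intro I.I_cong[OF cc_coset[OF up g]]) (auto simp: m_assoc subset_iff)
      also have "\<dots> = I (\<lambda>h. ?u (g \<otimes> h)) / modular_function ?H ?TH p"
        using I.right_translate[OF _ cc_coset[OF u g], of p] p by simp
      finally show "I (\<lambda>h. ?u ((g \<otimes> h) \<otimes> p)) = (1 / modular_function ?H ?TH p) * M ?u (\<pi> g)"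
        using M_eq[OF u g] by simp
    qed (auto simp: M_out)
    then have b: "J (M (\<lambda>x. ?u (x \<otimes> p))) = (1 / modular_function ?H ?TH p) * J (M ?u)"
      unfolding J.I_cmult[OF M_cc[OF u]] .
    show ?thesis unfolding a JM_cmult[OF up] b by (simp add: L_def)
  qed
  obtain f where f: "f \<in> cc T" "L f \<noteq> 0"
  proof -
    have 1: "compactin T {\<one>}" by (simp add: topspace_eq_carrier)
    have U: "{\<one>} \<subseteq> topspace T" by (simp add: topspace_eq_carrier)
    obtain f K where f: "f \<in> cc T" "\<And>x. x \<in> topspace T \<Longrightarrow> 0 \<le> f x" "\<And>x. x \<in> topspace T \<Longrightarrow> f x \<le> 1"
      "\<And>x. x \<in> {\<one>} \<Longrightarrow> f x = 1" "compactin T K" "K \<subseteq> topspace T" "\<And>x. x \<in> topspace T \<Longrightarrow> x \<notin> K \<Longrightarrow> f x = 0"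
      by (rule cc_bump[OF locally_compact Hausdorff 1 openin_topspace U], rule that)
    have nn: "0 \<le> \<delta> x * f x" if "x \<in> carrier G" for x
      using f(2) \<delta>_pos that by (simp add: topspace_eq_carrier less_imp_le)
    have "I (\<lambda>h. \<delta> (\<one> \<otimes> h) * f (\<one> \<otimes> h)) > 0"
    proof (rule I.strictly_positive[OF cc_coset[OF fc[OF f(1)] one_closed], of "\<one>"])
      show "0 \<le> \<delta> (\<one> \<otimes> h) * f (\<one> \<otimes> h)" if "h \<in> carrier ?H" for h
        using nn[of "\<one> \<otimes> h"] that H_carrier by auto
    qed (use \<delta>_pos f(4) subgroup.one_closed[OF subgroup_H] in auto)
    then have "M (\<lambda>x. \<delta> x * f x) (\<pi> \<one>) > 0" using M_eq[OF fc[OF f(1)] one_closed] by simp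
    moreover have "0 \<le> M (\<lambda>x. \<delta> x * f x) y" for y
    proof (cases "y \<in> \<pi> ` carrier G")
      case True
      then obtain x where x: "x \<in> carrier G" "y = \<pi> x" by blast
      have "0 \<le> I (\<lambda>h. \<delta> (x \<otimes> h) * f (x \<otimes> h))"
        using nn x H_carrier topspace_H by (intro I.I_nonneg[OF cc_coset[OF fc[OF f(1)] x(1)]]) auto
      then show ?thesis using M_eq[OF fc[OF f(1)] x(1)] x by simp
    qed (simp add: M_out)
    ultimately have "L f > 0" unfolding L_def by (intro J_pos M_cc fc f(1))
    then show thesis using that f(1) by force
  qed
  interpret L: left_invariant_functional G T L by (rule L_left)
  interpret L: haar_functional G T L by unfold_locales (use f in blast)
  have "L f / modular_function G T p = L f / (\<delta> p * modular_function ?H ?TH p)"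
    by (rule trans[OF L.right_translate[OF pc f(1), symmetric] L_right[OF f(1)]])
  then show ?thesis
    using f(2) modular_function_gt_0[OF pc] \<delta>_pos[OF pc] LH.modular_function_gt_0[of p] p
    by (auto simp: frac_eq_eq)
qed

end

section \<open>Fiber products\<close>

text \<open>Identifies the fibres of the orbit map with left cosets: the left side compares two
  orbit points, the right side says that a quotient of pairs has equal images.\<close>

lemma (in group) mult_inv_eq_iff:
  assumes "a \<in> carrier G" "b \<in> carrier G" "c \<in> carrier G" "d \<in> carrier G"
  shows "a \<otimes> inv b = c \<otimes> inv d \<longleftrightarrow> inv a \<otimes> c = inv b \<otimes> d"
proof
  assume "a \<otimes> inv b = c \<otimes> inv d"
  then have "inv a \<otimes> (a \<otimes> inv b) \<otimes> d = inv a \<otimes> (c \<otimes> inv d) \<otimes> d" by simp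
  then have "(inv a \<otimes> a) \<otimes> (inv b \<otimes> d) = (inv a \<otimes> c) \<otimes> (inv d \<otimes> d)"
    using assms by (simp only: m_assoc m_closed inv_closed)
  then show "inv a \<otimes> c = inv b \<otimes> d" using assms by simp
next
  assume "inv a \<otimes> c = inv b \<otimes> d"
  then have "a \<otimes> (inv a \<otimes> c) \<otimes> inv d = a \<otimes> (inv b \<otimes> d) \<otimes> inv d" by simp
  then have "(a \<otimes> inv a) \<otimes> (c \<otimes> inv d) = (a \<otimes> inv b) \<otimes> (d \<otimes> inv d)"
    using assms by (simp only: m_assoc m_closed inv_closed)
  then show "a \<otimes> inv b = c \<otimes> inv d" using assms by simp
qed

section \<open>The orbit map on the product group\<close>

locale open_homs = G: locally_compact_group G T + H: locally_compact_group H U + Q: locally_compact_group Q R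
  for G :: "('a, 'm) monoid_scheme" and T and H :: "('b, 'n) monoid_scheme" and U
    and Q :: "('c, 'q) monoid_scheme" and R +
  fixes \<alpha> :: "'a \<Rightarrow> 'c" and \<beta> :: "'b \<Rightarrow> 'c"
  assumes \<alpha>_hom: "\<alpha> \<in> hom G Q" and \<alpha>_continuous: "continuous_map T R \<alpha>" and \<alpha>_open: "open_map T R \<alpha>"
    and \<beta>_hom: "\<beta> \<in> hom H Q" and \<beta>_continuous: "continuous_map U R \<beta>" and \<beta>_open: "open_map U R \<beta>"
begin

sublocale \<alpha>: group_hom G Q \<alpha>
  using \<alpha>_hom by unfold_locales
sublocale \<beta>: group_hom H Q \<beta>
  using \<beta>_hom by unfold_locales
sublocale P: locally_compact_group "G \<times>\<times> H" "prod_topology T U"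
  by (rule locally_compact_group_DirProd) unfold_locales

lemmas topspace_eqs = G.topspace_eq_carrier H.topspace_eq_carrier Q.topspace_eq_carrier

abbreviation F where "F \<equiv> fiber_set G H \<alpha> \<beta>"

lemma subgroup_fiber_set: "subgroup F (G \<times>\<times> H)"
proof
  show "F \<subseteq> carrier (G \<times>\<times> H)" by (auto simp: fiber_set_def)
  show "\<one>\<^bsub>G \<times>\<times> H\<^esub> \<in> F" by (simp add: fiber_set_def)
  show "x \<otimes>\<^bsub>G \<times>\<times> H\<^esub> y \<in> F" if "x \<in> F" "y \<in> F" for x y using that by (auto simp: fiber_set_def)
  show "inv\<^bsub>G \<times>\<times> H\<^esub> x \<in> F" if "x \<in> F" for x
    using that inv_DirProd[OF G.group_axioms H.group_axioms] by (auto simp: fiber_set_def)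
qed

lemma continuous_fst: "continuous_map (prod_topology T U) R (\<lambda>p. \<alpha> (fst p))"
  using continuous_map_compose[OF continuous_map_fst \<alpha>_continuous] by (simp add: o_def)

lemma continuous_snd: "continuous_map (prod_topology T U) R (\<lambda>p. \<beta> (snd p))"
  using continuous_map_compose[OF continuous_map_snd \<beta>_continuous] by (simp add: o_def)

lemma closedin_fiber_set: "closedin (prod_topology T U) F"
proof -
  have "closedin (prod_topology T U) {p \<in> topspace (prod_topology T U). \<alpha> (fst p) = \<beta> (snd p)}"
    using Q.Hausdorff continuous_fst continuous_snd by (rule closedin_continuous_maps_eq)
  moreover have "{p \<in> topspace (prod_topology T U). \<alpha> (fst p) = \<beta> (snd p)} = F"
    by (auto simp: fiber_set_def topspace_eqs)
  ultimately show ?thesis by simp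
qed

definition \<pi> :: "'a \<times> 'b \<Rightarrow> 'c" where
  "\<pi> p = \<alpha> (fst p) \<otimes>\<^bsub>Q\<^esub> inv\<^bsub>Q\<^esub> (\<beta> (snd p))"

lemma \<pi>_mult:
  assumes "s \<in> carrier (G \<times>\<times> H)" "g \<in> carrier (G \<times>\<times> H)"
  shows "\<pi> (s \<otimes>\<^bsub>G \<times>\<times> H\<^esub> g) = \<alpha> (fst s) \<otimes>\<^bsub>Q\<^esub> \<pi> g \<otimes>\<^bsub>Q\<^esub> inv\<^bsub>Q\<^esub> (\<beta> (snd s))"
  using assms by (auto simp: \<pi>_def Q.m_assoc Q.inv_mult_group)

lemma \<pi>_carrier: "g \<in> carrier (G \<times>\<times> H) \<Longrightarrow> \<pi> g \<in> carrier Q"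
  by (auto simp: \<pi>_def)

lemma \<pi>_eq_iff:
  assumes "g \<in> carrier (G \<times>\<times> H)" "g' \<in> carrier (G \<times>\<times> H)"
  shows "\<pi> g = \<pi> g' \<longleftrightarrow> inv\<^bsub>G \<times>\<times> H\<^esub> g \<otimes>\<^bsub>G \<times>\<times> H\<^esub> g' \<in> F"
proof -
  obtain a b where g: "g = (a, b)" "a \<in> carrier G" "b \<in> carrier H" using assms by auto
  obtain c d where g': "g' = (c, d)" "c \<in> carrier G" "d \<in> carrier H" using assms by auto
  have "\<pi> g = \<pi> g' \<longleftrightarrow> inv\<^bsub>Q\<^esub> (\<alpha> a) \<otimes>\<^bsub>Q\<^esub> \<alpha> c = inv\<^bsub>Q\<^esub> (\<beta> b) \<otimes>\<^bsub>Q\<^esub> \<beta> d"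
    using g g' by (simp add: \<pi>_def Q.mult_inv_eq_iff)
  also have "\<dots> \<longleftrightarrow> inv\<^bsub>G \<times>\<times> H\<^esub> g \<otimes>\<^bsub>G \<times>\<times> H\<^esub> g' \<in> F"
    using g g' inv_DirProd[OF G.group_axioms H.group_axioms] by (simp add: fiber_set_def)
  finally show ?thesis .
qed

lemma continuous_\<pi>: "continuous_map (prod_topology T U) R \<pi>"
  unfolding \<pi>_def by (intro Q.continuous_map_mult Q.continuous_map_inverse continuous_fst continuous_snd)

text \<open>Moving the first coordinate alone suffices: a slice \<open>A \<times> {b}\<close> is
  sent to a right translate of the open set \<alpha>(A).\<close>

lemma open_\<pi>: "open_map (prod_topology T U) R \<pi>"
  unfolding open_map_def
proof (intro allI impI)
  fix W assume W: "openin (prod_topology T U) W"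
  show "openin R (\<pi> ` W)"
  proof (subst openin_subopen, rule ballI)
    fix q assume "q \<in> \<pi> ` W"
    then obtain a b where ab: "(a, b) \<in> W" "q = \<pi> (a, b)" by auto
    from openin_prod_topology_alt[THEN iffD1, OF W, rule_format, OF ab(1)]
    obtain A B where AB: "openin T A" "openin U B" "a \<in> A" "b \<in> B" "A \<times> B \<subseteq> W" by blast
    have A: "A \<subseteq> carrier G" using openin_subset[OF AB(1)] by (simp add: topspace_eqs)
    have b: "b \<in> carrier H" using openin_subset[OF AB(2)] AB(4) by (auto simp: topspace_eqs)
    have "openin R (\<alpha> ` A #>\<^bsub>Q\<^esub> inv\<^bsub>Q\<^esub> (\<beta> b))"
      using \<alpha>_open AB(1) b unfolding open_map_def by (intro Q.openin_right) auto
    moreover have "\<alpha> ` A #>\<^bsub>Q\<^esub> inv\<^bsub>Q\<^esub> (\<beta> b) = \<pi> ` (A \<times> {b})"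
      by (force simp: r_coset_image \<pi>_def)
    ultimately show "\<exists>V. openin R V \<and> q \<in> V \<and> V \<subseteq> \<pi> ` W"
      using AB ab by (intro exI[of _ "\<pi> ` (A \<times> {b})"]) auto
  qed
qed

text \<open>The complement of \<open>\<alpha>(G) \<beta>(H)\<close> is, like the set itself, a union of translates of the open
  subgroup \<open>\<beta>(H)\<close>.\<close>

lemma closed_image_\<pi>: "closedin R (\<pi> ` carrier (G \<times>\<times> H))"
proof -
  have "openin R (topspace R - \<pi> ` carrier (G \<times>\<times> H))"
  proof (subst openin_subopen, rule ballI)
    fix q assume q: "q \<in> topspace R - \<pi> ` carrier (G \<times>\<times> H)"
    then have qc: "q \<in> carrier Q" by (simp add: topspace_eqs)
    have "openin U (carrier H)" using openin_topspace[of U] unfolding topspace_eqs .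
    then have "openin R (q <#\<^bsub>Q\<^esub> (\<beta> ` carrier H))"
      using \<beta>_open qc unfolding open_map_def by (intro Q.openin_left) auto
    moreover have "q \<in> q <#\<^bsub>Q\<^esub> (\<beta> ` carrier H)"
      using qc \<beta>.hom_one H.one_closed Q.r_one unfolding l_coset_image by (metis image_eqI)
    moreover have "q <#\<^bsub>Q\<^esub> (\<beta> ` carrier H) \<subseteq> topspace R - \<pi> ` carrier (G \<times>\<times> H)"
    proof
      fix x assume "x \<in> q <#\<^bsub>Q\<^esub> (\<beta> ` carrier H)"
      then obtain b where b: "b \<in> carrier H" "x = q \<otimes>\<^bsub>Q\<^esub> \<beta> b" by (auto simp: l_coset_image)
      have "x \<notin> \<pi> ` carrier (G \<times>\<times> H)"
      proof
        assume "x \<in> \<pi> ` carrier (G \<times>\<times> H)"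
        then obtain c d where cd: "c \<in> carrier G" "d \<in> carrier H" "x = \<alpha> c \<otimes>\<^bsub>Q\<^esub> inv\<^bsub>Q\<^esub> (\<beta> d)" by (auto simp: \<pi>_def)
        have "q = x \<otimes>\<^bsub>Q\<^esub> inv\<^bsub>Q\<^esub> (\<beta> b)" using b qc by (simp add: Q.m_assoc)
        also have "\<dots> = \<pi> (c, b \<otimes>\<^bsub>H\<^esub> d)"
          unfolding cd(3) using b(1) cd(1,2) by (simp add: \<pi>_def Q.m_assoc Q.inv_mult_group)
        finally show False using q b cd by auto
      qed
      then show "x \<in> topspace R - \<pi> ` carrier (G \<times>\<times> H)" using b qc by (simp add: topspace_eqs)
    qed
    ultimately show "\<exists>V. openin R V \<and> q \<in> V \<and> V \<subseteq> topspace R - \<pi> ` carrier (G \<times>\<times> H)" by blast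
  qed
  moreover have "\<pi> ` carrier (G \<times>\<times> H) \<subseteq> topspace R" using \<pi>_carrier by (auto simp: topspace_eqs)
  ultimately show ?thesis by (simp add: closedin_def)
qed

lemma locally_compact_group_fiber_product:
  "locally_compact_group (fiber_product G H \<alpha> \<beta>) (subtopology (prod_topology T U) F)"
  unfolding fiber_product_def by (rule P.closed_subgroup[OF subgroup_fiber_set closedin_fiber_set])

lemma modular_function_fiber_product:
  assumes p: "p \<in> F"
  shows "modular_function G T (fst p) * modular_function H U (snd p) =
    modular_function Q R (\<beta> (snd p)) *
    modular_function (fiber_product G H \<alpha> \<beta>) (subtopology (prod_topology T U) F) p"
proof -
  obtain J where "haar_functional Q R J" using Q.haar_functional_exists by blast
  then interpret J: haar_functional Q R J .
  interpret homogeneous_space "G \<times>\<times> H" "prod_topology T U" R J F \<pi> "\<lambda>s. modular_function Q R (\<beta> (snd s))"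
  proof (intro homogeneous_space.intro homogeneous_space_axioms.intro)
    show "locally_compact_group (G \<times>\<times> H) (prod_topology T U)" by (rule P.locally_compact_group_axioms)
    show "positive_functional R J" by (rule J.positive_functional_axioms)
    show "subgroup F (G \<times>\<times> H)" by (rule subgroup_fiber_set)
    show "closedin (prod_topology T U) F" by (rule closedin_fiber_set)
    show "continuous_map (prod_topology T U) R \<pi>" by (rule continuous_\<pi>)
    show "open_map (prod_topology T U) R \<pi>" by (rule open_\<pi>)
    show "closedin R (\<pi> ` carrier (G \<times>\<times> H))" by (rule closed_image_\<pi>)
    show "\<pi> g = \<pi> g' \<longleftrightarrow> inv\<^bsub>G \<times>\<times> H\<^esub> g \<otimes>\<^bsub>G \<times>\<times> H\<^esub> g' \<in> F"
      if "g \<in> carrier (G \<times>\<times> H)" "g' \<in> carrier (G \<times>\<times> H)" for g g' by (rule \<pi>_eq_iff[OF that])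
    show "continuous_map (prod_topology T U) euclideanreal (\<lambda>s. modular_function Q R (\<beta> (snd s)))"
      using continuous_map_compose[OF continuous_snd Q.continuous_modular_function] by (simp add: o_def)
    show "0 < modular_function Q R (\<beta> (snd s))" if "s \<in> carrier (G \<times>\<times> H)" for s
      using that by (intro Q.modular_function_gt_0) auto
    show "modular_function Q R (\<beta> (snd (s \<otimes>\<^bsub>G \<times>\<times> H\<^esub> t))) =
        modular_function Q R (\<beta> (snd s)) * modular_function Q R (\<beta> (snd t))"
      if "s \<in> carrier (G \<times>\<times> H)" "t \<in> carrier (G \<times>\<times> H)" for s t
      using that by (auto simp: Q.modular_function_mult)
    show "0 < J f" if "f \<in> cc R" "\<And>y. y \<in> topspace R \<Longrightarrow> 0 \<le> f y" "0 < f (\<pi> \<one>\<^bsub>G \<times>\<times> H\<^esub>)" for f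
      using that \<pi>_carrier[OF P.one_closed] by (intro J.strictly_positive[of f "\<pi> \<one>\<^bsub>G \<times>\<times> H\<^esub>"]) (auto simp: topspace_eqs)
    fix s f f' assume s: "s \<in> carrier (G \<times>\<times> H)" and f: "f \<in> cc R" and f': "f' \<in> cc R"
      and eq: "\<And>g. g \<in> carrier (G \<times>\<times> H) \<Longrightarrow> f' (\<pi> g) = f (\<pi> (s \<otimes>\<^bsub>G \<times>\<times> H\<^esub> g))"
      and out: "\<And>y. y \<in> topspace R - \<pi> ` carrier (G \<times>\<times> H) \<Longrightarrow> f y = 0 \<and> f' y = 0"
    obtain a b where ab: "s = (a, b)" "a \<in> carrier G" "b \<in> carrier H" using s by auto
    let ?b = "inv\<^bsub>Q\<^esub> (\<beta> b)"
    have b: "?b \<in> carrier Q" and a: "\<alpha> a \<in> carrier Q" using ab by auto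
    \<comment> \<open>On the orbit this is equivariance of \<open>\<pi>\<close>. Off the orbit both
      functions vanish, since the action preserves the complement of the orbit; the identity thus
      holds on all of \<open>Q\<close>.\<close>
    have "J f' = J (\<lambda>q. f (\<alpha> a \<otimes>\<^bsub>Q\<^esub> q \<otimes>\<^bsub>Q\<^esub> ?b))"
    proof (rule J.I_cong[OF f'])
      fix q assume "q \<in> topspace R"
      then have q: "q \<in> carrier Q" by (simp add: topspace_eqs)
      show "f' q = f (\<alpha> a \<otimes>\<^bsub>Q\<^esub> q \<otimes>\<^bsub>Q\<^esub> ?b)"
      proof (cases "q \<in> \<pi> ` carrier (G \<times>\<times> H)")
        case True
        then obtain g where g: "g \<in> carrier (G \<times>\<times> H)" "q = \<pi> g" by blast
        then show ?thesis using eq[OF g(1)] \<pi>_mult[OF s g(1)] by (simp add: ab)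
      next
        case False
        have "\<alpha> a \<otimes>\<^bsub>Q\<^esub> q \<otimes>\<^bsub>Q\<^esub> ?b \<notin> \<pi> ` carrier (G \<times>\<times> H)"
        proof
          assume "\<alpha> a \<otimes>\<^bsub>Q\<^esub> q \<otimes>\<^bsub>Q\<^esub> ?b \<in> \<pi> ` carrier (G \<times>\<times> H)"
          then obtain g where g: "g \<in> carrier (G \<times>\<times> H)" "\<pi> g = \<alpha> a \<otimes>\<^bsub>Q\<^esub> q \<otimes>\<^bsub>Q\<^esub> ?b" by force
          have "\<pi> (inv\<^bsub>G \<times>\<times> H\<^esub> s \<otimes>\<^bsub>G \<times>\<times> H\<^esub> g) =
              \<alpha> (inv\<^bsub>G\<^esub> a) \<otimes>\<^bsub>Q\<^esub> (\<alpha> a \<otimes>\<^bsub>Q\<^esub> q \<otimes>\<^bsub>Q\<^esub> ?b) \<otimes>\<^bsub>Q\<^esub> inv\<^bsub>Q\<^esub> (\<beta> (inv\<^bsub>H\<^esub> b))"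
            using \<pi>_mult[OF P.inv_closed[OF s] g(1)] inv_DirProd[OF G.group_axioms H.group_axioms] ab g(2) by simp
          also have "\<dots> = (inv\<^bsub>Q\<^esub> (\<alpha> a) \<otimes>\<^bsub>Q\<^esub> \<alpha> a) \<otimes>\<^bsub>Q\<^esub> q \<otimes>\<^bsub>Q\<^esub> (?b \<otimes>\<^bsub>Q\<^esub> \<beta> b)"
            using ab q a b by (simp only: \<alpha>.hom_inv \<beta>.hom_inv Q.inv_inv Q.m_assoc Q.m_closed Q.inv_closed \<beta>.hom_closed)
          also have "\<dots> = q" using ab q a b by simp
          finally have "q = \<pi> (inv\<^bsub>G \<times>\<times> H\<^esub> s \<otimes>\<^bsub>G \<times>\<times> H\<^esub> g)" by simp
          then show False using False s g by blast
        qed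
        then show ?thesis using out[of q] out[of "\<alpha> a \<otimes>\<^bsub>Q\<^esub> q \<otimes>\<^bsub>Q\<^esub> ?b"] False q a b by (simp add: topspace_eqs)
      qed
    qed
    also have "\<dots> = J (\<lambda>q. f (q \<otimes>\<^bsub>Q\<^esub> ?b))" by (rule J.left_invariant[OF a Q.cc_right[OF f b]])
    \<comment> \<open>The left translation has been absorbed at no cost. The right translation by
      the inverse of \<beta>(b) divides by the modulus of that inverse, hence multiplies by the
      modulus of \<beta>(b).\<close>
    also have "\<dots> = modular_function Q R (\<beta> (snd s)) * J f"
      using J.right_translate[OF b f] Q.modular_function_inv[of "\<beta> b"] ab by simp
    finally show "J f' = modular_function Q R (\<beta> (snd s)) * J f" .
  qed
  have "fst p \<in> carrier G" "snd p \<in> carrier H" using p by (auto simp: fiber_set_def)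
  then have "modular_function (G \<times>\<times> H) (prod_topology T U) p = modular_function G T (fst p) * modular_function H U (snd p)"
    using modular_function_DirProd[OF G.locally_compact_group_axioms H.locally_compact_group_axioms, of "fst p" "snd p"] by simp
  then show ?thesis
    using modular_function_subgroup[OF p] by (simp add: fiber_product_def)
qed

section \<open>Transfer of open kernels in both directions\<close>

lemma almost_unimodular_fiber_product:
  assumes G: "openin T (modular_kernel G T)" and H: "openin U (modular_kernel H U)" and Q: "openin R (modular_kernel Q R)"
  shows "almost_unimodular (fiber_product G H \<alpha> \<beta>) (subtopology (prod_topology T U) F)"
proof -
  let ?P = "fiber_product G H \<alpha> \<beta>" and ?T = "subtopology (prod_topology T U) F"
  interpret F: locally_compact_group ?P ?T by (rule locally_compact_group_fiber_product)
  \<comment> \<open>On \<open>W \<inter> F\<close> three of the four moduli in the product formula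
    equal 1, which forces the fourth.\<close>
  define W where "W = modular_kernel G T \<times> modular_kernel H U \<inter>
    {p \<in> topspace (prod_topology T U). \<beta> (snd p) \<in> modular_kernel Q R}"
  have W: "openin (prod_topology T U) W"
    unfolding W_def using G H openin_continuous_map_preimage[OF continuous_snd Q]
    by (intro openin_Int) (auto simp: openin_prod_Times_iff)
  have "openin ?T (modular_kernel ?P ?T)"
    unfolding F.openin_modular_kernel_iff
  proof (intro exI conjI)
    show "openin ?T (W \<inter> F)" using W by (auto simp: openin_subtopology)
    show "\<one>\<^bsub>?P\<^esub> \<in> W \<inter> F"
      by (simp add: W_def fiber_product_def fiber_set_def modular_kernel_def topspace_eqs
          G.modular_function_one H.modular_function_one Q.modular_function_one)
    show "W \<inter> F \<subseteq> modular_kernel ?P ?T"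
    proof
      fix p assume p: "p \<in> W \<inter> F"
      then have "modular_function G T (fst p) = 1" "modular_function H U (snd p) = 1" "modular_function Q R (\<beta> (snd p)) = 1"
        by (auto simp: W_def modular_kernel_def)
      then show "p \<in> modular_kernel ?P ?T"
        using modular_function_fiber_product[of p] p by (simp add: modular_kernel_def fiber_product_def)
    qed
  qed
  then show ?thesis using F.locally_compact_group_axioms by (simp add: almost_unimodular_def)
qed

text \<open>A point of \<alpha>(A') \<inter> \<beta>(B') is \<alpha>(a) = \<beta>(b) for some
  \<open>a\<close> and \<open>b\<close>, so \<open>(a, b)\<close> lies in the fiber set and in
  \<open>W\<close>. Its moduli in both factors and in the fiber product are 1, so that of the point
  is 1; openness of both maps makes the intersection a neighbourhood of the identity.\<close>

lemma almost_unimodular_base: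
  assumes G: "openin T (modular_kernel G T)" and H: "openin U (modular_kernel H U)"
    and P: "almost_unimodular (fiber_product G H \<alpha> \<beta>) (subtopology (prod_topology T U) F)"
  shows "almost_unimodular Q R"
proof -
  let ?P = "fiber_product G H \<alpha> \<beta>" and ?T = "subtopology (prod_topology T U) F"
  interpret F: locally_compact_group ?P ?T by (rule locally_compact_group_fiber_product)
  have "openin ?T (modular_kernel ?P ?T)" using P by (simp add: almost_unimodular_def)
  then obtain W where W: "openin (prod_topology T U) W" "modular_kernel ?P ?T = W \<inter> F"
    by (auto simp: openin_subtopology)
  have "\<one>\<^bsub>?P\<^esub> \<in> modular_kernel ?P ?T" by (simp add: modular_kernel_def F.modular_function_one)
  then have "(\<one>\<^bsub>G\<^esub>, \<one>\<^bsub>H\<^esub>) \<in> W" using W by (simp add: fiber_product_def)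
  from openin_prod_topology_alt[THEN iffD1, OF W(1), rule_format, OF this]
  obtain A B where AB: "openin T A" "openin U B" "\<one>\<^bsub>G\<^esub> \<in> A" "\<one>\<^bsub>H\<^esub> \<in> B" "A \<times> B \<subseteq> W" by blast
  define A' where "A' = A \<inter> modular_kernel G T"
  define B' where "B' = B \<inter> modular_kernel H U"
  have "openin R (modular_kernel Q R)"
    unfolding Q.openin_modular_kernel_iff
  proof (intro exI conjI)
    show "openin R (\<alpha> ` A' \<inter> \<beta> ` B')"
      using \<alpha>_open \<beta>_open AB G H unfolding open_map_def A'_def B'_def by (intro openin_Int) auto
    have "\<one>\<^bsub>G\<^esub> \<in> A'" "\<one>\<^bsub>H\<^esub> \<in> B'"
      using AB by (auto simp: A'_def B'_def modular_kernel_def G.modular_function_one H.modular_function_one)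
    then show "\<one>\<^bsub>Q\<^esub> \<in> \<alpha> ` A' \<inter> \<beta> ` B'"
      using \<alpha>.hom_one \<beta>.hom_one by (metis IntI image_eqI)
    show "\<alpha> ` A' \<inter> \<beta> ` B' \<subseteq> modular_kernel Q R"
    proof
      fix q assume "q \<in> \<alpha> ` A' \<inter> \<beta> ` B'"
      then obtain a b where ab: "a \<in> A'" "b \<in> B'" "q = \<alpha> a" "q = \<beta> b" by blast
      have c: "a \<in> carrier G" "b \<in> carrier H" using ab by (auto simp: A'_def B'_def modular_kernel_def)
      have p: "(a, b) \<in> F" using ab c by (simp add: fiber_set_def)
      then have "(a, b) \<in> modular_kernel ?P ?T" using W(2) AB(5) ab by (auto simp: A'_def B'_def)
      then show "q \<in> modular_kernel Q R"
        using modular_function_fiber_product[OF p] ab c by (auto simp: A'_def B'_def modular_kernel_def)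
    qed
  qed
  then show ?thesis using Q.locally_compact_group_axioms by (simp add: almost_unimodular_def)
qed

end

theorem proposition3p8:
  fixes G\<^sub>1 :: "('a, 'm) monoid_scheme" and T\<^sub>1 :: "'a topology"
    and G\<^sub>2 :: "('b, 'n) monoid_scheme" and T\<^sub>2 :: "'b topology"
    and Q :: "('c, 'q) monoid_scheme" and T\<^sub>Q :: "'c topology"
    and \<theta>\<^sub>1 :: "'a \<Rightarrow> 'c" and \<theta>\<^sub>2 :: "'b \<Rightarrow> 'c"
  assumes "locally_compact_group Q T\<^sub>Q"
    and "almost_unimodular G\<^sub>1 T\<^sub>1" and "almost_unimodular G\<^sub>2 T\<^sub>2"
    and "\<theta>\<^sub>1 \<in> hom G\<^sub>1 Q" and "continuous_map T\<^sub>1 T\<^sub>Q \<theta>\<^sub>1" and "open_map T\<^sub>1 T\<^sub>Q \<theta>\<^sub>1"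
    and "\<theta>\<^sub>2 \<in> hom G\<^sub>2 Q" and "continuous_map T\<^sub>2 T\<^sub>Q \<theta>\<^sub>2" and "open_map T\<^sub>2 T\<^sub>Q \<theta>\<^sub>2"
  shows "(almost_unimodular Q T\<^sub>Q \<longrightarrow>
            almost_unimodular (fiber_product G\<^sub>1 G\<^sub>2 \<theta>\<^sub>1 \<theta>\<^sub>2)
              (subtopology (prod_topology T\<^sub>1 T\<^sub>2) (fiber_set G\<^sub>1 G\<^sub>2 \<theta>\<^sub>1 \<theta>\<^sub>2))) \<and>
         (\<theta>\<^sub>1 ` carrier G\<^sub>1 = carrier Q \<and> \<theta>\<^sub>2 ` carrier G\<^sub>2 = carrier Q \<longrightarrow>
            almost_unimodular (fiber_product G\<^sub>1 G\<^sub>2 \<theta>\<^sub>1 \<theta>\<^sub>2)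
              (subtopology (prod_topology T\<^sub>1 T\<^sub>2) (fiber_set G\<^sub>1 G\<^sub>2 \<theta>\<^sub>1 \<theta>\<^sub>2)) \<longrightarrow>
            almost_unimodular Q T\<^sub>Q)"
proof -
  have G1: "locally_compact_group G\<^sub>1 T\<^sub>1" "openin T\<^sub>1 (modular_kernel G\<^sub>1 T\<^sub>1)"
    and G2: "locally_compact_group G\<^sub>2 T\<^sub>2" "openin T\<^sub>2 (modular_kernel G\<^sub>2 T\<^sub>2)"
    using assms(2,3) by (simp_all add: almost_unimodular_def)
  interpret open_homs G\<^sub>1 T\<^sub>1 G\<^sub>2 T\<^sub>2 Q T\<^sub>Q \<theta>\<^sub>1 \<theta>\<^sub>2
    using assms(1,4-9) G1(1) G2(1) by (intro open_homs.intro open_homs_axioms.intro)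
  show ?thesis
  proof (intro conjI impI)
    assume "almost_unimodular Q T\<^sub>Q"
    then show "almost_unimodular (fiber_product G\<^sub>1 G\<^sub>2 \<theta>\<^sub>1 \<theta>\<^sub>2)
        (subtopology (prod_topology T\<^sub>1 T\<^sub>2) (fiber_set G\<^sub>1 G\<^sub>2 \<theta>\<^sub>1 \<theta>\<^sub>2))"
      by (intro almost_unimodular_fiber_product G1(2) G2(2)) (simp add: almost_unimodular_def)
  next
    assume "almost_unimodular (fiber_product G\<^sub>1 G\<^sub>2 \<theta>\<^sub>1 \<theta>\<^sub>2)
        (subtopology (prod_topology T\<^sub>1 T\<^sub>2) (fiber_set G\<^sub>1 G\<^sub>2 \<theta>\<^sub>1 \<theta>\<^sub>2))"
    then show "almost_unimodular Q T\<^sub>Q" by (rule almost_unimodular_base[OF G1(2) G2(2)])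
  qed
qed

end
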